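(* Let $R$ be a commutative ring with unity such that $R = 2R$, and let $I$ be an ideal of $R$. Let $(P, \langle\ ,\ \rangle)$ be a locally split orthogonal $R$-module with $P$ of rank $2n$, $n \geq 2$, and let $Q = R^2 \oplus P$ with the form induced from $\mathbb{H}(R) \oplus P$. Then $\operatorname{ETrans}_{\operatorname{O}}(Q, IQ, \langle\ ,\ \rangle)$ is a normal subgroup of $\operatorname{O}(Q)$.
   Context: An orthogonal $R$-module is a pair $(P,\langle\ ,\ \rangle)$ where $P$ is a finitely generated projective $R$-module of even rank and $\langle\ ,\ \rangle:P\times P\to R$ is a symmetric bilinear form that is non-degenerate, i.e. $x\mapsto\langle x,-\rangle$ is an isomorphism $P\cong P^{*}=\operatorname{Hom}_R(P,R)$. An isometry is an $R$-linear automorphism preserving the form; $\operatorname{O}(P)$ denotes the group of isometries of $(P,\langle\ ,\ \rangle)$. An orthogonal $R$-module $(P,\langle\ ,\ \rangle)$ is split if there is a submodule $N\subseteq P$ which is a direct summand of $P$ and satisfies $N=N^{\perp}=\{p\in P:\langle p,x\rangle=0 \text{ for all } x\in N\}$. It is locally split if $(P_{\mathfrak m},\langle\ ,\ \rangle)$ is a split orthogonal $R_{\mathfrak m}$-module for every maximal ideal $\mathfrak m$ of $R$. $\mathbb{H}(R)=R\oplus R^{*}$ carries the form $\langle(a_1,f_1),(a_2,f_2)\rangle=f_2(a_1)+f_1(a_2)$. $Q=R^2\oplus P$ is given the orthogonal sum form of $\mathbb{H}(R)\oplus P$ (identifying $R^*$ with $R$), so $\langle(a,b,p),(c,d,r)\rangle=ad+bc+\langle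 p,r\rangle$; this makes $Q$ an orthogonal $R$-module. An element $q\in P$ is isotropic if $\langle q,q\rangle=0$. For isotropic $q\in P$, the elementary orthogonal transvections of $Q$ are the isometries $$\rho(q):(a,b,p)\mapsto(a,\ b+\langle p,q\rangle,\ p-aq),\qquad \mu(q):(a,b,p)\mapsto(a+\langle p,q\rangle,\ b,\ p-bq).$$ $\operatorname{ETrans}_{\operatorname{O}}(Q,\langle\ ,\ \rangle)$ is the subgroup of $\operatorname{O}(Q)$ generated by all $\rho(q),\mu(q)$ with $q\in P$ isotropic. $\operatorname{ETrans}_{\operatorname{O}}(IQ,\langle\ ,\ \rangle)$ is the subgroup generated by those $\rho(q),\mu(q)$ with $q\in IP$ isotropic. $\operatorname{ETrans}_{\operatorname{O}}(Q,IQ,\langle\ ,\ \rangle)$ is the normal closure of $\operatorname{ETrans}_{\operatorname{O}}(IQ,\langle\ ,\ \rangle)$ in $\operatorname{ETrans}_{\operatorname{O}}(Q,\langle\ ,\ \rangle)$. *)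

theory Defs
  imports "HOL-Algebra.Algebra"
begin

section \<open>Modules\<close>

text \<open>
  The \<open>mult\<close> and \<open>one\<close> fields that module records inherit from ring records carry no meaning for
  modules.
\<close>

definition module_hom ::
  "('a, 'r) ring_scheme \<Rightarrow> ('a, 'b, 'm) module_scheme \<Rightarrow> ('a, 'c, 'k) module_scheme \<Rightarrow> ('b \<Rightarrow> 'c) set"
  where "module_hom R M N =
    {f \<in> carrier M \<rightarrow> carrier N.
       (\<forall>x\<in>carrier M. \<forall>y\<in>carrier M. f (x \<oplus>\<^bsub>M\<^esub> y) = f x \<oplus>\<^bsub>N\<^esub> f y) \<and>
       (\<forall>a\<in>carrier R. \<forall>x\<in>carrier M. f (a \<odot>\<^bsub>M\<^esub> x) = a \<odot>\<^bsub>N\<^esub> f x)}"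

definition regular_module :: "('a, 'r) ring_scheme \<Rightarrow> ('a, 'a) module"
  where "regular_module R =
    \<lparr>carrier = carrier R, monoid.mult = (\<otimes>\<^bsub>R\<^esub>), one = \<one>\<^bsub>R\<^esub>, ring.zero = \<zero>\<^bsub>R\<^esub>, ring.add = (\<oplus>\<^bsub>R\<^esub>), smult = (\<otimes>\<^bsub>R\<^esub>)\<rparr>"

definition free_module :: "('a, 'r) ring_scheme \<Rightarrow> nat \<Rightarrow> ('a, nat \<Rightarrow> 'a) module"
  where "free_module R n =
    \<lparr>carrier = {..<n} \<rightarrow>\<^sub>E carrier R,
     monoid.mult = undefined,
     one = undefined,
     ring.zero = (\<lambda>i\<in>{..<n}. \<zero>\<^bsub>R\<^esub>),
     ring.add = (\<lambda>x y. \<lambda>i\<in>{..<n}. x i \<oplus>\<^bsub>R\<^esub> y i),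
     smult = (\<lambda>a x. \<lambda>i\<in>{..<n}. a \<otimes>\<^bsub>R\<^esub> x i)\<rparr>"

text \<open>Finitely generated projective means direct summand, i.e. retract, of some \<open>R\<^sup>k\<close>.\<close>

definition fg_projective :: "('a, 'r) ring_scheme \<Rightarrow> ('a, 'b, 'm) module_scheme \<Rightarrow> bool"
  where "fg_projective R M \<longleftrightarrow>
    (\<exists>k. \<exists>s \<in> module_hom R M (free_module R k). \<exists>p \<in> module_hom R (free_module R k) M.
       \<forall>x\<in>carrier M. p (s x) = x)"

definition free_of_rank :: "('a, 'r) ring_scheme \<Rightarrow> ('a, 'b, 'm) module_scheme \<Rightarrow> nat \<Rightarrow> bool"
  where "free_of_rank R M r \<longleftrightarrow>
    (\<exists>f \<in> module_hom R (free_module R r) M. bij_betw f (carrier (free_module R r)) (carrier M))"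

definition dual :: "('a, 'r) ring_scheme \<Rightarrow> ('a, 'b, 'm) module_scheme \<Rightarrow> ('b \<Rightarrow> 'a) set"
  where "dual R M = module_hom R M (regular_module R) \<inter> extensional (carrier M)"

definition direct_summand ::
  "'b set \<Rightarrow> ('a, 'r) ring_scheme \<Rightarrow> ('a, 'b, 'm) module_scheme \<Rightarrow> bool"
  where "direct_summand N R M \<longleftrightarrow>
    submodule N R M \<and>
    (\<exists>N'. submodule N' R M \<and> N \<inter> N' = {\<zero>\<^bsub>M\<^esub>} \<and> N <+>\<^bsub>M\<^esub> N' = carrier M)"

definition ideal_times_module ::
  "'a set \<Rightarrow> ('a, 'b, 'm) module_scheme \<Rightarrow> 'b set"
  where "ideal_times_module I M = generate (add_monoid M) {a \<odot>\<^bsub>M\<^esub> x | a x. a \<in> I \<and> x \<in> carrier M}"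


section \<open>Localization\<close>

text \<open>
  Here \<open>S\<close> is a multiplicative subset of \<open>R\<close>, and \<open>fraction R S M x s\<close> is the element \<open>x/s\<close> of
  \<open>S\<^sup>-\<^sup>1M\<close>, i.e. the equivalence class of \<open>(x, s)\<close> in \<open>M \<times> S\<close>.  The operations are defined
  as unions over representatives, as is usual for quotients: all the classes
  in such a union coincide.
\<close>

definition fraction ::
  "('a, 'r) ring_scheme \<Rightarrow> 'a set \<Rightarrow> ('a, 'b, 'm) module_scheme \<Rightarrow> 'b \<Rightarrow> 'a \<Rightarrow> ('b \<times> 'a) set"
  where "fraction R S M x s =
    {(y, t). y \<in> carrier M \<and> t \<in> S \<and> (\<exists>u\<in>S. u \<odot>\<^bsub>M\<^esub> (t \<odot>\<^bsub>M\<^esub> x) = u \<odot>\<^bsub>M\<^esub> (s \<odot>\<^bsub>M\<^esub> y))}"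

definition localized_module ::
  "('a, 'r) ring_scheme \<Rightarrow> 'a set \<Rightarrow> ('a, 'b, 'm) module_scheme \<Rightarrow> (('a \<times> 'a) set, ('b \<times> 'a) set) module"
  where "localized_module R S M =
    \<lparr>carrier = {fraction R S M x s | x s. x \<in> carrier M \<and> s \<in> S},
     monoid.mult = undefined,
     one = undefined,
     ring.zero = fraction R S M \<zero>\<^bsub>M\<^esub> \<one>\<^bsub>R\<^esub>,
     ring.add = (\<lambda>V W. \<Union>(x, s)\<in>V. \<Union>(y, t)\<in>W.
       fraction R S M (t \<odot>\<^bsub>M\<^esub> x \<oplus>\<^bsub>M\<^esub> s \<odot>\<^bsub>M\<^esub> y) (s \<otimes>\<^bsub>R\<^esub> t)),
     smult = (\<lambda>A V. \<Union>(a, s)\<in>A. \<Union>(x, t)\<in>V.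
       fraction R S M (a \<odot>\<^bsub>M\<^esub> x) (s \<otimes>\<^bsub>R\<^esub> t))\<rparr>"

definition localized_ring :: "('a, 'r) ring_scheme \<Rightarrow> 'a set \<Rightarrow> ('a \<times> 'a) set ring"
  where "localized_ring R S =
    \<lparr>carrier = carrier (localized_module R S (regular_module R)),
     monoid.mult = smult (localized_module R S (regular_module R)),
     one = fraction R S (regular_module R) \<one>\<^bsub>R\<^esub> \<one>\<^bsub>R\<^esub>,
     ring.zero = \<zero>\<^bsub>localized_module R S (regular_module R)\<^esub>,
     ring.add = (\<oplus>\<^bsub>localized_module R S (regular_module R)\<^esub>)\<rparr>"

definition localized_form ::
  "('a, 'r) ring_scheme \<Rightarrow> 'a set \<Rightarrow> ('b \<Rightarrow> 'b \<Rightarrow> 'a) \<Rightarrow> ('b \<times> 'a) set \<Rightarrow> ('b \<times> 'a) set \<Rightarrow> ('a \<times> 'a) set"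
  where "localized_form R S B V W =
    (\<Union>(x, s)\<in>V. \<Union>(y, t)\<in>W. fraction R S (regular_module R) (B x y) (s \<otimes>\<^bsub>R\<^esub> t))"

text \<open>Constant rank \<open>r\<close>: the localization at each prime ideal is free of rank \<open>r\<close>.\<close>

definition has_rank :: "('a, 'r) ring_scheme \<Rightarrow> ('a, 'b, 'm) module_scheme \<Rightarrow> nat \<Rightarrow> bool"
  where "has_rank R M r \<longleftrightarrow>
    (\<forall>\<pp>. primeideal \<pp> R \<longrightarrow>
       free_of_rank (localized_ring R (carrier R - \<pp>)) (localized_module R (carrier R - \<pp>) M) r)"


section \<open>Orthogonal modules\<close>

locale orthogonal_module = module R P for R (structure) and P (structure) +
  fixes B :: "'c \<Rightarrow> 'c \<Rightarrow> 'a"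
  assumes fg_projective: "fg_projective R P"
    and even_rank: "\<exists>k. has_rank R P (2 * k)"
    and linear: "x \<in> carrier P \<Longrightarrow> B x \<in> module_hom R P (regular_module R)"
    and symmetric: "x \<in> carrier P \<Longrightarrow> y \<in> carrier P \<Longrightarrow> B x y = B y x"
    and nondegenerate: "bij_betw (\<lambda>x. restrict (B x) (carrier P)) (carrier P) (dual R P)"

definition orthogonal_complement ::
  "('a, 'r) ring_scheme \<Rightarrow> ('a, 'b, 'm) module_scheme \<Rightarrow> ('b \<Rightarrow> 'b \<Rightarrow> 'a) \<Rightarrow> 'b set \<Rightarrow> 'b set"
  where "orthogonal_complement R P B N = {p \<in> carrier P. \<forall>x\<in>N. B p x = \<zero>\<^bsub>R\<^esub>}"

definition split_orthogonal_module ::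
  "('a, 'r) ring_scheme \<Rightarrow> ('a, 'b, 'm) module_scheme \<Rightarrow> ('b \<Rightarrow> 'b \<Rightarrow> 'a) \<Rightarrow> bool"
  where "split_orthogonal_module R P B \<longleftrightarrow>
    orthogonal_module R P B \<and>
    (\<exists>N. direct_summand N R P \<and> N = orthogonal_complement R P B N)"

definition locally_split_orthogonal_module ::
  "('a, 'r) ring_scheme \<Rightarrow> ('a, 'b, 'm) module_scheme \<Rightarrow> ('b \<Rightarrow> 'b \<Rightarrow> 'a) \<Rightarrow> bool"
  where "locally_split_orthogonal_module R P B \<longleftrightarrow>
    orthogonal_module R P B \<and>
    (\<forall>\<mm>. maximalideal \<mm> R \<longrightarrow>
       split_orthogonal_module
         (localized_ring R (carrier R - \<mm>))
         (localized_module R (carrier R - \<mm>) P)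
         (localized_form R (carrier R - \<mm>) B))"

definition orthogonal_group ::
  "('a, 'r) ring_scheme \<Rightarrow> ('a, 'b, 'm) module_scheme \<Rightarrow> ('b \<Rightarrow> 'b \<Rightarrow> 'a) \<Rightarrow> ('b \<Rightarrow> 'b) monoid"
  where "orthogonal_group R P B =
    (BijGroup (carrier P))
      \<lparr>carrier := {f \<in> Bij (carrier P). f \<in> module_hom R P P \<and>
         (\<forall>x\<in>carrier P. \<forall>y\<in>carrier P. B (f x) (f y) = B x y)}\<rparr>"


section \<open>The module \<open>R\<^sup>2 \<oplus> P\<close> and its elementary transvections\<close>

definition hyperbolic_sum ::
  "('a, 'r) ring_scheme \<Rightarrow> ('a, 'b, 'm) module_scheme \<Rightarrow> ('a, 'a \<times> 'a \<times> 'b) module"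
  where "hyperbolic_sum R P =
    \<lparr>carrier = carrier R \<times> carrier R \<times> carrier P,
     monoid.mult = undefined,
     one = undefined,
     ring.zero = (\<zero>\<^bsub>R\<^esub>, \<zero>\<^bsub>R\<^esub>, \<zero>\<^bsub>P\<^esub>),
     ring.add = (\<lambda>(a, b, p) (c, d, r). (a \<oplus>\<^bsub>R\<^esub> c, b \<oplus>\<^bsub>R\<^esub> d, p \<oplus>\<^bsub>P\<^esub> r)),
     smult = (\<lambda>u (a, b, p). (u \<otimes>\<^bsub>R\<^esub> a, u \<otimes>\<^bsub>R\<^esub> b, u \<odot>\<^bsub>P\<^esub> p))\<rparr>"

definition hyperbolic_form ::
  "('a, 'r) ring_scheme \<Rightarrow> ('b \<Rightarrow> 'b \<Rightarrow> 'a) \<Rightarrow> 'a \<times> 'a \<times> 'b \<Rightarrow> 'a \<times> 'a \<times> 'b \<Rightarrow> 'a"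
  where "hyperbolic_form R B =
    (\<lambda>(a, b, p) (c, d, r). a \<otimes>\<^bsub>R\<^esub> d \<oplus>\<^bsub>R\<^esub> b \<otimes>\<^bsub>R\<^esub> c \<oplus>\<^bsub>R\<^esub> B p r)"

definition rho ::
  "('a, 'r) ring_scheme \<Rightarrow> ('a, 'b, 'm) module_scheme \<Rightarrow> ('b \<Rightarrow> 'b \<Rightarrow> 'a) \<Rightarrow> 'b \<Rightarrow>
    'a \<times> 'a \<times> 'b \<Rightarrow> 'a \<times> 'a \<times> 'b"
  where "rho R P B q =
    restrict (\<lambda>(a, b, p). (a, b \<oplus>\<^bsub>R\<^esub> B p q, p \<ominus>\<^bsub>P\<^esub> a \<odot>\<^bsub>P\<^esub> q)) (carrier (hyperbolic_sum R P))"

definition mu ::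
  "('a, 'r) ring_scheme \<Rightarrow> ('a, 'b, 'm) module_scheme \<Rightarrow> ('b \<Rightarrow> 'b \<Rightarrow> 'a) \<Rightarrow> 'b \<Rightarrow>
    'a \<times> 'a \<times> 'b \<Rightarrow> 'a \<times> 'a \<times> 'b"
  where "mu R P B q =
    restrict (\<lambda>(a, b, p). (a \<oplus>\<^bsub>R\<^esub> B p q, b, p \<ominus>\<^bsub>P\<^esub> b \<odot>\<^bsub>P\<^esub> q)) (carrier (hyperbolic_sum R P))"

definition isotropic :: "('a, 'r) ring_scheme \<Rightarrow> ('b \<Rightarrow> 'b \<Rightarrow> 'a) \<Rightarrow> 'b \<Rightarrow> bool"
  where "isotropic R B q \<longleftrightarrow> B q q = \<zero>\<^bsub>R\<^esub>"

text \<open>\<open>O(Q)\<close> for \<open>Q = R\<^sup>2 \<oplus> P\<close>.\<close>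

abbreviation O_Q ::
  "('a, 'r) ring_scheme \<Rightarrow> ('a, 'b, 'm) module_scheme \<Rightarrow> ('b \<Rightarrow> 'b \<Rightarrow> 'a) \<Rightarrow>
    ('a \<times> 'a \<times> 'b \<Rightarrow> 'a \<times> 'a \<times> 'b) monoid"
  where "O_Q R P B \<equiv> orthogonal_group R (hyperbolic_sum R P) (hyperbolic_form R B)"

text \<open>
  The subgroup of \<open>O(Q)\<close> generated by the \<open>\<rho>(q)\<close>, \<open>\<mu>(q)\<close> with \<open>q\<close> isotropic in a given subset \<open>V\<close>
  of \<open>P\<close>.  It is \<open>ETrans\<^sub>O(Q)\<close> for \<open>V = P\<close> and \<open>ETrans\<^sub>O(IQ)\<close> for \<open>V = IP\<close>.
\<close>

definition ETrans_on ::
  "('a, 'r) ring_scheme \<Rightarrow> ('a, 'b, 'm) module_scheme \<Rightarrow> ('b \<Rightarrow> 'b \<Rightarrow> 'a) \<Rightarrow> 'b set \<Rightarrow>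
    ('a \<times> 'a \<times> 'b \<Rightarrow> 'a \<times> 'a \<times> 'b) set"
  where "ETrans_on R P B V =
    generate (O_Q R P B)
      ({rho R P B q | q. q \<in> V \<and> isotropic R B q} \<union> {mu R P B q | q. q \<in> V \<and> isotropic R B q})"

definition ETrans ::
  "('a, 'r) ring_scheme \<Rightarrow> ('a, 'b, 'm) module_scheme \<Rightarrow> ('b \<Rightarrow> 'b \<Rightarrow> 'a) \<Rightarrow>
    ('a \<times> 'a \<times> 'b \<Rightarrow> 'a \<times> 'a \<times> 'b) set"
  where "ETrans R P B = ETrans_on R P B (carrier P)"

definition ETrans_ideal ::
  "('a, 'r) ring_scheme \<Rightarrow> ('a, 'b, 'm) module_scheme \<Rightarrow> ('b \<Rightarrow> 'b \<Rightarrow> 'a) \<Rightarrow> 'a set \<Rightarrow>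
    ('a \<times> 'a \<times> 'b \<Rightarrow> 'a \<times> 'a \<times> 'b) set"
  where "ETrans_ideal R P B I = ETrans_on R P B (ideal_times_module I P)"

definition normal_closure :: "('g, 'k) monoid_scheme \<Rightarrow> 'g set \<Rightarrow> 'g set"
  where "normal_closure G H = \<Inter>{N. N \<lhd> G \<and> H \<subseteq> N}"

definition ETrans_relative ::
  "('a, 'r) ring_scheme \<Rightarrow> ('a, 'b, 'm) module_scheme \<Rightarrow> ('b \<Rightarrow> 'b \<Rightarrow> 'a) \<Rightarrow> 'a set \<Rightarrow>
    ('a \<times> 'a \<times> 'b \<Rightarrow> 'a \<times> 'a \<times> 'b) set"
  where "ETrans_relative R P B I =
    normal_closure ((O_Q R P B)\<lparr>carrier := ETrans R P B\<rparr>) (ETrans_ideal R P B I)"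

end

theory Submission
  imports Defs
begin

text \<open>
  The generators \<open>\<rho>(q)\<close> and \<open>\<mu>(q)\<close> are the Eichler transformations \<open>E(f,-q)\<close> and \<open>E(e,-q)\<close>, where
  \<open>e\<close>, \<open>f\<close> is the standard hyperbolic pair of \<open>R\<^sup>2\<close>. An isometry \<open>g\<close> conjugates \<open>E(e,q)\<close> into
  \<open>E(ge,gq)\<close>. So it must be shown that \<open>E(v,u)\<close> lies in the relative elementary group whenever \<open>v\<close> is a
  unimodular isotropic vector of \<open>Q\<close> and \<open>u \<in> IQ\<close> is orthogonal to \<open>v\<close>
  (\<open>unimodular_directions\<close>). The key is that \<open>E(v,_)\<close> is additive on the orthogonal complement of \<open>v\<close>.
  Call \<open>u\<close> good if \<open>E(v,u)\<close> lies in the relative elementary group. Then sums of good vectors are good, and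
  the scalars \<open>t\<close> for which all multiples of \<open>tu\<close> are good form an ideal. To show that this ideal is \<open>R\<close>,
  it suffices to find an element of it outside each maximal ideal \<open>\<mm>\<close>.

  For the summands, write \<open>[x,y] = \<langle>v,x\<rangle>y - \<langle>v,y\<rangle>x\<close>, a vector orthogonal to \<open>v\<close>. If \<open>x \<in> P\<close> is isotropic
  and there are isotropic \<open>z, z' \<in> P\<close> orthogonal to \<open>x\<close> with \<open>\<langle>z,z'\<rangle> = t\<close>, then \<open>t\<^sup>2c[f,x]\<close> is good for
  \<open>c \<in> I\<close>, because the transformation is a product of elementary ones and a commutator
  (\<open>koszul_directions_witnessed\<close>). Local splitness and rank at least four ensure that such \<open>x\<close>, with \<open>t\<close>
  outside \<open>\<mm>\<close>, span \<open>P\<close> near \<open>\<mm>\<close>: a split form over a local ring is a sum of two dual totally isotropic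
  summands (\<open>totally_isotropic_complement\<close>), inside which there are two orthogonal hyperbolic pairs, and
  every vector is a sum of four isotropic vectors orthogonal to one or the other (\<open>sum_of_unit_witnesses\<close>). Therefore
  \<open>c[f,x]\<close> and \<open>c[e,x]\<close> are good for all \<open>x \<in> P\<close> (\<open>koszul_directions\<close>). The same spanning
  property shows that the transvections along isotropic vectors of \<open>IP\<close> already generate those along all
  of \<open>IP\<close> (\<open>generators_from_isotropic\<close>).

  The Koszul relation then makes \<open>\<langle>v,y\<rangle>\<langle>v,f\<rangle>u\<close> and \<open>\<langle>v,y\<rangle>\<langle>v,e\<rangle>u\<close> good for all \<open>y \<in> P\<close>
  (\<open>multiple_directions\<close>). Since the relative group is normalized by the elementary group, \<open>v\<close> may first be
  moved by elementary transformations, and modulo any given \<open>\<mm>\<close> this makes \<open>\<langle>v,e\<rangle>\<close> or \<open>\<langle>v,f\<rangle>\<close> and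
  also the component in \<open>P\<close> nonzero.
\<close>

section \<open>Ideals and multiples of a module by an ideal\<close>

lemma (in ring) exists_maximalideal:
  assumes J: "ideal J R" "J \<noteq> carrier R"
  shows "\<exists>\<mm>. maximalideal \<mm> R \<and> J \<subseteq> \<mm>"
proof -
  let ?A = "{I. ideal I R \<and> J \<subseteq> I \<and> \<one> \<notin> I}"
  have "\<one> \<notin> J" using J ideal.one_imp_carrier by blast
  then have "?A \<noteq> {}" using J(1) by auto
  moreover have "\<Union>C \<in> ?A" if C: "C \<noteq> {}" "subset.chain ?A C" for C
  proof -
    have "subset.chain {I. ideal I R} C" using C(2) by (auto simp: pred_on.chain_def)
    from chain_Union_is_ideal[OF this] have "ideal (\<Union>C) R" using C(1) by simp
    then show ?thesis using C by (auto simp: pred_on.chain_def)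
  qed
  ultimately have "\<exists>\<mm>\<in>?A. \<forall>Y\<in>?A. \<mm> \<subseteq> Y \<longrightarrow> Y = \<mm>"
    by (rule subset_Zorn_nonempty)
  then obtain \<mm> where m: "\<mm> \<in> ?A" and max: "\<forall>Y\<in>?A. \<mm> \<subseteq> Y \<longrightarrow> Y = \<mm>" ..
  have "maximalideal \<mm> R"
  proof (rule maximalidealI)
    fix Y assume Y: "ideal Y R" "\<mm> \<subseteq> Y" "Y \<subseteq> carrier R"
    show "Y = \<mm> \<or> Y = carrier R"
    proof (cases "\<one> \<in> Y")
      case True
      then show ?thesis using ideal.one_imp_carrier[OF Y(1)] by simp
    next
      case False
      then have "Y \<in> ?A" using Y m by auto
      then show ?thesis using Y(2) max by simp
    qed
  qed (use m in auto)
  then show ?thesis using m by auto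
qed

lemma (in ring) ideal_add_cancel:
  assumes J: "ideal J R" "x \<in> carrier R" "x \<oplus> y \<in> J" "y \<in> J"
  shows "x \<in> J"
proof -
  interpret J: ideal J R by fact
  have y: "y \<in> carrier R" using J(4) J.Icarr by auto
  have "(x \<oplus> y) \<oplus> \<ominus> y \<in> J" (is "?z \<in> J") 
    by (rule additive_subgroup.a_closed[OF J.additive_subgroup_axioms J(3)
        additive_subgroup.a_inv_closed[OF J.additive_subgroup_axioms J(4)]])
  moreover have "?z = x" using J(2) y by (simp add: a_assoc r_neg)
  ultimately show ?thesis by (simp only:)
qed

lemma (in module) ideal_times_module_induct [consumes 2, case_names zero smult add]:
  assumes u: "u \<in> ideal_times_module I M" and I: "ideal I R"
    and zero: "P \<zero>\<^bsub>M\<^esub>"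
    and smult: "\<And>c x. c \<in> I \<Longrightarrow> x \<in> carrier M \<Longrightarrow> P (c \<odot>\<^bsub>M\<^esub> x)"
    and add: "\<And>x y. x \<in> ideal_times_module I M \<Longrightarrow> y \<in> ideal_times_module I M \<Longrightarrow>
      x \<in> carrier M \<Longrightarrow> y \<in> carrier M \<Longrightarrow> P x \<Longrightarrow> P y \<Longrightarrow> P (x \<oplus>\<^bsub>M\<^esub> y)"
  shows "P u"
proof -
  interpret I: ideal I R by fact
  have "u \<in> carrier M \<and> P u" using u unfolding ideal_times_module_def
  proof (induction rule: generate.induct)
    case one
    then show ?case using zero by simp
  next
    case (incl h)
    then show ?case using smult I.Icarr by auto
  next
    case (inv h)
    then obtain c x where h: "h = c \<odot>\<^bsub>M\<^esub> x" "c \<in> I" "x \<in> carrier M" by auto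
    then have "inv\<^bsub>add_monoid M\<^esub> h = (\<ominus> c) \<odot>\<^bsub>M\<^esub> x"
      using I.Icarr by (simp add: smult_l_minus flip: a_inv_def)
    then show ?case using h smult[of "\<ominus> c" x] I.Icarr by simp
  next
    case (eng x y)
    then show ?case using add[of x y] by (simp add: ideal_times_module_def)
  qed
  then show ?thesis ..
qed

lemma (in module) ideal_times_module_smult:
  assumes "u \<in> ideal_times_module I M" "ideal I R" and a: "a \<in> carrier R"
  shows "a \<odot>\<^bsub>M\<^esub> u \<in> ideal_times_module I M"
  using assms(1,2)
proof (induction rule: ideal_times_module_induct)
  case zero
  then show ?case using a generate.one[of "add_monoid M"] by (simp add: ideal_times_module_def)
next
  case (smult c x)
  then have "a \<odot>\<^bsub>M\<^esub> (c \<odot>\<^bsub>M\<^esub> x) = (a \<otimes> c) \<odot>\<^bsub>M\<^esub> x" "a \<otimes> c \<in> I"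
    using a ideal.Icarr[OF assms(2), of c] ideal.I_l_closed[OF assms(2), of c a] by (auto simp: smult_assoc1)
  then show ?case using smult unfolding ideal_times_module_def by (intro generate.incl) blast
next
  case (add x y)
  then have "a \<odot>\<^bsub>M\<^esub> x \<oplus>\<^bsub>M\<^esub> a \<odot>\<^bsub>M\<^esub> y \<in> ideal_times_module I M"
    using generate.eng[of "a \<odot>\<^bsub>M\<^esub> x" "add_monoid M" _ "a \<odot>\<^bsub>M\<^esub> y"] by (simp add: ideal_times_module_def)
  then show ?case using a add by (simp add: smult_r_distr)
qed

section \<open>Eichler transformations\<close>

text \<open>
  The element \<open>h\<close> is the half of \<open>\<one>\<close>; it turns the form into the quadratic form
  \<open>x \<mapsto> h \<otimes> B x x\<close>, which occurs in the Eichler transformations.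
\<close>

locale symmetric_form_module = module R M for R (structure) and M (structure) +
  fixes B :: "'c \<Rightarrow> 'c \<Rightarrow> 'a" and h :: 'a
  assumes form_closed [simp]: "x \<in> carrier M \<Longrightarrow> y \<in> carrier M \<Longrightarrow> B x y \<in> carrier R"
    and form_add_left: "x \<in> carrier M \<Longrightarrow> y \<in> carrier M \<Longrightarrow> z \<in> carrier M \<Longrightarrow>
      B (x \<oplus>\<^bsub>M\<^esub> y) z = B x z \<oplus> B y z"
    and form_smult_left: "a \<in> carrier R \<Longrightarrow> x \<in> carrier M \<Longrightarrow> y \<in> carrier M \<Longrightarrow>
      B (a \<odot>\<^bsub>M\<^esub> x) y = a \<otimes> B x y"
    and form_sym: "x \<in> carrier M \<Longrightarrow> y \<in> carrier M \<Longrightarrow> B x y = B y x"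
    and half_closed [simp]: "h \<in> carrier R"
    and half_add_half: "h \<oplus> h = \<one>"
begin

lemma form_add_right:
  "x \<in> carrier M \<Longrightarrow> y \<in> carrier M \<Longrightarrow> z \<in> carrier M \<Longrightarrow> B z (x \<oplus>\<^bsub>M\<^esub> y) = B z x \<oplus> B z y"
  by (metis M.a_closed form_add_left form_sym)

lemma form_smult_right:
  "a \<in> carrier R \<Longrightarrow> x \<in> carrier M \<Longrightarrow> y \<in> carrier M \<Longrightarrow> B y (a \<odot>\<^bsub>M\<^esub> x) = a \<otimes> B y x"
  by (metis smult_closed form_smult_left form_sym)

lemma form_zero_left: "x \<in> carrier M \<Longrightarrow> B \<zero>\<^bsub>M\<^esub> x = \<zero>"
  by (metis M.zero_closed R.l_null R.zero_closed form_closed form_smult_left smult_l_null)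

lemma form_minus_left: "x \<in> carrier M \<Longrightarrow> y \<in> carrier M \<Longrightarrow> B (\<ominus>\<^bsub>M\<^esub> x) y = \<ominus> B x y"
  by (metis M.add.inv_closed M.r_neg R.minus_equality form_add_left form_closed form_zero_left R.a_comm)

lemma form_zero_right: "x \<in> carrier M \<Longrightarrow> B x \<zero>\<^bsub>M\<^esub> = \<zero>"
  by (metis M.zero_closed form_sym form_zero_left)

lemma form_minus_right: "x \<in> carrier M \<Longrightarrow> y \<in> carrier M \<Longrightarrow> B x (\<ominus>\<^bsub>M\<^esub> y) = \<ominus> B x y"
  by (metis M.a_inv_closed form_minus_left form_sym)

lemmas form_simps = form_add_left form_add_right form_smult_left form_smult_right
  form_minus_left form_minus_right form_zero_left form_zero_right

text \<open>
  The Eichler (or Siegel) transformation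
  \<open>E(u,v) x = x + \<langle>x,u\<rangle>v - \<langle>x,v\<rangle>u - h\<langle>v,v\<rangle>\<langle>x,u\<rangle>u\<close>. It is an isometry when \<open>u\<close> is isotropic and
  \<open>v\<close> is orthogonal to \<open>u\<close>; the last summand compensates for \<open>\<langle>v,v\<rangle>\<close>.
\<close>

definition eichler :: "'c \<Rightarrow> 'c \<Rightarrow> 'c \<Rightarrow> 'c" where
  "eichler u v = (\<lambda>x\<in>carrier M.
     x \<oplus>\<^bsub>M\<^esub> (B x u \<odot>\<^bsub>M\<^esub> v \<oplus>\<^bsub>M\<^esub> (\<ominus> (B x v \<oplus> h \<otimes> B v v \<otimes> B x u)) \<odot>\<^bsub>M\<^esub> u))"

lemma eichler_apply:
  "x \<in> carrier M \<Longrightarrow> eichler u v x =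
     x \<oplus>\<^bsub>M\<^esub> (B x u \<odot>\<^bsub>M\<^esub> v \<oplus>\<^bsub>M\<^esub> (\<ominus> (B x v \<oplus> h \<otimes> B v v \<otimes> B x u)) \<odot>\<^bsub>M\<^esub> u)"
  by (simp add: eichler_def)

lemma eichler_closed [simp]:
  "u \<in> carrier M \<Longrightarrow> v \<in> carrier M \<Longrightarrow> x \<in> carrier M \<Longrightarrow> eichler u v x \<in> carrier M"
  by (simp add: eichler_apply)

lemma eichler_extensional: "eichler u v \<in> extensional (carrier M)"
  by (simp add: eichler_def)

lemma half_double: "a \<in> carrier R \<Longrightarrow> h \<otimes> a \<oplus> h \<otimes> a = a"
  by (metis R.l_distr R.l_one half_add_half half_closed)

text \<open>
  The cross terms in the composition contribute \<open>\<langle>v,w\<rangle> = h\<langle>v,w\<rangle> + h\<langle>w,v\<rangle>\<close>, exactly what the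
  quadratic correction of \<open>E(u,v+w)\<close> has beyond those of \<open>E(u,v)\<close> and \<open>E(u,w)\<close>.
\<close>

lemma eichler_add:
  assumes [simp]: "u \<in> carrier M" "v \<in> carrier M" "w \<in> carrier M" "x \<in> carrier M"
    and iso: "B u u = \<zero>" "B u v = \<zero>" "B u w = \<zero>"
  shows "eichler u v (eichler u w x) = eichler u (v \<oplus>\<^bsub>M\<^esub> w) x"
proof -
  define a where "a = B x u"
  define c where "c = B x w \<oplus> h \<otimes> B w w \<otimes> B x u"
  define d where "d = B x v \<oplus> a \<otimes> B v w \<oplus> h \<otimes> B v v \<otimes> B x u"
  have [simp]: "a \<in> carrier R" "c \<in> carrier R" "d \<in> carrier R" by (simp_all add: a_def c_def d_def)
  have iso': "B v u = \<zero>" "B w u = \<zero>" using iso form_sym by auto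
  let ?y = "eichler u w x"
  have y: "?y = x \<oplus>\<^bsub>M\<^esub> (a \<odot>\<^bsub>M\<^esub> w \<oplus>\<^bsub>M\<^esub> (\<ominus> c) \<odot>\<^bsub>M\<^esub> u)"
    by (simp add: eichler_apply a_def c_def)
  have yu: "B ?y u = a" by (simp add: y form_simps iso iso' a_def)
  have yv: "B ?y v = B x v \<oplus> a \<otimes> B v w" by (simp add: y form_simps iso iso' form_sym[of w v])
  have *: "c \<oplus> d = B x (v \<oplus>\<^bsub>M\<^esub> w) \<oplus> h \<otimes> B (v \<oplus>\<^bsub>M\<^esub> w) (v \<oplus>\<^bsub>M\<^esub> w) \<otimes> a"
  proof -
    have "a \<otimes> B v w = h \<otimes> (a \<otimes> B v w) \<oplus> h \<otimes> (a \<otimes> B v w)" by (simp add: half_double)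
    then have "d = B x v \<oplus> (h \<otimes> (a \<otimes> B v w) \<oplus> h \<otimes> (a \<otimes> B v w)) \<oplus> h \<otimes> B v v \<otimes> a" by (simp add: d_def a_def)
    then show ?thesis unfolding c_def a_def[symmetric]
      by (simp add: form_simps R.l_distr R.r_distr R.a_ac R.m_ac form_sym[of w v])
  qed
  have "eichler u v ?y = ?y \<oplus>\<^bsub>M\<^esub> (a \<odot>\<^bsub>M\<^esub> v \<oplus>\<^bsub>M\<^esub> (\<ominus> d) \<odot>\<^bsub>M\<^esub> u)"
    using yu yv by (simp add: eichler_apply[of ?y] d_def a_def)
  also have "\<dots> = x \<oplus>\<^bsub>M\<^esub> (a \<odot>\<^bsub>M\<^esub> (v \<oplus>\<^bsub>M\<^esub> w) \<oplus>\<^bsub>M\<^esub> (\<ominus> (c \<oplus> d)) \<odot>\<^bsub>M\<^esub> u)"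
    by (simp add: y smult_l_distr smult_r_distr M.a_ac R.minus_add)
  also have "\<dots> = eichler u (v \<oplus>\<^bsub>M\<^esub> w) x"
    by (simp add: * eichler_apply a_def)
  finally show ?thesis .
qed

lemma eichler_zero: "u \<in> carrier M \<Longrightarrow> eichler u \<zero>\<^bsub>M\<^esub> = (\<lambda>x\<in>carrier M. x)"
  unfolding eichler_def by (rule restrict_ext) (simp add: form_simps)

lemma eichler_minus:
  assumes [simp]: "u \<in> carrier M" "v \<in> carrier M" "x \<in> carrier M" and iso: "B u u = \<zero>" "B u v = \<zero>"
  shows "eichler u (\<ominus>\<^bsub>M\<^esub> v) (eichler u v x) = x" "eichler u v (eichler u (\<ominus>\<^bsub>M\<^esub> v) x) = x"
  using iso by (simp_all add: eichler_add form_simps M.l_neg M.r_neg eichler_zero)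

text \<open>
  With additivity this gives the isometry property without expanding
  \<open>\<langle>E(u,v)x, E(u,v)y\<rangle>\<close>: the adjoint of \<open>E(u,v)\<close> is its inverse \<open>E(u,-v)\<close>.
\<close>

lemma form_eichler_adjoint:
  assumes [simp]: "u \<in> carrier M" "v \<in> carrier M" "x \<in> carrier M" "y \<in> carrier M"
  shows "B (eichler u v x) y = B x (eichler u (\<ominus>\<^bsub>M\<^esub> v) y)"
  by (simp add: eichler_apply form_simps form_sym[of v y] form_sym[of u y] R.l_distr R.r_distr R.minus_add R.l_minus R.r_minus
     R.a_ac R.m_ac)

lemma eichler_isometry:
  assumes [simp]: "u \<in> carrier M" "v \<in> carrier M" "x \<in> carrier M" "y \<in> carrier M"
    and iso: "B u u = \<zero>" "B u v = \<zero>"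
  shows "B (eichler u v x) (eichler u v y) = B x y"
  by (simp add: form_eichler_adjoint eichler_minus iso)

lemma eichler_module_hom:
  assumes [simp]: "u \<in> carrier M" "v \<in> carrier M"
  shows "eichler u v \<in> module_hom R M M"
  unfolding module_hom_def
  by (auto simp: eichler_apply form_simps smult_l_distr smult_r_distr R.l_distr R.r_distr R.minus_add R.l_minus
    R.r_minus R.a_ac R.m_ac M.a_ac smult_assoc1[symmetric] smult_l_minus smult_r_minus)

lemma eichler_smult:
  assumes [simp]: "u \<in> carrier M" "v \<in> carrier M" "c \<in> carrier R"
  shows "eichler (c \<odot>\<^bsub>M\<^esub> u) v = eichler u (c \<odot>\<^bsub>M\<^esub> v)"
  unfolding eichler_def
  by (rule restrict_ext) (simp add: form_simps smult_assoc1[symmetric] R.m_ac R.l_distr R.r_distr R.minus_add R.l_minus R.r_minus)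

text \<open>
  For two orthogonal isotropic vectors the transformation is the exponential of the alternating
  expression \<open>u \<and> v\<close>; this lets additivity be used in either argument.
\<close>

lemma eichler_swap:
  assumes [simp]: "u \<in> carrier M" "v \<in> carrier M" and iso: "B u u = \<zero>" "B v v = \<zero>"
  shows "eichler u v = eichler v (\<ominus>\<^bsub>M\<^esub> u)"
  unfolding eichler_def
  by (rule restrict_ext) (simp add: form_simps iso smult_l_minus smult_r_minus M.a_ac)

abbreviation isometries ("\<O>") where "\<O> \<equiv> orthogonal_group R M B"

lemma isometry_iff:
  "g \<in> carrier \<O> \<longleftrightarrow> g \<in> Bij (carrier M) \<and> g \<in> module_hom R M M \<and>
     (\<forall>x\<in>carrier M. \<forall>y\<in>carrier M. B (g x) (g y) = B x y)"
  by (simp add: orthogonal_group_def)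

lemma isometry_closed: "g \<in> carrier \<O> \<Longrightarrow> x \<in> carrier M \<Longrightarrow> g x \<in> carrier M"
  by (auto simp: isometry_iff module_hom_def)

lemma isometry_add:
  "g \<in> carrier \<O> \<Longrightarrow> x \<in> carrier M \<Longrightarrow> y \<in> carrier M \<Longrightarrow> g (x \<oplus>\<^bsub>M\<^esub> y) = g x \<oplus>\<^bsub>M\<^esub> g y"
  by (auto simp: isometry_iff module_hom_def)

lemma isometry_smult:
  "g \<in> carrier \<O> \<Longrightarrow> a \<in> carrier R \<Longrightarrow> x \<in> carrier M \<Longrightarrow> g (a \<odot>\<^bsub>M\<^esub> x) = a \<odot>\<^bsub>M\<^esub> g x"
  by (auto simp: isometry_iff module_hom_def)

lemma isometry_form:
  "g \<in> carrier \<O> \<Longrightarrow> x \<in> carrier M \<Longrightarrow> y \<in> carrier M \<Longrightarrow> B (g x) (g y) = B x y"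
  by (auto simp: isometry_iff)

lemma isometry_mult:
  "f \<in> carrier \<O> \<Longrightarrow> g \<in> carrier \<O> \<Longrightarrow> f \<otimes>\<^bsub>\<O>\<^esub> g = compose (carrier M) f g"
  by (simp add: orthogonal_group_def BijGroup_def)

lemma isometry_mult_apply:
  "f \<in> carrier \<O> \<Longrightarrow> g \<in> carrier \<O> \<Longrightarrow> x \<in> carrier M \<Longrightarrow> (f \<otimes>\<^bsub>\<O>\<^esub> g) x = f (g x)"
  by (simp add: isometry_mult compose_def)

lemma isometry_one: "\<one>\<^bsub>\<O>\<^esub> = (\<lambda>x\<in>carrier M. x)"
  by (simp add: orthogonal_group_def BijGroup_def)

lemma isometry_eqI:
  assumes "f \<in> carrier \<O>" "g \<in> carrier \<O>" "\<And>x. x \<in> carrier M \<Longrightarrow> f x = g x"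
  shows "f = g"
  using assms by (auto simp: isometry_iff Bij_def intro: extensionalityI)

lemma isometries_subgroup: "subgroup (carrier \<O>) (BijGroup (carrier M))"
proof -
  interpret S: group "BijGroup (carrier M)" by (rule group_BijGroup)
  show ?thesis
  proof (rule S.subgroupI)
    show "carrier \<O> \<subseteq> carrier (BijGroup (carrier M))"
      by (auto simp: isometry_iff BijGroup_def)
    have "\<one>\<^bsub>BijGroup (carrier M)\<^esub> \<in> carrier \<O>"
      by (auto simp: isometry_iff BijGroup_def id_Bij module_hom_def)
    then show "carrier \<O> \<noteq> {}" by auto
  next
    fix g assume g: "g \<in> carrier \<O>"
    then have gB: "g \<in> Bij (carrier M)" by (simp add: isometry_iff)
    define k where "k = (\<lambda>x\<in>carrier M. inv_into (carrier M) g x)"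
    have kB: "k \<in> Bij (carrier M)" unfolding k_def by (rule restrict_inv_into_Bij[OF gB])
    have gk: "g (k x) = x" if "x \<in> carrier M" for x
      using gB that by (auto simp: k_def Bij_def bij_betw_def f_inv_into_f)
    have kg: "k (g x) = x" if "x \<in> carrier M" for x
      using gB that g by (auto simp: k_def Bij_def bij_betw_def)
    have kc [simp]: "k x \<in> carrier M" if "x \<in> carrier M" for x
      using kB that by (auto simp: Bij_def bij_betw_def)
    have "k \<in> carrier \<O>"
      unfolding isometry_iff module_hom_def
    proof (intro conjI CollectI ballI funcsetI kB kc)
      fix x y assume [simp]: "x \<in> carrier M" "y \<in> carrier M"
      have "k (x \<oplus>\<^bsub>M\<^esub> y) = k (g (k x \<oplus>\<^bsub>M\<^esub> k y))" by (simp add: isometry_add[OF g] gk)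
      then show "k (x \<oplus>\<^bsub>M\<^esub> y) = k x \<oplus>\<^bsub>M\<^esub> k y" by (simp add: kg)
      show "B (k x) (k y) = B x y" using isometry_form[OF g, of "k x" "k y"] by (simp add: gk)
    next
      fix a x assume [simp]: "a \<in> carrier R" "x \<in> carrier M"
      have "k (a \<odot>\<^bsub>M\<^esub> x) = k (g (a \<odot>\<^bsub>M\<^esub> k x))" using isometry_smult[OF g, of a "k x"] by (simp add: gk)
      then show "k (a \<odot>\<^bsub>M\<^esub> x) = a \<odot>\<^bsub>M\<^esub> k x" by (simp add: kg)
    qed auto
    then show "inv\<^bsub>BijGroup (carrier M)\<^esub> g \<in> carrier \<O>" using inv_BijGroup[OF gB] by (simp add: k_def)
  next
    fix f g assume fg: "f \<in> carrier \<O>" "g \<in> carrier \<O>"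
    note [simp] = isometry_closed[OF fg(1)] isometry_closed[OF fg(2)]
      isometry_add[OF fg(1)] isometry_add[OF fg(2)] isometry_smult[OF fg(1)] isometry_smult[OF fg(2)]
      isometry_form[OF fg(1)] isometry_form[OF fg(2)]
    have "compose (carrier M) f g \<in> Bij (carrier M)" using fg by (auto simp: isometry_iff intro: compose_Bij)
    then have "compose (carrier M) f g \<in> carrier \<O>"
      unfolding isometry_iff module_hom_def by (auto simp: compose_def)
    then show "f \<otimes>\<^bsub>BijGroup (carrier M)\<^esub> g \<in> carrier \<O>"
      using fg by (simp add: BijGroup_def isometry_iff)
  qed
qed

sublocale O: group \<O>
  using group.subgroup_imp_group[OF group_BijGroup isometries_subgroup]
  by (simp add: orthogonal_group_def)

lemma eichler_in_isometries:
  assumes [simp]: "u \<in> carrier M" "v \<in> carrier M" and iso: "B u u = \<zero>" "B u v = \<zero>"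
  shows "eichler u v \<in> carrier \<O>"
proof -
  have "bij_betw (eichler u v) (carrier M) (carrier M)"
    by (rule bij_betw_byWitness[where f' = "eichler u (\<ominus>\<^bsub>M\<^esub> v)"]) (auto simp: eichler_minus iso)
  then show ?thesis
    using iso by (simp add: isometry_iff Bij_def eichler_module_hom eichler_isometry eichler_extensional)
qed

lemma eichler_mult:
  assumes "u \<in> carrier M" "v \<in> carrier M" "w \<in> carrier M"
    and "B u u = \<zero>" "B u v = \<zero>" "B u w = \<zero>"
  shows "eichler u v \<otimes>\<^bsub>\<O>\<^esub> eichler u w = eichler u (v \<oplus>\<^bsub>M\<^esub> w)"
  using assms
  by (intro isometry_eqI) (auto simp: isometry_mult_apply eichler_in_isometries eichler_add form_simps)

lemma eichler_inv:
  assumes [simp]: "u \<in> carrier M" "v \<in> carrier M" and iso: "B u u = \<zero>" "B u v = \<zero>"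
  shows "inv\<^bsub>\<O>\<^esub> (eichler u v) = eichler u (\<ominus>\<^bsub>M\<^esub> v)"
proof -
  have "eichler u (\<ominus>\<^bsub>M\<^esub> v) \<otimes>\<^bsub>\<O>\<^esub> eichler u v = \<one>\<^bsub>\<O>\<^esub>"
    using iso by (simp add: eichler_mult form_simps M.l_neg eichler_zero isometry_one)
  then show ?thesis
    using iso by (intro O.inv_equality) (auto simp: eichler_in_isometries form_simps)
qed

lemma eichler_conj:
  assumes g: "g \<in> carrier \<O>" and [simp]: "u \<in> carrier M" "v \<in> carrier M" and iso: "B u u = \<zero>" "B u v = \<zero>"
  shows "g \<otimes>\<^bsub>\<O>\<^esub> eichler u v \<otimes>\<^bsub>\<O>\<^esub> inv\<^bsub>\<O>\<^esub> g = eichler (g u) (g v)"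
proof -
  note [simp] = isometry_closed[OF g]
  have gu: "B (g u) (g u) = \<zero>" "B (g u) (g v) = \<zero>" using g iso by (simp_all add: isometry_form)
  have "g \<otimes>\<^bsub>\<O>\<^esub> eichler u v = eichler (g u) (g v) \<otimes>\<^bsub>\<O>\<^esub> g"
  proof (rule isometry_eqI)
    fix x assume [simp]: "x \<in> carrier M"
    show "(g \<otimes>\<^bsub>\<O>\<^esub> eichler u v) x = (eichler (g u) (g v) \<otimes>\<^bsub>\<O>\<^esub> g) x"
      using g gu iso
      by (simp add: isometry_mult_apply eichler_in_isometries eichler_apply isometry_form isometry_add isometry_smult)
  qed (use g gu iso in \<open>auto simp: eichler_in_isometries\<close>)
  then show ?thesis
    using g gu iso by (simp add: O.inv_solve_right' eichler_in_isometries)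
qed

end

section \<open>Directions along which a subgroup is elementary\<close>

context symmetric_form_module begin

text \<open>
  By additivity the directions of a subgroup at an isotropic vector form an additive group, so that
  membership of \<open>E(y,w)\<close> in the subgroup can be checked on summands of \<open>w\<close>.
\<close>

definition directions :: "('c \<Rightarrow> 'c) set \<Rightarrow> 'c \<Rightarrow> 'c set" where
  "directions N y = {w \<in> carrier M. B y w = \<zero> \<and> eichler y w \<in> N}"

lemma directions_carrier: "w \<in> directions N y \<Longrightarrow> w \<in> carrier M"
  by (simp add: directions_def)

lemma zero_in_directions:
  assumes "subgroup N \<O>" "y \<in> carrier M" shows "\<zero>\<^bsub>M\<^esub> \<in> directions N y"
  using assms subgroup.one_closed[OF assms(1)]
  by (simp add: directions_def form_simps eichler_zero isometry_one)

lemma directions_add: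
  assumes "subgroup N \<O>" "y \<in> carrier M" "B y y = \<zero>" "v \<in> directions N y" "w \<in> directions N y"
  shows "v \<oplus>\<^bsub>M\<^esub> w \<in> directions N y"
  using assms subgroup.m_closed[OF assms(1), of "eichler y v" "eichler y w"]
  by (auto simp: directions_def form_simps eichler_mult)

lemma directions_minus:
  assumes "subgroup N \<O>" "y \<in> carrier M" "B y y = \<zero>" "v \<in> directions N y"
  shows "\<ominus>\<^bsub>M\<^esub> v \<in> directions N y"
  using assms subgroup.m_inv_closed[OF assms(1), of "eichler y v"]
  by (auto simp: directions_def form_simps eichler_inv)

lemma directions_cancel:
  assumes "subgroup N \<O>" "y \<in> carrier M" "B y y = \<zero>"
    "v \<oplus>\<^bsub>M\<^esub> w \<in> directions N y" "v \<in> directions N y" "w \<in> carrier M"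
  shows "w \<in> directions N y"
proof -
  have "\<ominus>\<^bsub>M\<^esub> v \<oplus>\<^bsub>M\<^esub> (v \<oplus>\<^bsub>M\<^esub> w) \<in> directions N y"
    by (rule directions_add[OF assms(1-3) directions_minus[OF assms(1-3,5)] assms(4)])
  then show ?thesis using assms directions_carrier[OF assms(5)] by (simp add: M.r_neg1)
qed

text \<open>
  Follows from \<open>E(w,y) = E(y,-w)\<close>.
\<close>

lemma directions_swap:
  assumes "subgroup N \<O>" "y \<in> carrier M" "B y y = \<zero>" "w \<in> directions N y" "B w w = \<zero>"
  shows "y \<in> directions N w"
proof -
  have w: "w \<in> carrier M" "B y w = \<zero>" using assms(4) by (auto simp: directions_def)
  have "\<ominus>\<^bsub>M\<^esub> w \<in> directions N y" using assms by (intro directions_minus)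
  then show ?thesis
    using assms(2,3,5) w eichler_swap[of w y] form_sym[of w y] by (simp add: directions_def)
qed

lemma directions_smult_iff:
  assumes "y \<in> carrier M" "w \<in> carrier M" "c \<in> carrier R" "B y w = \<zero>"
  shows "c \<odot>\<^bsub>M\<^esub> w \<in> directions N y \<longleftrightarrow> w \<in> directions N (c \<odot>\<^bsub>M\<^esub> y)"
  using assms by (simp add: directions_def form_simps eichler_smult)

lemma directions_conj:
  assumes k: "k \<in> carrier \<O>" and conj: "\<And>l. l \<in> N \<Longrightarrow> k \<otimes>\<^bsub>\<O>\<^esub> l \<otimes>\<^bsub>\<O>\<^esub> inv\<^bsub>\<O>\<^esub> k \<in> N"
    and "y \<in> carrier M" "B y y = \<zero>" "w \<in> directions N y"
  shows "k w \<in> directions N (k y)"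
  using assms conj[of "eichler y w"] eichler_conj[OF k, of y w]
  by (auto simp: directions_def isometry_form isometry_closed[OF k])

definition plane_complement :: "'c \<Rightarrow> 'c \<Rightarrow> 'c set" where
  "plane_complement e f = {p \<in> carrier M. B p e = \<zero> \<and> B p f = \<zero>}"

lemma plane_complement_sym: "plane_complement e f = plane_complement f e"
  by (auto simp: plane_complement_def)

lemma plane_complementD:
  assumes "p \<in> plane_complement e f" "e \<in> carrier M" "f \<in> carrier M"
  shows "p \<in> carrier M" "B p e = \<zero>" "B p f = \<zero>" "B e p = \<zero>" "B f p = \<zero>"
  using assms form_sym by (auto simp: plane_complement_def)

text \<open>
  The combination of \<open>x\<close> and \<open>y\<close> orthogonal to \<open>v\<close>: the Koszul syzygy of the linear forms that \<open>v\<close>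
  defines on \<open>x\<close> and \<open>y\<close>.
\<close>

definition koszul :: "'c \<Rightarrow> 'c \<Rightarrow> 'c \<Rightarrow> 'c" where
  "koszul v x y = B v x \<odot>\<^bsub>M\<^esub> y \<oplus>\<^bsub>M\<^esub> (\<ominus> B v y) \<odot>\<^bsub>M\<^esub> x"

lemma koszul_closed [simp]:
  "v \<in> carrier M \<Longrightarrow> x \<in> carrier M \<Longrightarrow> y \<in> carrier M \<Longrightarrow> koszul v x y \<in> carrier M"
  by (simp add: koszul_def)

lemma koszul_orthogonal:
  "v \<in> carrier M \<Longrightarrow> x \<in> carrier M \<Longrightarrow> y \<in> carrier M \<Longrightarrow> B v (koszul v x y) = \<zero>"
  by (simp add: koszul_def form_simps R.r_minus R.l_minus R.m_comm[of "B v y"] R.r_neg)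

end

text \<open>
  In the application \<open>K\<close> is the elementary group, \<open>L\<close> its relative subgroup, and \<open>e\<close>, \<open>f\<close> the standard
  hyperbolic pair. The conditions are symmetric in \<open>e\<close> and \<open>f\<close>, and they hold for \<open>L = K\<close> and
  \<open>I = R\<close>; so each result is available for the swapped pair and in the absolute form.
\<close>

locale elementary_pair = symmetric_form_module R M B h
  for R (structure) and M (structure) and B h +
  fixes e f K L I
  assumes e_carrier [simp]: "e \<in> carrier M" and f_carrier [simp]: "f \<in> carrier M"
    and ee [simp]: "B e e = \<zero>" and ff [simp]: "B f f = \<zero>" and ef [simp]: "B e f = \<one>"
    and ideal_I: "ideal I R"
    and subgroup_K: "subgroup K \<O>" and subgroup_L: "subgroup L \<O>"
    and conj_L: "k \<in> K \<Longrightarrow> l \<in> L \<Longrightarrow> k \<otimes>\<^bsub>\<O>\<^esub> l \<otimes>\<^bsub>\<O>\<^esub> inv\<^bsub>\<O>\<^esub> k \<in> L"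
    and gen_K: "p \<in> plane_complement e f \<Longrightarrow> eichler e p \<in> K"
      "p \<in> plane_complement e f \<Longrightarrow> eichler f p \<in> K"
    and gen_L: "c \<in> I \<Longrightarrow> p \<in> plane_complement e f \<Longrightarrow> eichler e (c \<odot>\<^bsub>M\<^esub> p) \<in> L"
      "c \<in> I \<Longrightarrow> p \<in> plane_complement e f \<Longrightarrow> eichler f (c \<odot>\<^bsub>M\<^esub> p) \<in> L"
begin

lemma fe [simp]: "B f e = \<one>" using ef form_sym[of e f] by simp

lemma I_carrier [simp]: "c \<in> I \<Longrightarrow> c \<in> carrier R" using ideal.Icarr[OF ideal_I] by auto

lemma I_mult: "c \<in> I \<Longrightarrow> a \<in> carrier R \<Longrightarrow> a \<otimes> c \<in> I"
  using ideal.I_l_closed[OF ideal_I] by auto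

lemma swapped: "elementary_pair R M B h f e K L I"
  by (intro elementary_pair.intro elementary_pair_axioms.intro symmetric_form_module_axioms
      e_carrier f_carrier ee ff fe ideal_I subgroup_K subgroup_L conj_L gen_K gen_L)
    (simp_all add: plane_complement_sym[of f e])

lemma absolute: "elementary_pair R M B h e f K K (carrier R)"
proof -
  have "c \<odot>\<^bsub>M\<^esub> p \<in> plane_complement e f" if "c \<in> carrier R" "p \<in> plane_complement e f" for c p
    using that by (auto simp: plane_complement_def form_simps)
  then show ?thesis
    by (intro elementary_pair.intro elementary_pair_axioms.intro symmetric_form_module_axioms R.oneideal
      e_carrier f_carrier ee ff ef subgroup_K gen_K subgroup.m_closed[OF subgroup_K] subgroup.m_inv_closed[OF subgroup_K])
qed

lemma pair_decomposition:
  assumes [simp]: "w \<in> carrier M"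
  obtains r where "r \<in> plane_complement e f" "w = B w f \<odot>\<^bsub>M\<^esub> e \<oplus>\<^bsub>M\<^esub> (B w e \<odot>\<^bsub>M\<^esub> f \<oplus>\<^bsub>M\<^esub> r)"
proof
  let ?r = "\<ominus>\<^bsub>M\<^esub> (B w e \<odot>\<^bsub>M\<^esub> f) \<oplus>\<^bsub>M\<^esub> (\<ominus>\<^bsub>M\<^esub> (B w f \<odot>\<^bsub>M\<^esub> e) \<oplus>\<^bsub>M\<^esub> w)"
  show "?r \<in> plane_complement e f"
    by (simp add: plane_complement_def form_simps R.l_neg)
  show "w = B w f \<odot>\<^bsub>M\<^esub> e \<oplus>\<^bsub>M\<^esub> (B w e \<odot>\<^bsub>M\<^esub> f \<oplus>\<^bsub>M\<^esub> ?r)"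
    by (simp add: M.r_neg2)
qed

lemma pair_in_directions:
  assumes c: "c \<in> I" and x: "x \<in> plane_complement e f" "B x x = \<zero>"
  shows "e \<in> directions L (c \<odot>\<^bsub>M\<^esub> x)" "f \<in> directions L (c \<odot>\<^bsub>M\<^esub> x)"
proof -
  note [simp] = plane_complementD[OF x(1) e_carrier f_carrier]
  have "c \<odot>\<^bsub>M\<^esub> x \<in> directions L e" "c \<odot>\<^bsub>M\<^esub> x \<in> directions L f"
    using c x gen_L by (auto simp: directions_def form_simps)
  then show "e \<in> directions L (c \<odot>\<^bsub>M\<^esub> x)" "f \<in> directions L (c \<odot>\<^bsub>M\<^esub> x)"
    using c x(2) directions_swap[OF subgroup_L, of _ "c \<odot>\<^bsub>M\<^esub> x"] by (simp_all add: form_simps)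
qed

lemma smult_pair_in_directions:
  assumes c: "c \<in> I" and x: "x \<in> plane_complement e f" "B x x = \<zero>" and d: "d \<in> carrier R"
  shows "d \<odot>\<^bsub>M\<^esub> e \<in> directions L (c \<odot>\<^bsub>M\<^esub> x)" "d \<odot>\<^bsub>M\<^esub> f \<in> directions L (c \<odot>\<^bsub>M\<^esub> x)"
proof -
  note [simp] = plane_complementD[OF x(1) e_carrier f_carrier]
  show "d \<odot>\<^bsub>M\<^esub> e \<in> directions L (c \<odot>\<^bsub>M\<^esub> x)" "d \<odot>\<^bsub>M\<^esub> f \<in> directions L (c \<odot>\<^bsub>M\<^esub> x)"
    using c d pair_in_directions[OF I_mult[OF c d] x]
    by (auto simp: directions_smult_iff form_simps smult_assoc1)
qed

text \<open>
  The plane spanned by \<open>c x\<close> and \<open>r\<close> is orthogonal to both \<open>e\<close> and \<open>f\<close>. Conjugating \<open>E(cx, e)\<close> by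
  \<open>E(f, r)\<close>, which fixes \<open>x\<close>, gives \<open>E(cx, e + r - h\<langle>r,r\<rangle>f)\<close>; the summands \<open>e\<close> and \<open>f\<close> are known.
\<close>

lemma complement_in_directions:
  assumes c: "c \<in> I" and x: "x \<in> plane_complement e f" "B x x = \<zero>"
    and r: "r \<in> plane_complement e f" "B x r = \<zero>"
  shows "r \<in> directions L (c \<odot>\<^bsub>M\<^esub> x)"
proof -
  note [simp] = plane_complementD[OF x(1) e_carrier f_carrier] plane_complementD[OF r(1) e_carrier f_carrier]
  let ?y = "c \<odot>\<^bsub>M\<^esub> x" and ?k = "eichler f r" and ?d = "\<ominus> (h \<otimes> B r r)"
  have y: "?y \<in> carrier M" "B ?y ?y = \<zero>" using c x(2) by (simp_all add: form_simps)
  have k: "?k \<in> carrier \<O>" by (simp add: eichler_in_isometries)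
  have ky: "?k ?y = ?y" using c r(2) by (simp add: eichler_apply form_simps)
  have ke: "?k e = e \<oplus>\<^bsub>M\<^esub> (?d \<odot>\<^bsub>M\<^esub> f \<oplus>\<^bsub>M\<^esub> r)" by (simp add: eichler_apply M.a_comm)
  have "?k e \<in> directions L (?k ?y)"
    by (rule directions_conj[OF k conj_L[OF gen_K(2)[OF r(1)]] y pair_in_directions(1)[OF c x]])
  then have "e \<oplus>\<^bsub>M\<^esub> (?d \<odot>\<^bsub>M\<^esub> f \<oplus>\<^bsub>M\<^esub> r) \<in> directions L ?y" by (simp add: ky ke)
  then have "?d \<odot>\<^bsub>M\<^esub> f \<oplus>\<^bsub>M\<^esub> r \<in> directions L ?y"
    by (rule directions_cancel[OF subgroup_L y]) (auto intro: pair_in_directions c x)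
  then show ?thesis
    by (rule directions_cancel[OF subgroup_L y]) (auto intro: smult_pair_in_directions c x)
qed

lemma isotropic_directions:
  assumes c: "c \<in> I" and x: "x \<in> plane_complement e f" "B x x = \<zero>"
    and w: "w \<in> carrier M" "B x w = \<zero>"
  shows "w \<in> directions L (c \<odot>\<^bsub>M\<^esub> x)"
proof -
  note [simp] = plane_complementD[OF x(1) e_carrier f_carrier] w(1)
  obtain r where r: "r \<in> plane_complement e f" and wr: "w = B w f \<odot>\<^bsub>M\<^esub> e \<oplus>\<^bsub>M\<^esub> (B w e \<odot>\<^bsub>M\<^esub> f \<oplus>\<^bsub>M\<^esub> r)"
    using pair_decomposition[OF w(1)] .
  note [simp] = plane_complementD[OF r(1) e_carrier f_carrier]
  have "B x w = B x (B w f \<odot>\<^bsub>M\<^esub> e \<oplus>\<^bsub>M\<^esub> (B w e \<odot>\<^bsub>M\<^esub> f \<oplus>\<^bsub>M\<^esub> r))" by (rule arg_cong[OF wr])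
  also have "\<dots> = B x r" by (simp add: form_simps)
  finally have "B x r = \<zero>" using w(2) by simp
  have "B w f \<odot>\<^bsub>M\<^esub> e \<oplus>\<^bsub>M\<^esub> (B w e \<odot>\<^bsub>M\<^esub> f \<oplus>\<^bsub>M\<^esub> r) \<in> directions L (c \<odot>\<^bsub>M\<^esub> x)"
    using c x(2) \<open>B x r = \<zero>\<close>
    by (intro directions_add subgroup_L smult_pair_in_directions complement_in_directions c x r)
      (auto simp: form_simps)
  then show ?thesis using wr by simp
qed

text \<open>
  The main computation. Put \<open>y = c(\<langle>v,f\<rangle>x - \<langle>v,x\<rangle>f)\<close>. The vectors \<open>y\<close> and \<open>v\<close> are isotropic and
  orthogonal, so \<open>E(v,y)\<close> may be studied as \<open>E(y,v)\<close>, additively in \<open>v\<close>. The component of \<open>t v\<close>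
  orthogonal to \<open>z\<close> and \<open>z'\<close> is \<open>w = tv - \<langle>v,z'\<rangle>z - \<langle>v,z\<rangle>z'\<close>. Multiples of \<open>z\<close> and \<open>z'\<close> are directions
  at \<open>y\<close> since \<open>z\<close> and \<open>z'\<close> are isotropic vectors of the complement of \<open>e\<close>, \<open>f\<close>. The direction \<open>w\<close>, which involves all of
  \<open>v\<close>, is reached by a commutator: \<open>E(z',w)\<close> is elementary, fixes \<open>y\<close>, and moves \<open>z\<close> to \<open>z + tw\<close> up to
  a multiple of \<open>z'\<close>. The two factors \<open>t\<close> are the price for \<open>z\<close>, \<open>z'\<close> forming a hyperbolic pair
  only up to the scalar \<open>t\<close>.
\<close>

lemma koszul_directions_witnessed:
  assumes c: "c \<in> I" and v: "v \<in> carrier M" "B v v = \<zero>"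
    and x: "x \<in> plane_complement e f" "B x x = \<zero>"
    and z: "z \<in> plane_complement e f" "B z z = \<zero>" "B x z = \<zero>"
    and z': "z' \<in> plane_complement e f" "B z' z' = \<zero>" "B x z' = \<zero>"
  defines "t \<equiv> B z z'"
  shows "(t \<otimes> t \<otimes> c) \<odot>\<^bsub>M\<^esub> koszul v f x \<in> directions L v"
proof -
  interpret abs: elementary_pair R M B h e f K K "carrier R" by (rule absolute)
  note [simp] = plane_complementD[OF x(1) e_carrier f_carrier] plane_complementD[OF z(1) e_carrier f_carrier]
    plane_complementD[OF z'(1) e_carrier f_carrier] v x(2) z(2,3) z'(2,3)
  have t [simp]: "t \<in> carrier R" "B z z' = t" "B z' z = t" using form_sym[of z z'] by (simp_all add: t_def)
  have [simp]: "B z x = \<zero>" "B z' x = \<zero>" using z z' form_sym by auto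
  have [simp]: "c \<in> carrier R" using c by simp
  let ?k = "koszul v f x"
  let ?y = "c \<odot>\<^bsub>M\<^esub> ?k"
  have k: "B ?k ?k = \<zero>" "B z ?k = \<zero>" "B z' ?k = \<zero>" "B ?k z = \<zero>" "B ?k z' = \<zero>"
    by (simp_all add: koszul_def form_simps)
  have kv: "B v ?k = \<zero>" "B ?k v = \<zero>" using koszul_orthogonal[of v f x] form_sym[of v ?k] by simp_all
  have y: "?y \<in> carrier M" "B ?y ?y = \<zero>" by (simp_all add: form_simps k)
  have multiples: "d \<odot>\<^bsub>M\<^esub> q \<in> directions L ?y"
    if d: "d \<in> carrier R" and q: "q \<in> plane_complement e f" "B q q = \<zero>" "B q ?k = \<zero>" for d q
  proof -
    note [simp] = plane_complementD[OF q(1) e_carrier f_carrier]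
    have "B ?k q = \<zero>" using q form_sym[of q ?k] by simp
    have "?k \<in> directions L ((c \<otimes> d) \<odot>\<^bsub>M\<^esub> q)"
      using isotropic_directions[of "c \<otimes> d" q ?k] I_mult[OF c d] d q by (simp add: R.m_comm)
    then have "(c \<otimes> d) \<odot>\<^bsub>M\<^esub> q \<in> directions L ?k"
      using d q k by (intro directions_swap[OF subgroup_L, of "(c \<otimes> d) \<odot>\<^bsub>M\<^esub> q"]) (simp_all add: form_simps)
    then show ?thesis
      using d q \<open>B ?k q = \<zero>\<close> by (simp add: directions_smult_iff[symmetric] smult_assoc1 form_simps)
  qed
  define \<alpha> where "\<alpha> = \<ominus> B v z'"
  define \<beta> where "\<beta> = \<ominus> B v z"
  have [simp]: "\<alpha> \<in> carrier R" "\<beta> \<in> carrier R" by (simp_all add: \<alpha>_def \<beta>_def)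
  define w where "w = \<alpha> \<odot>\<^bsub>M\<^esub> z \<oplus>\<^bsub>M\<^esub> (\<beta> \<odot>\<^bsub>M\<^esub> z' \<oplus>\<^bsub>M\<^esub> t \<odot>\<^bsub>M\<^esub> v)"
  have w [simp]: "w \<in> carrier M" by (simp add: w_def)
  have z'w: "B z' w = \<zero>"
    by (simp add: w_def form_simps \<alpha>_def form_sym[of z' v] R.l_minus R.m_comm[of t] R.l_neg)
  have yw: "B ?y w = \<zero>" by (simp add: w_def form_simps k kv)
  let ?g = "eichler z' w"
  have "w \<in> directions K (\<one> \<odot>\<^bsub>M\<^esub> z')" using z'w by (intro abs.isotropic_directions z') auto
  then have gK: "?g \<in> K" by (simp add: directions_def)
  have g: "?g \<in> carrier \<O>" using z'w by (simp add: eichler_in_isometries)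
  have gy: "?g ?y = ?y" using yw y k by (simp add: eichler_apply form_simps)
  define \<gamma> where "\<gamma> = \<ominus> (B z w \<oplus> h \<otimes> B w w \<otimes> t)"
  have [simp]: "\<gamma> \<in> carrier R" by (simp add: \<gamma>_def)
  have gz: "?g z = z \<oplus>\<^bsub>M\<^esub> (\<gamma> \<odot>\<^bsub>M\<^esub> z' \<oplus>\<^bsub>M\<^esub> t \<odot>\<^bsub>M\<^esub> w)" by (simp add: eichler_apply M.a_comm \<gamma>_def)
  have zL: "z \<in> directions L ?y" using multiples[of \<one> z] z(1) k by simp
  have "?g z \<in> directions L (?g ?y)"
    by (rule directions_conj[OF g conj_L[OF gK] y zL])
  then have "z \<oplus>\<^bsub>M\<^esub> (\<gamma> \<odot>\<^bsub>M\<^esub> z' \<oplus>\<^bsub>M\<^esub> t \<odot>\<^bsub>M\<^esub> w) \<in> directions L ?y" by (simp add: gy gz)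
  then have "\<gamma> \<odot>\<^bsub>M\<^esub> z' \<oplus>\<^bsub>M\<^esub> t \<odot>\<^bsub>M\<^esub> w \<in> directions L ?y"
    by (rule directions_cancel[OF subgroup_L y]) (auto intro: zL)
  then have tw: "t \<odot>\<^bsub>M\<^esub> w \<in> directions L ?y"
    by (rule directions_cancel[OF subgroup_L y]) (auto intro: multiples z' simp: k)
  have "t \<odot>\<^bsub>M\<^esub> w = (t \<otimes> \<alpha>) \<odot>\<^bsub>M\<^esub> z \<oplus>\<^bsub>M\<^esub> ((t \<otimes> \<beta>) \<odot>\<^bsub>M\<^esub> z' \<oplus>\<^bsub>M\<^esub> (t \<otimes> t) \<odot>\<^bsub>M\<^esub> v)"
    by (simp add: w_def smult_r_distr smult_assoc1)
  with tw have "(t \<otimes> \<alpha>) \<odot>\<^bsub>M\<^esub> z \<oplus>\<^bsub>M\<^esub> ((t \<otimes> \<beta>) \<odot>\<^bsub>M\<^esub> z' \<oplus>\<^bsub>M\<^esub> (t \<otimes> t) \<odot>\<^bsub>M\<^esub> v) \<in> directions L ?y" by simp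
  then have "(t \<otimes> \<beta>) \<odot>\<^bsub>M\<^esub> z' \<oplus>\<^bsub>M\<^esub> (t \<otimes> t) \<odot>\<^bsub>M\<^esub> v \<in> directions L ?y"
    by (rule directions_cancel[OF subgroup_L y]) (auto intro: multiples z simp: k)
  then have "(t \<otimes> t) \<odot>\<^bsub>M\<^esub> v \<in> directions L ?y"
    by (rule directions_cancel[OF subgroup_L y]) (auto intro: multiples z' simp: k)
  then have "v \<in> directions L ((t \<otimes> t \<otimes> c) \<odot>\<^bsub>M\<^esub> ?k)"
    using kv by (simp add: directions_smult_iff form_simps smult_assoc1)
  then show ?thesis
    using k by (intro directions_swap[OF subgroup_L, of "(t \<otimes> t \<otimes> c) \<odot>\<^bsub>M\<^esub> ?k"]) (simp_all add: form_simps)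
qed

end

section \<open>From locally spanning vectors to all unimodular vectors\<close>

context symmetric_form_module begin

text \<open>
  The vectors \<open>x\<close> to which the main computation applies, with the scalar \<open>t\<close> it costs.
\<close>

definition hyperbolic_witness :: "'c \<Rightarrow> 'c \<Rightarrow> 'c \<Rightarrow> 'a \<Rightarrow> bool" where
  "hyperbolic_witness e f x t \<longleftrightarrow> x \<in> plane_complement e f \<and> B x x = \<zero> \<and>
     (\<exists>z\<in>plane_complement e f. \<exists>z'\<in>plane_complement e f.
       B z z = \<zero> \<and> B z' z' = \<zero> \<and> B x z = \<zero> \<and> B x z' = \<zero> \<and> B z z' = t)"

text \<open>
  A form of "the vectors with a hyperbolic witness generate the complement locally" that can be applied
  without mentioning localizations: a submodule containing these vectors up to scalars outside each
  maximal ideal contains the complement.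
\<close>

definition locally_spanned :: "'c \<Rightarrow> 'c \<Rightarrow> bool" where
  "locally_spanned e f \<longleftrightarrow>
     (\<forall>Y. submodule Y R M \<longrightarrow>
       (\<forall>\<mm> x t. maximalideal \<mm> R \<longrightarrow> hyperbolic_witness e f x t \<longrightarrow> t \<notin> \<mm> \<longrightarrow>
          (\<exists>s\<in>carrier R - \<mm>. s \<odot>\<^bsub>M\<^esub> x \<in> Y)) \<longrightarrow>
       plane_complement e f \<subseteq> Y)"

definition locally_unimodular :: "'c \<Rightarrow> 'c \<Rightarrow> bool" where
  "locally_unimodular e f \<longleftrightarrow>
     (\<forall>\<mm>. maximalideal \<mm> R \<longrightarrow> (\<exists>p\<in>plane_complement e f. \<exists>q\<in>plane_complement e f. B p q \<notin> \<mm>))"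

lemma locally_spanned_sym: "locally_spanned e f \<Longrightarrow> locally_spanned f e"
  unfolding locally_spanned_def hyperbolic_witness_def plane_complement_sym[of f e] .

lemma locally_unimodular_sym: "locally_unimodular e f \<Longrightarrow> locally_unimodular f e"
  unfolding locally_unimodular_def plane_complement_sym[of f e] .

lemma hyperbolic_witness_closed:
  "hyperbolic_witness e f x t \<Longrightarrow> x \<in> carrier M \<and> t \<in> carrier R"
  unfolding hyperbolic_witness_def plane_complement_def by auto

lemma locally_spannedD:
  assumes "locally_spanned e f" "submodule Y R M"
    and "\<And>\<mm> x t. maximalideal \<mm> R \<Longrightarrow> hyperbolic_witness e f x t \<Longrightarrow> t \<notin> \<mm> \<Longrightarrow>
          \<exists>s\<in>carrier R - \<mm>. s \<odot>\<^bsub>M\<^esub> x \<in> Y"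
  shows "plane_complement e f \<subseteq> Y"
  using assms unfolding locally_spanned_def by blast

lemma directions_preimage_submodule:
  assumes N: "subgroup N \<O>" and y: "y \<in> carrier M" "B y y = \<zero>" and I: "ideal I R"
    and \<phi>: "\<phi> \<in> module_hom R M M"
  shows "submodule {x \<in> carrier M. \<forall>c\<in>I. c \<odot>\<^bsub>M\<^esub> \<phi> x \<in> directions N y} R M"
proof -
  interpret I: ideal I R by fact
  have [simp]: "\<phi> x \<in> carrier M" if "x \<in> carrier M" for x using \<phi> that by (auto simp: module_hom_def)
  have add: "\<phi> (x \<oplus>\<^bsub>M\<^esub> x') = \<phi> x \<oplus>\<^bsub>M\<^esub> \<phi> x'" if "x \<in> carrier M" "x' \<in> carrier M" for x x'
    using \<phi> that by (auto simp: module_hom_def)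
  have smult: "\<phi> (a \<odot>\<^bsub>M\<^esub> x) = a \<odot>\<^bsub>M\<^esub> \<phi> x" if "a \<in> carrier R" "x \<in> carrier M" for a x
    using \<phi> that by (auto simp: module_hom_def)
  let ?Y = "{x \<in> carrier M. \<forall>c\<in>I. c \<odot>\<^bsub>M\<^esub> \<phi> x \<in> directions N y}"
  have sm: "a \<odot>\<^bsub>M\<^esub> x \<in> ?Y" if "a \<in> carrier R" "x \<in> ?Y" for a x
  proof -
    have "c \<odot>\<^bsub>M\<^esub> \<phi> (a \<odot>\<^bsub>M\<^esub> x) \<in> directions N y" if "c \<in> I" for c
      using \<open>x \<in> ?Y\<close> \<open>a \<in> carrier R\<close> that I.I_r_closed[OF that \<open>a \<in> carrier R\<close>] I.Icarr[OF that]
      by (auto simp: smult simp flip: smult_assoc1)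
    then show ?thesis using that by auto
  qed
  have zero: "\<zero>\<^bsub>M\<^esub> \<in> ?Y"
    using smult[of \<zero> "\<zero>\<^bsub>M\<^esub>"] zero_in_directions[OF N y(1)] I.Icarr by auto
  show ?thesis
  proof (rule submoduleI)
    fix x assume x: "x \<in> ?Y"
    then show "\<ominus>\<^bsub>M\<^esub> x \<in> ?Y" using sm[of "\<ominus> \<one>" x] by (simp add: smult_l_minus)
  next
    fix x x' assume "x \<in> ?Y" "x' \<in> ?Y"
    then show "x \<oplus>\<^bsub>M\<^esub> x' \<in> ?Y"
      using I.Icarr by (auto simp: add smult_r_distr intro!: directions_add N y)
  next
    fix a x assume "a \<in> carrier R" "x \<in> ?Y"
    then show "a \<odot>\<^bsub>M\<^esub> x \<in> ?Y" by (rule sm)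
  qed (use zero in auto)
qed

text \<open>
  The elementary group is generated by transvections along isotropic vectors only. As these span
  the complement, additivity supplies the transvections along all vectors.
\<close>

lemma generators_from_isotropic:
  assumes sp: "locally_spanned e f" and N: "subgroup N \<O>" and g: "g \<in> carrier M" "B g g = \<zero>"
    and I: "ideal I R"
    and iso: "\<And>c x. c \<in> I \<Longrightarrow> x \<in> plane_complement e f \<Longrightarrow> B x x = \<zero> \<Longrightarrow> c \<odot>\<^bsub>M\<^esub> x \<in> directions N g"
    and "c \<in> I" "p \<in> plane_complement e f"
  shows "eichler g (c \<odot>\<^bsub>M\<^esub> p) \<in> N"
proof -
  have "plane_complement e f \<subseteq> {x \<in> carrier M. \<forall>c\<in>I. c \<odot>\<^bsub>M\<^esub> (\<lambda>x. x) x \<in> directions N g}"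
  proof (rule locally_spannedD[OF sp directions_preimage_submodule[OF N g I]])
    show "(\<lambda>x. x) \<in> module_hom R M M" by (auto simp: module_hom_def)
    fix \<mm> x t assume m: "maximalideal \<mm> R" and w: "hyperbolic_witness e f x t" and t: "t \<notin> \<mm>"
    have "\<one> \<in> carrier R - \<mm>"
      using m maximalideal.I_notcarr[OF m] ideal.one_imp_carrier[OF maximalideal.axioms(1)[OF m]] by auto
    moreover have "\<one> \<odot>\<^bsub>M\<^esub> x \<in> {x \<in> carrier M. \<forall>c\<in>I. c \<odot>\<^bsub>M\<^esub> x \<in> directions N g}"
      using w hyperbolic_witness_closed[OF w] iso by (auto simp: hyperbolic_witness_def)
    ultimately show "\<exists>s\<in>carrier R - \<mm>. s \<odot>\<^bsub>M\<^esub> x \<in> {x \<in> carrier M. \<forall>c\<in>I. c \<odot>\<^bsub>M\<^esub> x \<in> directions N g}" by blast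
  qed
  then show ?thesis using assms(7,8) by (auto simp: directions_def)
qed

lemma koszul_module_hom:
  assumes [simp]: "v \<in> carrier M" "x \<in> carrier M"
  shows "koszul v x \<in> module_hom R M M"
  unfolding module_hom_def
  by (auto simp: koszul_def form_simps smult_l_distr smult_r_distr R.minus_add[symmetric] M.minus_add M.a_ac R.m_ac
      smult_l_minus smult_r_minus R.r_minus smult_assoc1[symmetric])

lemma koszul_self: "v \<in> carrier M \<Longrightarrow> x \<in> carrier M \<Longrightarrow> koszul v x x = \<zero>\<^bsub>M\<^esub>"
  by (simp add: koszul_def smult_l_minus M.r_neg)

lemma koszul_add: "v \<in> carrier M \<Longrightarrow> x \<in> carrier M \<Longrightarrow> y \<in> carrier M \<Longrightarrow> y' \<in> carrier M \<Longrightarrow>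
    koszul v x (y \<oplus>\<^bsub>M\<^esub> y') = koszul v x y \<oplus>\<^bsub>M\<^esub> koszul v x y'"
  using koszul_module_hom[of v x] by (auto simp: module_hom_def)

lemma koszul_smult: "v \<in> carrier M \<Longrightarrow> x \<in> carrier M \<Longrightarrow> y \<in> carrier M \<Longrightarrow> a \<in> carrier R \<Longrightarrow>
    koszul v x (a \<odot>\<^bsub>M\<^esub> y) = a \<odot>\<^bsub>M\<^esub> koszul v x y"
  using koszul_module_hom[of v x] by (auto simp: module_hom_def)

text \<open>
  The Koszul relation \<open>\<langle>v,z\<rangle>[x,y] + \<langle>v,x\<rangle>[y,z] + \<langle>v,y\<rangle>[z,x] = 0\<close>.
\<close>

lemma koszul_cyclic:
  assumes [simp]: "v \<in> carrier M" "x \<in> carrier M" "y \<in> carrier M" "z \<in> carrier M"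
  shows "B v z \<odot>\<^bsub>M\<^esub> koszul v x y = (\<ominus> B v x) \<odot>\<^bsub>M\<^esub> koszul v y z \<oplus>\<^bsub>M\<^esub> B v y \<odot>\<^bsub>M\<^esub> koszul v x z"
proof -
  define a b c where "a = B v x" and "b = B v y" and "c = B v z"
  have [simp]: "a \<in> carrier R" "b \<in> carrier R" "c \<in> carrier R" by (simp_all add: a_def b_def c_def)
  have "(\<ominus> a) \<odot>\<^bsub>M\<^esub> koszul v y z \<oplus>\<^bsub>M\<^esub> b \<odot>\<^bsub>M\<^esub> koszul v x z =
     (\<ominus>\<^bsub>M\<^esub> ((a \<otimes> b) \<odot>\<^bsub>M\<^esub> z) \<oplus>\<^bsub>M\<^esub> (a \<otimes> c) \<odot>\<^bsub>M\<^esub> y) \<oplus>\<^bsub>M\<^esub> ((a \<otimes> b) \<odot>\<^bsub>M\<^esub> z \<oplus>\<^bsub>M\<^esub> \<ominus>\<^bsub>M\<^esub> ((b \<otimes> c) \<odot>\<^bsub>M\<^esub> x))"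
    by (simp add: koszul_def flip: a_def b_def c_def)
      (simp add: smult_r_distr smult_l_minus smult_r_minus R.m_ac R.l_minus R.r_minus M.minus_add flip: smult_assoc1)
  also have "\<dots> = (a \<otimes> c) \<odot>\<^bsub>M\<^esub> y \<oplus>\<^bsub>M\<^esub> \<ominus>\<^bsub>M\<^esub> ((b \<otimes> c) \<odot>\<^bsub>M\<^esub> x)"
    by (simp add: M.a_ac M.r_neg1 M.r_neg2)
  also have "\<dots> = c \<odot>\<^bsub>M\<^esub> koszul v x y"
    by (simp add: koszul_def smult_r_distr smult_l_minus smult_r_minus R.m_ac flip: smult_assoc1 a_def b_def c_def)
  finally show ?thesis by (simp add: a_def b_def c_def)
qed

end

locale locally_spanned_pair = elementary_pair +
  assumes spanned: "locally_spanned e f" and unimodular: "locally_unimodular e f"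
begin

lemma swapped_spanned: "locally_spanned_pair R M B h f e K L I"
  by (intro locally_spanned_pair.intro swapped locally_spanned_pair_axioms.intro
    locally_spanned_sym[OF spanned] locally_unimodular_sym[OF unimodular])

lemma koszul_directions:
  assumes v: "v \<in> carrier M" "B v v = \<zero>" and "c \<in> I" "x \<in> plane_complement e f"
  shows "c \<odot>\<^bsub>M\<^esub> koszul v f x \<in> directions L v"
proof -
  let ?Y = "{x \<in> carrier M. \<forall>c\<in>I. c \<odot>\<^bsub>M\<^esub> koszul v f x \<in> directions L v}"
  have submod: "submodule ?Y R M"
    by (rule directions_preimage_submodule[OF subgroup_L v ideal_I koszul_module_hom[OF v(1) f_carrier]])
  have "plane_complement e f \<subseteq> ?Y"
  proof (rule locally_spannedD[OF spanned submod])
    fix \<mm> x t assume m: "maximalideal \<mm> R" and w: "hyperbolic_witness e f x t" and t: "t \<notin> \<mm>"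
    have [simp]: "x \<in> carrier M" "t \<in> carrier R" using hyperbolic_witness_closed[OF w] by auto
    obtain z z' where z: "x \<in> plane_complement e f" "B x x = \<zero>" "z \<in> plane_complement e f" "z' \<in> plane_complement e f"
      "B z z = \<zero>" "B z' z' = \<zero>" "B x z = \<zero>" "B x z' = \<zero>" "B z z' = t"
      using w by (auto simp: hyperbolic_witness_def)
    have "t \<otimes> t \<in> carrier R - \<mm>"
      using primeideal.I_prime[OF R.maximalideal_prime[OF m], of t t] t by auto
    moreover have "(t \<otimes> t) \<odot>\<^bsub>M\<^esub> x \<in> ?Y"
    proof -
      have "c \<odot>\<^bsub>M\<^esub> koszul v f ((t \<otimes> t) \<odot>\<^bsub>M\<^esub> x) \<in> directions L v" if "c \<in> I" for c
        using koszul_directions_witnessed[OF that v z(1,2) z(3,5,7) z(4,6,8)] v that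
        by (simp add: z(9) koszul_smult R.m_comm[of c] flip: smult_assoc1)
      then show ?thesis by auto
    qed
    ultimately show "\<exists>s\<in>carrier R - \<mm>. s \<odot>\<^bsub>M\<^esub> x \<in> ?Y" by blast
  qed
  then show ?thesis using assms by auto
qed

text \<open>
  For \<open>u\<close> orthogonal to \<open>v\<close> one has \<open>\<langle>v,f\<rangle>u = [f,u]\<close>, and \<open>[f,u]\<close> is linear in \<open>u\<close>. Split \<open>u\<close> along
  \<open>e\<close>, \<open>f\<close> and the complement. The complement is covered by the previous lemma and \<open>[f,f] = 0\<close>; the
  remaining \<open>[f,e]\<close> becomes a combination of \<open>[e,y]\<close> and \<open>[f,y]\<close> after multiplication with \<open>\<langle>v,y\<rangle>\<close>.
\<close>

lemma multiple_directions:
  assumes v: "v \<in> carrier M" "B v v = \<zero>" and y: "y \<in> plane_complement e f"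
    and u: "u \<in> ideal_times_module I M" "u \<in> carrier M" "B v u = \<zero>"
  shows "(B v y \<otimes> B v f) \<odot>\<^bsub>M\<^esub> u \<in> directions L v"
proof -
  interpret sw: locally_spanned_pair R M B h f e K L I by (rule swapped_spanned)
  note [simp] = v plane_complementD[OF y e_carrier f_carrier]
  define \<tau> where "\<tau> = B v y"
  have [simp]: "\<tau> \<in> carrier R" by (simp add: \<tau>_def)
  have "\<tau> \<odot>\<^bsub>M\<^esub> koszul v f u \<in> directions L v" using u(1) ideal_I
  proof (induction rule: ideal_times_module_induct)
    case zero
    then show ?case
      using koszul_smult[of v f "\<zero>\<^bsub>M\<^esub>" \<zero>] zero_in_directions[OF subgroup_L v(1)] by simp
  next
    case (add x x')
    then show ?case using directions_add[OF subgroup_L v] by (simp add: koszul_add smult_r_distr)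
  next
    case (smult c m)
    note [simp] = \<open>m \<in> carrier M\<close> I_carrier[OF \<open>c \<in> I\<close>]
    obtain r where r: "r \<in> plane_complement e f" and mr: "m = B m f \<odot>\<^bsub>M\<^esub> e \<oplus>\<^bsub>M\<^esub> (B m e \<odot>\<^bsub>M\<^esub> f \<oplus>\<^bsub>M\<^esub> r)"
      using pair_decomposition[of m] by auto
    note [simp] = plane_complementD[OF r e_carrier f_carrier]
    define \<alpha> where "\<alpha> = B m f"
    have [simp]: "\<alpha> \<in> carrier R" by (simp add: \<alpha>_def)
    have "koszul v f m = koszul v f (\<alpha> \<odot>\<^bsub>M\<^esub> e \<oplus>\<^bsub>M\<^esub> (B m e \<odot>\<^bsub>M\<^esub> f \<oplus>\<^bsub>M\<^esub> r))"
      unfolding \<alpha>_def by (rule arg_cong[OF mr])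
    also have "\<dots> = \<alpha> \<odot>\<^bsub>M\<^esub> koszul v f e \<oplus>\<^bsub>M\<^esub> koszul v f r"
      by (simp add: koszul_add koszul_smult koszul_self)
    finally have "\<tau> \<odot>\<^bsub>M\<^esub> koszul v f (c \<odot>\<^bsub>M\<^esub> m) =
        (\<alpha> \<otimes> c) \<odot>\<^bsub>M\<^esub> (\<tau> \<odot>\<^bsub>M\<^esub> koszul v f e) \<oplus>\<^bsub>M\<^esub> (\<tau> \<otimes> c) \<odot>\<^bsub>M\<^esub> koszul v f r"
      by (simp add: koszul_smult smult_r_distr R.m_ac flip: smult_assoc1)
    also have "\<tau> \<odot>\<^bsub>M\<^esub> koszul v f e =
        (\<ominus> B v f) \<odot>\<^bsub>M\<^esub> koszul v e y \<oplus>\<^bsub>M\<^esub> B v e \<odot>\<^bsub>M\<^esub> koszul v f y"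
      unfolding \<tau>_def by (rule koszul_cyclic) auto
    also have "(\<alpha> \<otimes> c) \<odot>\<^bsub>M\<^esub> \<dots> =
        (\<ominus> B v f \<otimes> (\<alpha> \<otimes> c)) \<odot>\<^bsub>M\<^esub> koszul v e y \<oplus>\<^bsub>M\<^esub> (B v e \<otimes> (\<alpha> \<otimes> c)) \<odot>\<^bsub>M\<^esub> koszul v f y"
      by (simp add: smult_r_distr R.m_comm[of "\<alpha> \<otimes> c"] flip: smult_assoc1)
    finally show ?case
      using smult(1) r y plane_complement_sym[of e f]
      by (auto intro!: directions_add[OF subgroup_L v] koszul_directions sw.koszul_directions I_mult)
  qed
  moreover have "koszul v f u = B v f \<odot>\<^bsub>M\<^esub> u" using u by (simp add: koszul_def)
  ultimately show ?thesis using u by (simp add: \<tau>_def smult_assoc1)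
qed

text \<open>
  If \<open>\<langle>v,f\<rangle>\<close> is a unit modulo \<open>\<mm>\<close>, then a transformation \<open>E(f,p)\<close> leaves it unchanged and can make
  the component of \<open>v\<close> in the complement nonzero modulo \<open>\<mm>\<close>.
\<close>

lemma koszul_multiplier_in_maximalideal:
  assumes v: "v \<in> carrier M" and m: "maximalideal \<mm> R"
    and all: "\<And>k y. k \<in> K \<Longrightarrow> y \<in> plane_complement e f \<Longrightarrow> B (k v) y \<otimes> B (k v) f \<in> \<mm>"
  shows "B v f \<in> \<mm>"
proof (rule ccontr)
  assume a: "B v f \<notin> \<mm>"
  note [simp] = v
  have prime: "primeideal \<mm> R" by (rule R.maximalideal_prime[OF m])
  have ideal: "ideal \<mm> R" by (rule maximalideal.axioms(1)[OF m])
  have vy: "B v y \<in> \<mm>" if y: "y \<in> plane_complement e f" for y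
  proof -
    note [simp] = plane_complementD[OF y e_carrier f_carrier]
    have "B v y \<otimes> B v f \<in> \<mm>"
      using all[OF subgroup.one_closed[OF subgroup_K] y] by (simp add: isometry_one)
    then show ?thesis using primeideal.I_prime[OF prime, of "B v y" "B v f"] a by simp
  qed
  obtain p q where p: "p \<in> plane_complement e f" and q: "q \<in> plane_complement e f" and pq: "B p q \<notin> \<mm>"
    using unimodular m unfolding locally_unimodular_def by blast
  note [simp] = plane_complementD[OF p e_carrier f_carrier] plane_complementD[OF q e_carrier f_carrier]
  let ?v = "eichler f p v"
  have "B ?v f = B v f" and vq: "B ?v q = B v f \<otimes> B p q \<oplus> B v q"
    by (simp_all add: eichler_apply form_simps R.a_comm)
  moreover have "B ?v q \<otimes> B ?v f \<in> \<mm>" by (rule all[OF gen_K(2)[OF p] q])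
  ultimately have "B ?v q \<in> \<mm>" using primeideal.I_prime[OF prime, of "B ?v q" "B v f"] a by simp
  then have "B v f \<otimes> B p q \<in> \<mm>"
    using R.ideal_add_cancel[OF ideal, of "B v f \<otimes> B p q" "B v q"] vy[OF q] by (simp add: vq)
  then show False using primeideal.I_prime[OF prime, of "B v f" "B p q"] a pq by simp
qed

text \<open>
  The scalars \<open>t\<close> with \<open>E(v,tu)\<close> in \<open>L\<close> for all multiples of \<open>u\<close> form an ideal \<open>J\<close>. As \<open>L\<close> is normalized by
  \<open>K\<close>, replacing \<open>(v,u)\<close> by \<open>(kv,ku)\<close> with \<open>k \<in> K\<close> does not change \<open>J\<close>, so \<open>J\<close> contains all products
  \<open>\<langle>kv,y\<rangle>\<langle>kv,f\<rangle>\<close> and \<open>\<langle>kv,y\<rangle>\<langle>kv,e\<rangle>\<close>. For every maximal ideal one of these products lies outside, because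
  \<open>v\<close> is unimodular; hence \<open>J = R\<close>.
\<close>

lemma unimodular_directions:
  assumes v: "v \<in> carrier M" "B v v = \<zero>" and w: "w \<in> carrier M" "B v w = \<one>"
    and u: "u \<in> ideal_times_module I M" "u \<in> carrier M" "B v u = \<zero>"
    and inv: "\<And>k x. k \<in> K \<Longrightarrow> x \<in> ideal_times_module I M \<Longrightarrow> k x \<in> ideal_times_module I M"
  shows "u \<in> directions L v"
proof -
  interpret sw: locally_spanned_pair R M B h f e K L I by (rule swapped_spanned)
  note [simp] = v(1) w(1) u(2)
  \<comment> \<open>\<open>directions L v\<close> is only an additive group; the quantifier over \<open>c\<close> makes \<open>J\<close> an ideal.\<close>
  define J where "J = {t \<in> carrier R. \<forall>c\<in>carrier R. (c \<otimes> t) \<odot>\<^bsub>M\<^esub> u \<in> directions L v}"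
  have J: "ideal J R"
  proof (rule idealI[OF R.ring_axioms])
    have scale: "a \<otimes> t \<in> J" if "t \<in> J" "a \<in> carrier R" for a t
    proof -
      have "(c \<otimes> (a \<otimes> t)) \<odot>\<^bsub>M\<^esub> u \<in> directions L v" if "c \<in> carrier R" for c
        using \<open>t \<in> J\<close> \<open>a \<in> carrier R\<close> that by (simp add: J_def flip: R.m_assoc)
      then show ?thesis using that by (simp add: J_def)
    qed
    show "a \<otimes> t \<in> J" "t \<otimes> a \<in> J" if "t \<in> J" "a \<in> carrier R" for a t
      using scale[OF that] that R.m_comm[of t a] by (auto simp: J_def)
    show "subgroup J (add_monoid R)"
    proof (rule R.add.subgroupI)
      show "J \<subseteq> carrier R" by (auto simp: J_def)
      have "\<zero> \<in> J" using zero_in_directions[OF subgroup_L v(1)] by (simp add: J_def)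
      then show "J \<noteq> {}" by auto
      fix t assume t: "t \<in> J"
      then have "\<ominus> t = \<ominus> \<one> \<otimes> t" by (simp add: J_def R.l_minus)
      with scale[OF t, of "\<ominus> \<one>"] show "\<ominus> t \<in> J" by simp
      fix t' assume t': "t' \<in> J"
      show "t \<oplus> t' \<in> J"
        using t t' directions_add[OF subgroup_L v] by (simp add: J_def smult_l_distr R.r_distr)
    qed
  qed
  have mult_J: "B (k v) y \<otimes> B (k v) g \<in> J" if k: "k \<in> K" and y: "y \<in> plane_complement e f" and g: "g = e \<or> g = f" for k y g
  proof -
    note [simp] = plane_complementD[OF y e_carrier f_carrier]
    have kO: "k \<in> carrier \<O>" using k subgroup.subset[OF subgroup_K] by auto
    have ki: "inv\<^bsub>\<O>\<^esub> k \<in> K" "inv\<^bsub>\<O>\<^esub> k \<in> carrier \<O>" using k kO subgroup.m_inv_closed[OF subgroup_K] by auto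
    have kik: "(inv\<^bsub>\<O>\<^esub> k) (k x) = x" if "x \<in> carrier M" for x
      using isometry_mult_apply[OF ki(2) kO that] O.l_inv[OF kO] that by (simp add: isometry_one)
    have [simp]: "k v \<in> carrier M" "k u \<in> carrier M" "g \<in> carrier M" using isometry_closed[OF kO] g by auto
    let ?t = "B (k v) y \<otimes> B (k v) g"
    have kv: "B (k v) (k v) = \<zero>" "B (k v) (k u) = \<zero>" using v u by (simp_all add: isometry_form[OF kO])
    have "(c \<otimes> ?t) \<odot>\<^bsub>M\<^esub> u \<in> directions L v" if c: "c \<in> carrier R" for c
    proof -
      have ku: "c \<odot>\<^bsub>M\<^esub> k u \<in> ideal_times_module I M" "c \<odot>\<^bsub>M\<^esub> k u \<in> carrier M" "B (k v) (c \<odot>\<^bsub>M\<^esub> k u) = \<zero>"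
        using c kv ideal_times_module_smult[OF inv[OF k u(1)] ideal_I c] by (simp_all add: form_simps)
      have tku: "?t \<odot>\<^bsub>M\<^esub> (c \<odot>\<^bsub>M\<^esub> k u) \<in> directions L (k v)"
        using g multiple_directions[OF \<open>k v \<in> carrier M\<close> kv(1) y ku]
          sw.multiple_directions[OF \<open>k v \<in> carrier M\<close> kv(1) y[unfolded plane_complement_sym[of e f]] ku] by auto
      have "(inv\<^bsub>\<O>\<^esub> k) (?t \<odot>\<^bsub>M\<^esub> (c \<odot>\<^bsub>M\<^esub> k u)) \<in> directions L ((inv\<^bsub>\<O>\<^esub> k) (k v))"
        by (rule directions_conj[OF ki(2) conj_L[OF ki(1)] \<open>k v \<in> carrier M\<close> kv(1) tku])
      then show ?thesis using c by (simp add: kik isometry_smult[OF ki(2)] R.m_comm[of c] smult_assoc1)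
    qed
    then show ?thesis by (simp add: J_def)
  qed
  have "J = carrier R"
  proof (rule ccontr)
    assume "J \<noteq> carrier R"
    then obtain \<mm> where m: "maximalideal \<mm> R" and Jm: "J \<subseteq> \<mm>" using R.exists_maximalideal[OF J] by auto
    have prime: "primeideal \<mm> R" by (rule R.maximalideal_prime[OF m])
    interpret \<mm>: maximalideal \<mm> R by (rule m)
    have ideal: "ideal \<mm> R" by (rule maximalideal.axioms(1)[OF m])
    have in_m: "B (k v) y \<otimes> B (k v) g \<in> \<mm>" if "k \<in> K" "y \<in> plane_complement e f" "g = e \<or> g = f" for k y g
      using mult_J[OF that] Jm by auto
    have a: "B v f \<in> \<mm>"
      by (rule koszul_multiplier_in_maximalideal[OF v(1) m]) (rule in_m, simp_all)
    have b: "B v e \<in> \<mm>"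
      by (rule sw.koszul_multiplier_in_maximalideal[OF v(1) m]) (rule in_m, simp_all add: plane_complement_sym[of e f])
    \<comment> \<open>Modulo \<open>\<mm>\<close> only the component of \<open>v\<close> in the complement survives; \<open>E(f,x)\<close> keeps it
      nonzero and makes \<open>\<langle>v,e\<rangle>\<close> nonzero.\<close>
    obtain x where x: "x \<in> plane_complement e f" and wx: "w = B w f \<odot>\<^bsub>M\<^esub> e \<oplus>\<^bsub>M\<^esub> (B w e \<odot>\<^bsub>M\<^esub> f \<oplus>\<^bsub>M\<^esub> x)"
      using pair_decomposition[OF w(1)] .
    note [simp] = plane_complementD[OF x e_carrier f_carrier]
    have one: "\<one> \<notin> \<mm>" using \<mm>.one_imp_carrier \<mm>.I_notcarr by auto
    have "\<one> = B v (B w f \<odot>\<^bsub>M\<^esub> e \<oplus>\<^bsub>M\<^esub> (B w e \<odot>\<^bsub>M\<^esub> f \<oplus>\<^bsub>M\<^esub> x))"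
      using w(2) arg_cong[OF wx, of "B v"] by simp
    also have "\<dots> = B w f \<otimes> B v e \<oplus> (B w e \<otimes> B v f \<oplus> B v x)" by (simp add: form_simps)
    finally have sum1: "B w f \<otimes> B v e \<oplus> (B w e \<otimes> B v f \<oplus> B v x) \<notin> \<mm>" using one by simp
    have vx: "B v x \<notin> \<mm>"
      using sum1 \<mm>.I_l_closed[OF a, of "B w e"] \<mm>.I_l_closed[OF b, of "B w f"]
        additive_subgroup.a_closed[OF \<mm>.additive_subgroup_axioms] by auto
    let ?v = "eichler f x v"
    let ?c = "\<ominus> (B v x \<oplus> h \<otimes> B x x \<otimes> B v f)"
    have ve: "B ?v e = B v e \<oplus> ?c" and vx': "B ?v x = B v x \<oplus> B v f \<otimes> B x x"
      by (simp_all add: eichler_apply form_simps)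
    have "B ?v x \<notin> \<mm>"
      using R.ideal_add_cancel[OF ideal, of "B v x" "B v f \<otimes> B x x"] vx \<mm>.I_r_closed[OF a, of "B x x"]
      by (auto simp: vx')
    moreover have "B ?v e \<notin> \<mm>"
    proof
      assume *: "B ?v e \<in> \<mm>"
      let ?d = "B v x \<oplus> h \<otimes> B x x \<otimes> B v f"
      have "\<ominus> ?d \<oplus> B v e \<in> \<mm>" using * by (subst R.a_comm) (simp_all add: ve)
      then have "\<ominus> ?d \<in> \<mm>" by (rule R.ideal_add_cancel[OF ideal, rotated]) (simp_all add: b)
      then have "\<ominus> (\<ominus> ?d) \<in> \<mm>" by (rule additive_subgroup.a_inv_closed[OF \<mm>.additive_subgroup_axioms])
      then have "?d \<in> \<mm>" by simp
      moreover have "h \<otimes> B x x \<otimes> B v f \<in> \<mm>" by (rule \<mm>.I_l_closed[OF a]) simp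
      ultimately have "B v x \<in> \<mm>" by (rule R.ideal_add_cancel[OF ideal, rotated]) simp
      then show False using vx by contradiction
    qed
    moreover have "B ?v x \<otimes> B ?v e \<in> \<mm>" by (rule in_m[OF gen_K(2)[OF x] x]) auto
    ultimately show False using primeideal.I_prime[OF prime, of "B ?v x" "B ?v e"] by simp
  qed
  then have "\<one> \<in> J" by auto
  then have "(\<one> \<otimes> \<one>) \<odot>\<^bsub>M\<^esub> u \<in> directions L v" unfolding J_def by blast
  then show ?thesis by simp
qed

end

section \<open>Split forms over local rings\<close>

context symmetric_form_module begin

text \<open>
  Start from any complement \<open>C\<close> of \<open>N\<close>. For \<open>y \<in> C\<close> non-degeneracy represents the functional that vanishes
  on \<open>N\<close> and is \<open>-h\<langle>y,_\<rangle>\<close> on \<open>C\<close>, and the representing vector \<open>n\<close> lies in \<open>N\<^sup>\<bottom> = N\<close>. The vectors \<open>y + n\<close>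
  form the complement \<open>T\<close>: the form on \<open>C\<close> is cancelled by the two cross terms.
\<close>

lemma totally_isotropic_complement:
  assumes nondeg: "\<And>\<phi>. \<phi> \<in> module_hom R M (regular_module R) \<Longrightarrow> \<exists>x\<in>carrier M. \<forall>y\<in>carrier M. B x y = \<phi> y"
    and N: "direct_summand N R M" "N = orthogonal_complement R M B N"
  obtains T where "submodule T R M" "\<And>x y. x \<in> T \<Longrightarrow> y \<in> T \<Longrightarrow> B x y = \<zero>"
    "\<And>p. p \<in> carrier M \<Longrightarrow> \<exists>n\<in>N. \<exists>t\<in>T. p = n \<oplus>\<^bsub>M\<^esub> t"
proof -
  obtain C where sN: "submodule N R M" and sC: "submodule C R M"
    and inter: "N \<inter> C = {\<zero>\<^bsub>M\<^esub>}" and sum: "N <+>\<^bsub>M\<^esub> C = carrier M"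
    using N(1) by (auto simp: direct_summand_def)
  note Nc = subsetD[OF submoduleE(1)[OF sN]] and Cc = subsetD[OF submoduleE(1)[OF sC]]
  have NN: "B x y = \<zero>" if "x \<in> N" "y \<in> N" for x y
    using that N(2) by (auto simp: orthogonal_complement_def)
  have in_N: "p \<in> N" if "p \<in> carrier M" "\<And>x. x \<in> N \<Longrightarrow> B p x = \<zero>" for p
    by (subst N(2)) (use that in \<open>auto simp: orthogonal_complement_def\<close>)
  have dec: "\<exists>n\<in>N. \<exists>y\<in>C. p = n \<oplus>\<^bsub>M\<^esub> y" if "p \<in> carrier M" for p
  proof -
    have "p \<in> N <+>\<^bsub>M\<^esub> C" using that sum by simp
    then show ?thesis unfolding set_add_def' by blast
  qed
  have uniq: "y = y'" if "n \<in> N" "y \<in> C" "n' \<in> N" "y' \<in> C" "n \<oplus>\<^bsub>M\<^esub> y = n' \<oplus>\<^bsub>M\<^esub> y'" for n y n' y'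
  proof -
    note [simp] = Nc[OF that(1)] Cc[OF that(2)] Nc[OF that(3)] Cc[OF that(4)]
    have "y \<oplus>\<^bsub>M\<^esub> \<ominus>\<^bsub>M\<^esub> y' = \<ominus>\<^bsub>M\<^esub> n \<oplus>\<^bsub>M\<^esub> (n \<oplus>\<^bsub>M\<^esub> y) \<oplus>\<^bsub>M\<^esub> \<ominus>\<^bsub>M\<^esub> y'" by (simp add: M.r_neg1)
    also have "\<dots> = \<ominus>\<^bsub>M\<^esub> n \<oplus>\<^bsub>M\<^esub> n'" unfolding that(5) by (simp add: M.a_assoc M.r_neg)
    finally have eq: "y \<oplus>\<^bsub>M\<^esub> \<ominus>\<^bsub>M\<^esub> y' = \<ominus>\<^bsub>M\<^esub> n \<oplus>\<^bsub>M\<^esub> n'" .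
    have "y \<oplus>\<^bsub>M\<^esub> \<ominus>\<^bsub>M\<^esub> y' \<in> C" using that by (intro submoduleE(5)[OF sC] submoduleE(3)[OF sC])
    moreover have "\<ominus>\<^bsub>M\<^esub> n \<oplus>\<^bsub>M\<^esub> n' \<in> N" using that by (intro submoduleE(5)[OF sN] submoduleE(3)[OF sN])
    ultimately have "y \<oplus>\<^bsub>M\<^esub> \<ominus>\<^bsub>M\<^esub> y' = \<zero>\<^bsub>M\<^esub>" using eq inter by auto
    from M.minus_equality[OF this] show ?thesis by simp
  qed
  \<comment> \<open>the projection onto \<open>C\<close> along \<open>N\<close>\<close>
  define pr where "pr p = (SOME y. y \<in> C \<and> (\<exists>n\<in>N. p = n \<oplus>\<^bsub>M\<^esub> y))" for p
  have pr: "pr p \<in> C \<and> (\<exists>n\<in>N. p = n \<oplus>\<^bsub>M\<^esub> pr p)" if "p \<in> carrier M" for p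
    unfolding pr_def by (rule someI_ex) (use dec[OF that] in auto)
  have pr_eq: "pr p = y" if "p = n \<oplus>\<^bsub>M\<^esub> y" "n \<in> N" "y \<in> C" for p n y
  proof -
    have "p \<in> carrier M" using that Nc Cc by auto
    from pr[OF this] show ?thesis using uniq that by metis
  qed
  have pr_add: "pr (p \<oplus>\<^bsub>M\<^esub> q) = pr p \<oplus>\<^bsub>M\<^esub> pr q" if pq: "p \<in> carrier M" "q \<in> carrier M" for p q
  proof -
    obtain n where n: "n \<in> N" "p = n \<oplus>\<^bsub>M\<^esub> pr p" "pr p \<in> C" using pr[OF pq(1)] by auto
    obtain n' where n': "n' \<in> N" "q = n' \<oplus>\<^bsub>M\<^esub> pr q" "pr q \<in> C" using pr[OF pq(2)] by auto
    note [simp] = Nc[OF n(1)] Nc[OF n'(1)] Cc[OF n(3)] Cc[OF n'(3)]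
    have "p \<oplus>\<^bsub>M\<^esub> q = (n \<oplus>\<^bsub>M\<^esub> pr p) \<oplus>\<^bsub>M\<^esub> (n' \<oplus>\<^bsub>M\<^esub> pr q)" using n(2) n'(2) by simp
    also have "\<dots> = (n \<oplus>\<^bsub>M\<^esub> n') \<oplus>\<^bsub>M\<^esub> (pr p \<oplus>\<^bsub>M\<^esub> pr q)" by (simp add: M.a_ac)
    finally show ?thesis
      by (rule pr_eq) (use n n' submoduleE(5)[OF sN] submoduleE(5)[OF sC] in blast)+
  qed
  have pr_smult: "pr (a \<odot>\<^bsub>M\<^esub> p) = a \<odot>\<^bsub>M\<^esub> pr p" if ap: "a \<in> carrier R" "p \<in> carrier M" for a p
  proof -
    obtain n where n: "n \<in> N" "p = n \<oplus>\<^bsub>M\<^esub> pr p" "pr p \<in> C" using pr[OF ap(2)] by auto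
    note [simp] = Nc[OF n(1)] Cc[OF n(3)] ap(1)
    have "a \<odot>\<^bsub>M\<^esub> p = a \<odot>\<^bsub>M\<^esub> (n \<oplus>\<^bsub>M\<^esub> pr p)" using n(2) by simp
    also have "\<dots> = a \<odot>\<^bsub>M\<^esub> n \<oplus>\<^bsub>M\<^esub> a \<odot>\<^bsub>M\<^esub> pr p" by (simp add: smult_r_distr)
    finally show ?thesis
      by (rule pr_eq) (use n ap submoduleE(4)[OF sN] submoduleE(4)[OF sC] in blast)+
  qed
  have ex_n: "\<exists>n\<in>N. \<forall>y'\<in>C. B n y' = \<ominus> (h \<otimes> B y y')" if "y \<in> C" for y
  proof -
    note [simp] = Cc[OF that]
    have prc [simp]: "pr p \<in> carrier M" if "p \<in> carrier M" for p using pr[OF that] Cc by auto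
    have "(\<lambda>p. \<ominus> (h \<otimes> B y (pr p))) \<in> module_hom R M (regular_module R)"
      by (auto simp: module_hom_def regular_module_def pr_add pr_smult form_simps R.r_distr R.minus_add R.m_lcomm R.r_minus)
    from nondeg[OF this] obtain x where x: "x \<in> carrier M" "\<forall>p\<in>carrier M. B x p = \<ominus> (h \<otimes> B y (pr p))" by auto
    have prn: "pr n = \<zero>\<^bsub>M\<^esub>" if "n \<in> N" for n
      by (rule pr_eq[of _ n]) (use that Nc inter in auto)
    have pry: "pr y' = y'" if "y' \<in> C" for y'
      by (rule pr_eq[of _ "\<zero>\<^bsub>M\<^esub>"]) (use that Cc inter in auto)
    have "x \<in> N" by (rule in_N) (use x prn Nc in \<open>auto simp: form_simps\<close>)
    then show ?thesis using x pry Cc by (intro bexI[of _ x]) auto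
  qed
  define T where "T = {y \<oplus>\<^bsub>M\<^esub> n | y n. y \<in> C \<and> n \<in> N \<and> (\<forall>y'\<in>C. B n y' = \<ominus> (h \<otimes> B y y'))}"
  have T_smult: "a \<odot>\<^bsub>M\<^esub> t \<in> T" if a: "a \<in> carrier R" and t: "t \<in> T" for a t
  proof -
    obtain y n where yn: "t = y \<oplus>\<^bsub>M\<^esub> n" "y \<in> C" "n \<in> N" "\<forall>y'\<in>C. B n y' = \<ominus> (h \<otimes> B y y')"
      using t by (auto simp: T_def)
    note [simp] = Cc[OF yn(2)] Nc[OF yn(3)] a
    have "\<forall>y'\<in>C. B (a \<odot>\<^bsub>M\<^esub> n) y' = \<ominus> (h \<otimes> B (a \<odot>\<^bsub>M\<^esub> y) y')"
      using yn(4) Cc by (auto simp: form_simps R.m_lcomm R.r_minus)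
    moreover have "a \<odot>\<^bsub>M\<^esub> t = a \<odot>\<^bsub>M\<^esub> y \<oplus>\<^bsub>M\<^esub> a \<odot>\<^bsub>M\<^esub> n" by (simp add: yn(1) smult_r_distr)
    ultimately show ?thesis
      using submoduleE(4)[OF sN a yn(3)] submoduleE(4)[OF sC a yn(2)] unfolding T_def by blast
  qed
  have T_sub: "T \<subseteq> carrier M" unfolding T_def using Nc Cc by auto
  have "submodule T R M"
  proof (rule submoduleI)
    show "T \<subseteq> carrier M" by (rule T_sub)
    have "\<zero>\<^bsub>M\<^esub> \<oplus>\<^bsub>M\<^esub> \<zero>\<^bsub>M\<^esub> \<in> T" unfolding T_def using inter Cc by (force simp: form_simps)
    then show "\<zero>\<^bsub>M\<^esub> \<in> T" by simp
    show "\<ominus>\<^bsub>M\<^esub> t \<in> T" if "t \<in> T" for t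
      using T_smult[of "\<ominus> \<one>" t] that T_sub by (auto simp: smult_l_minus)
    show "t \<oplus>\<^bsub>M\<^esub> t' \<in> T" if t: "t \<in> T" and t': "t' \<in> T" for t t'
    proof -
      obtain y n where yn: "t = y \<oplus>\<^bsub>M\<^esub> n" "y \<in> C" "n \<in> N" "\<forall>y'\<in>C. B n y' = \<ominus> (h \<otimes> B y y')"
        using t by (auto simp: T_def)
      obtain y1 n1 where yn1: "t' = y1 \<oplus>\<^bsub>M\<^esub> n1" "y1 \<in> C" "n1 \<in> N" "\<forall>y'\<in>C. B n1 y' = \<ominus> (h \<otimes> B y1 y')"
        using t' by (auto simp: T_def)
      note [simp] = Cc[OF yn(2)] Nc[OF yn(3)] Cc[OF yn1(2)] Nc[OF yn1(3)]
      have "\<forall>y'\<in>C. B (n \<oplus>\<^bsub>M\<^esub> n1) y' = \<ominus> (h \<otimes> B (y \<oplus>\<^bsub>M\<^esub> y1) y')"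
        using yn(4) yn1(4) Cc by (auto simp: form_simps R.r_distr R.minus_add)
      moreover have "t \<oplus>\<^bsub>M\<^esub> t' = (y \<oplus>\<^bsub>M\<^esub> y1) \<oplus>\<^bsub>M\<^esub> (n \<oplus>\<^bsub>M\<^esub> n1)" by (simp add: yn(1) yn1(1) M.a_ac)
      ultimately show ?thesis
        using submoduleE(5)[OF sN yn(3) yn1(3)] submoduleE(5)[OF sC yn(2) yn1(2)] unfolding T_def by blast
    qed
  qed (rule T_smult)
  moreover have "B t t' = \<zero>" if t: "t \<in> T" and t': "t' \<in> T" for t t'
  proof -
    obtain y n where yn: "t = y \<oplus>\<^bsub>M\<^esub> n" "y \<in> C" "n \<in> N" "\<forall>y'\<in>C. B n y' = \<ominus> (h \<otimes> B y y')"
      using t by (auto simp: T_def)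
    obtain y1 n1 where yn1: "t' = y1 \<oplus>\<^bsub>M\<^esub> n1" "y1 \<in> C" "n1 \<in> N" "\<forall>y'\<in>C. B n1 y' = \<ominus> (h \<otimes> B y1 y')"
      using t' by (auto simp: T_def)
    note [simp] = Cc[OF yn(2)] Nc[OF yn(3)] Cc[OF yn1(2)] Nc[OF yn1(3)]
    define \<beta> where "\<beta> = h \<otimes> B y y1"
    have [simp]: "\<beta> \<in> carrier R" by (simp add: \<beta>_def)
    have cross: "B y y1 = \<beta> \<oplus> \<beta>" "B n y1 = \<ominus> \<beta>" "B y n1 = \<ominus> \<beta>"
      using yn(4) yn1(4) yn(2) yn1(2) form_sym[of y n1] form_sym[of y1 y]
      by (simp_all add: \<beta>_def half_double)
    have "B t t' = (\<beta> \<oplus> \<beta>) \<oplus> (\<ominus> \<beta> \<oplus> \<ominus> \<beta>)"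
      by (simp add: yn(1) yn1(1) form_simps cross NN yn yn1 R.a_ac)
    also have "\<dots> = \<zero>" by (simp add: R.a_ac R.r_neg R.r_neg1 R.r_neg2)
    finally show ?thesis .
  qed
  moreover have "\<exists>n\<in>N. \<exists>t\<in>T. p = n \<oplus>\<^bsub>M\<^esub> t" if p: "p \<in> carrier M" for p
  proof -
    obtain n y where ny: "n \<in> N" "y \<in> C" "p = n \<oplus>\<^bsub>M\<^esub> y" using dec[OF p] by auto
    obtain m where m: "m \<in> N" "\<forall>y'\<in>C. B m y' = \<ominus> (h \<otimes> B y y')" using ex_n[OF ny(2)] by auto
    note [simp] = Nc[OF ny(1)] Nc[OF m(1)] Cc[OF ny(2)]
    have "y \<oplus>\<^bsub>M\<^esub> m \<in> T" unfolding T_def using ny m by blast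
    moreover have "n \<oplus>\<^bsub>M\<^esub> \<ominus>\<^bsub>M\<^esub> m \<in> N"
      using ny m by (intro submoduleE(5)[OF sN] submoduleE(3)[OF sN])
    moreover have "p = (n \<oplus>\<^bsub>M\<^esub> \<ominus>\<^bsub>M\<^esub> m) \<oplus>\<^bsub>M\<^esub> (y \<oplus>\<^bsub>M\<^esub> m)"
      unfolding ny(3) by (simp add: M.a_comm[of y m] M.a_assoc M.r_neg1)
    ultimately show ?thesis by blast
  qed
  ultimately show ?thesis by (rule that)
qed

lemma dual_system_from_basis:
  assumes nondeg: "\<And>\<phi>. \<phi> \<in> module_hom R M (regular_module R) \<Longrightarrow> \<exists>x\<in>carrier M. \<forall>y\<in>carrier M. B x y = \<phi> y"
    and free: "free_of_rank R M r"
  obtains b c where "\<And>i. i < r \<Longrightarrow> b i \<in> carrier M" "\<And>i. i < r \<Longrightarrow> c i \<in> carrier M"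
    "\<And>i j. i < r \<Longrightarrow> j < r \<Longrightarrow> B (b i) (c j) = (if i = j then \<one> else \<zero>)"
proof -
  let ?F = "free_module R r"
  obtain f where f: "f \<in> module_hom R ?F M" "bij_betw f (carrier ?F) (carrier M)"
    using free by (auto simp: free_of_rank_def)
  define g where "g = inv_into (carrier ?F) f"
  have gc: "g x \<in> carrier ?F" and fg: "f (g x) = x" if "x \<in> carrier M" for x
    using f(2) that by (auto simp: g_def bij_betw_def inv_into_into f_inv_into_f)
  have gf: "g (f v) = v" if "v \<in> carrier ?F" for v
    using f(2) that by (auto simp: g_def bij_betw_def)
  have gi: "g x i \<in> carrier R" if "x \<in> carrier M" "i < r" for x i
    using gc[OF that(1)] that(2) by (auto simp: free_module_def PiE_def Pi_def)
  have Fadd: "v \<oplus>\<^bsub>?F\<^esub> w \<in> carrier ?F" if "v \<in> carrier ?F" "w \<in> carrier ?F" for v w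
    using that by (auto simp: free_module_def PiE_def Pi_def)
  have Fsm: "a \<odot>\<^bsub>?F\<^esub> w \<in> carrier ?F" if "a \<in> carrier R" "w \<in> carrier ?F" for a w
    using that by (auto simp: free_module_def PiE_def Pi_def)
  have gadd: "g (x \<oplus>\<^bsub>M\<^esub> y) = g x \<oplus>\<^bsub>?F\<^esub> g y" if "x \<in> carrier M" "y \<in> carrier M" for x y
  proof -
    have "f (g x \<oplus>\<^bsub>?F\<^esub> g y) = x \<oplus>\<^bsub>M\<^esub> y" using f(1) gc[OF that(1)] gc[OF that(2)] fg that by (auto simp: module_hom_def)
    then show ?thesis using gf[OF Fadd[OF gc[OF that(1)] gc[OF that(2)]]] by simp
  qed
  have gsm: "g (a \<odot>\<^bsub>M\<^esub> y) = a \<odot>\<^bsub>?F\<^esub> g y" if "a \<in> carrier R" "y \<in> carrier M" for a y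
  proof -
    have "f (a \<odot>\<^bsub>?F\<^esub> g y) = a \<odot>\<^bsub>M\<^esub> y" using f(1) gc[OF that(2)] fg that by (auto simp: module_hom_def)
    then show ?thesis using gf[OF Fsm[OF that(1) gc[OF that(2)]]] by simp
  qed
  have "\<exists>x\<in>carrier M. \<forall>y\<in>carrier M. B x y = g y i" if i: "i < r" for i
  proof (rule nondeg)
    show "(\<lambda>y. g y i) \<in> module_hom R M (regular_module R)"
      using i gi by (auto simp: module_hom_def regular_module_def gadd gsm) (auto simp: free_module_def)
  qed
  then obtain c where c: "\<And>i. i < r \<Longrightarrow> c i \<in> carrier M" "\<And>i y. i < r \<Longrightarrow> y \<in> carrier M \<Longrightarrow> B (c i) y = g y i"
    by metis
  define \<delta> where "\<delta> i = (\<lambda>j\<in>{..<r}. if i = j then \<one> else \<zero>)" for i :: nat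
  have \<delta>: "\<delta> i \<in> carrier ?F" for i by (auto simp: \<delta>_def free_module_def)
  have fd: "f (\<delta> i) \<in> carrier M" for i using f(1) \<delta> by (auto simp: module_hom_def)
  have "B (f (\<delta> i)) (c j) = (if i = j then \<one> else \<zero>)" if "i < r" "j < r" for i j
    using that form_sym[of "f (\<delta> i)" "c j"] c fd gf[OF \<delta>] by (simp add: \<delta>_def)
  with c(1) fd show ?thesis by (intro that[of "\<lambda>i. f (\<delta> i)" c]) auto
qed

text \<open>
  The special case of a hyperbolic witness over a local ring, where the scalar can be normalized.
\<close>

definition unit_witness :: "'c \<Rightarrow> bool" where
  "unit_witness x \<longleftrightarrow> x \<in> carrier M \<and> B x x = \<zero> \<and>
     (\<exists>z\<in>carrier M. \<exists>z'\<in>carrier M. B z z = \<zero> \<and> B z' z' = \<zero> \<and> B x z = \<zero> \<and> B x z' = \<zero> \<and> B z z' = \<one>)"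

lemma complement_pairing_mem:
  assumes z: "z \<in> carrier M" "z' \<in> carrier M" "B z z = \<zero>" "B z' z' = \<zero>" "B z z' = \<one>"
    and W: "\<And>p q. p \<in> plane_complement z z' \<Longrightarrow> q \<in> plane_complement z z' \<Longrightarrow> B p q \<in> \<nn>"
    and p: "p \<in> plane_complement z z'" and q: "q \<in> carrier M"
  shows "B p q \<in> \<nn>"
proof -
  note [simp] = z q plane_complementD[OF p z(1,2)]
  have z'z [simp]: "B z' z = \<one>" using form_sym[of z z'] by simp
  let ?q = "q \<oplus>\<^bsub>M\<^esub> ((\<ominus> B q z') \<odot>\<^bsub>M\<^esub> z \<oplus>\<^bsub>M\<^esub> (\<ominus> B q z) \<odot>\<^bsub>M\<^esub> z')"
  have "?q \<in> plane_complement z z'"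
    by (simp add: plane_complement_def form_simps R.r_neg)
  then have "B p ?q \<in> \<nn>" by (rule W[OF p])
  then show ?thesis by (simp add: form_simps)
qed

text \<open>
  If the form on the complement of the hyperbolic pair \<open>z\<close>, \<open>z'\<close> takes values in \<open>\<nn>\<close> only, then a vector
  of that complement pairs into \<open>\<nn>\<close> with everything. The combination of \<open>b1\<close>, \<open>b2\<close>, \<open>b3\<close> whose
  coefficients are the cross product \<open>u \<times> v\<close> of their coordinates is such a vector, and so is
  \<open>u1 b2 - u2 b1 - w3 z\<close>; pairing these with \<open>c3\<close> and \<open>c2\<close> extracts \<open>w3\<close> and then \<open>u1\<close>.
\<close>

lemma coordinate_mem:
  assumes nn: "ideal \<nn> R"
    and z: "z \<in> carrier M" "z' \<in> carrier M" "B z z = \<zero>" "B z' z' = \<zero>" "B z z' = \<one>"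
    and W: "\<And>p q. p \<in> plane_complement z z' \<Longrightarrow> q \<in> plane_complement z z' \<Longrightarrow> B p q \<in> \<nn>"
    and b: "b1 \<in> carrier M" "b2 \<in> carrier M" "b3 \<in> carrier M"
    and c: "c2 \<in> carrier M" "c3 \<in> carrier M"
    and bc: "B b1 c2 = \<zero>" "B b2 c2 = \<one>" "B b1 c3 = \<zero>" "B b2 c3 = \<zero>" "B b3 c3 = \<one>"
  shows "B b1 z \<in> \<nn>"
proof -
  interpret nn: ideal \<nn> R by (rule nn)
  note [simp] = z b c bc
  have z'z [simp]: "B z' z = \<one>" using form_sym[of z z'] by simp
  define u1 u2 u3 where "u1 = B b1 z" and "u2 = B b2 z" and "u3 = B b3 z"
  define v1 v2 v3 where "v1 = B b1 z'" and "v2 = B b2 z'" and "v3 = B b3 z'"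
  have [simp]: "u1 \<in> carrier R" "u2 \<in> carrier R" "u3 \<in> carrier R" "v1 \<in> carrier R" "v2 \<in> carrier R" "v3 \<in> carrier R"
    by (simp_all add: u1_def u2_def u3_def v1_def v2_def v3_def)
  note [simp] = u1_def[symmetric] u2_def[symmetric] u3_def[symmetric] v1_def[symmetric] v2_def[symmetric] v3_def[symmetric]
  define w1 w2 w3 where "w1 = u2 \<otimes> v3 \<oplus> \<ominus> (u3 \<otimes> v2)" and "w2 = u3 \<otimes> v1 \<oplus> \<ominus> (u1 \<otimes> v3)"
    and "w3 = u1 \<otimes> v2 \<oplus> \<ominus> (u2 \<otimes> v1)"
  have [simp]: "w1 \<in> carrier R" "w2 \<in> carrier R" "w3 \<in> carrier R" by (simp_all add: w1_def w2_def w3_def)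
  note mem = complement_pairing_mem[OF z W]
  have cancel: "x \<oplus> (y \<oplus> (\<ominus> x \<oplus> \<ominus> y)) = \<zero>" if "x \<in> carrier R" "y \<in> carrier R" for x y
    using that R.r_neg[of "x \<oplus> y"] by (simp add: R.a_assoc flip: R.minus_add)
  have "w1 \<odot>\<^bsub>M\<^esub> b1 \<oplus>\<^bsub>M\<^esub> (w2 \<odot>\<^bsub>M\<^esub> b2 \<oplus>\<^bsub>M\<^esub> w3 \<odot>\<^bsub>M\<^esub> b3) \<in> plane_complement z z'"
    unfolding plane_complement_def
    by (simp add: form_simps)
      (simp add: w1_def w2_def w3_def R.l_distr R.r_distr R.l_minus R.r_minus R.m_ac R.a_ac R.r_neg R.r_neg1 R.r_neg2 cancel)
  from mem[OF _ _ this c(2)] have w3: "w3 \<in> \<nn>" by (simp add: form_simps)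
  have "u1 \<odot>\<^bsub>M\<^esub> b2 \<oplus>\<^bsub>M\<^esub> ((\<ominus> u2) \<odot>\<^bsub>M\<^esub> b1 \<oplus>\<^bsub>M\<^esub> (\<ominus> w3) \<odot>\<^bsub>M\<^esub> z) \<in> plane_complement z z'"
    unfolding plane_complement_def
    by (simp add: form_simps)
      (simp add: w3_def R.l_minus R.r_minus R.minus_add R.m_ac R.a_ac R.r_neg R.r_neg1 R.r_neg2 cancel)
  from mem[OF _ _ this c(1)] have "u1 \<oplus> \<ominus> w3 \<otimes> B z c2 \<in> \<nn>" by (simp add: form_simps)
  moreover have "\<ominus> w3 \<otimes> B z c2 \<in> \<nn>"
    by (intro nn.I_r_closed additive_subgroup.a_inv_closed[OF nn.additive_subgroup_axioms] w3) simp
  ultimately show ?thesis using R.ideal_add_cancel[OF nn, of u1] by simp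
qed

text \<open>
  A dual system of size three does not fit into a plane modulo \<open>\<nn>\<close>. Inside the complement of one
  hyperbolic pair there is therefore room for another.
\<close>

lemma complement_unit_pairing:
  fixes b c :: "nat \<Rightarrow> 'c"
  assumes nn: "ideal \<nn> R" "\<one> \<notin> \<nn>"
    and z: "z \<in> carrier M" "z' \<in> carrier M" "B z z = \<zero>" "B z' z' = \<zero>" "B z z' = \<one>"
    and b: "\<And>i. i < 3 \<Longrightarrow> b i \<in> carrier M" and c: "\<And>i. i < 3 \<Longrightarrow> c i \<in> carrier M"
    and bc: "\<And>i j. i < 3 \<Longrightarrow> j < 3 \<Longrightarrow> B (b i) (c j) = (if i = j then \<one> else \<zero>)"
  shows "\<exists>p\<in>plane_complement z z'. \<exists>q\<in>plane_complement z z'. B p q \<notin> \<nn>"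
proof (rule ccontr)
  assume "\<not> ?thesis"
  then have W: "B p q \<in> \<nn>" if "p \<in> plane_complement z z'" "q \<in> plane_complement z z'" for p q
    using that by blast
  interpret nn: ideal \<nn> R by (rule nn)
  let ?b = "b (0::nat)" and ?c = "c (0::nat)"
  have [simp]: "?b \<in> carrier M" "?c \<in> carrier M" using b c by auto
  note [simp] = z
  have z'z [simp]: "B z' z = \<one>" using form_sym[of z z'] by simp
  have u: "B ?b z \<in> \<nn>"
    by (rule coordinate_mem[OF nn(1) z W, of _ "b 1" "b 2" "c 1" "c 2"]) (auto simp: b c bc)
  have v: "B ?b z' \<in> \<nn>"
    by (rule coordinate_mem[OF nn(1) z(2,1,4,3) z'z, of _ "b 1" "b 2" "c 1" "c 2"])
      (auto simp: b c bc plane_complement_sym[of z'] intro: W)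
  let ?p = "?b \<oplus>\<^bsub>M\<^esub> ((\<ominus> B ?b z') \<odot>\<^bsub>M\<^esub> z \<oplus>\<^bsub>M\<^esub> (\<ominus> B ?b z) \<odot>\<^bsub>M\<^esub> z')"
  have "?p \<in> plane_complement z z'"
    by (simp add: plane_complement_def form_simps R.r_neg)
  from complement_pairing_mem[OF z W this, of ?c]
  have "\<one> \<oplus> (\<ominus> B ?b z' \<otimes> B z ?c \<oplus> \<ominus> B ?b z \<otimes> B z' ?c) \<in> \<nn>" by (simp add: form_simps bc)
  moreover have "\<ominus> B ?b z' \<otimes> B z ?c \<oplus> \<ominus> B ?b z \<otimes> B z' ?c \<in> \<nn>"
    by (intro additive_subgroup.a_closed[OF nn.additive_subgroup_axioms] nn.I_r_closed
      additive_subgroup.a_inv_closed[OF nn.additive_subgroup_axioms] u v) simp_all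
  ultimately have "\<one> \<in> \<nn>" using R.ideal_add_cancel[OF nn(1), of \<one>] by simp
  with nn(2) show False ..
qed

text \<open>
  There are two orthogonal hyperbolic pairs \<open>z\<close>, \<open>z'\<close> and \<open>y\<close>, \<open>y'\<close> with \<open>z\<close>, \<open>y\<close> in \<open>N\<close> and \<open>z'\<close>, \<open>y'\<close> in
  \<open>T\<close>. For \<open>n \<in> N\<close> the summand \<open>\<langle>n,z'\<rangle>z\<close> is orthogonal to the second pair and the rest \<open>n - \<langle>n,z'\<rangle>z\<close> is
  orthogonal to the first; likewise for \<open>T\<close>.
\<close>

lemma sum_of_unit_witnesses:
  fixes b c :: "nat \<Rightarrow> 'c"
  assumes nn: "ideal \<nn> R" "\<one> \<notin> \<nn>" and units: "\<And>a. a \<in> carrier R \<Longrightarrow> a \<notin> \<nn> \<Longrightarrow> a \<in> Units R"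
    and N: "submodule N R M" "\<And>x y. x \<in> N \<Longrightarrow> y \<in> N \<Longrightarrow> B x y = \<zero>"
    and T: "submodule T R M" "\<And>x y. x \<in> T \<Longrightarrow> y \<in> T \<Longrightarrow> B x y = \<zero>"
    and NT: "\<And>p. p \<in> carrier M \<Longrightarrow> \<exists>n\<in>N. \<exists>t\<in>T. p = n \<oplus>\<^bsub>M\<^esub> t"
    and b: "\<And>i. i < 3 \<Longrightarrow> b i \<in> carrier M" and c: "\<And>i. i < 3 \<Longrightarrow> c i \<in> carrier M"
    and bc: "\<And>i j. i < 3 \<Longrightarrow> j < 3 \<Longrightarrow> B (b i) (c j) = (if i = j then \<one> else \<zero>)"
    and p: "p \<in> carrier M"
  shows "\<exists>x1 x2 x3 x4. unit_witness x1 \<and> unit_witness x2 \<and> unit_witness x3 \<and> unit_witness x4 \<and>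
    p = (x1 \<oplus>\<^bsub>M\<^esub> x2) \<oplus>\<^bsub>M\<^esub> (x3 \<oplus>\<^bsub>M\<^esub> x4)"
proof -
  interpret nn: ideal \<nn> R by (rule nn)
  note Nc = subsetD[OF submoduleE(1)[OF N(1)]] and Tc = subsetD[OF submoduleE(1)[OF T(1)]]
  \<comment> \<open>For \<open>A\<close> the whole module this yields the first pair, for \<open>A\<close> its complement the second.\<close>
  have unit_pair: "\<exists>n\<in>N. \<exists>t\<in>T. n \<in> A \<and> t \<in> A \<and> B n t = \<one>"
    if A: "p \<in> A" "q \<in> A" "B p q \<notin> \<nn>" "A \<subseteq> carrier M"
      and split: "\<And>n t. n \<in> N \<Longrightarrow> t \<in> T \<Longrightarrow> n \<oplus>\<^bsub>M\<^esub> t \<in> A \<Longrightarrow> n \<in> A \<and> t \<in> A"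
      and scale: "\<And>a x. a \<in> carrier R \<Longrightarrow> x \<in> A \<Longrightarrow> a \<odot>\<^bsub>M\<^esub> x \<in> A" for p q A
  proof -
    obtain n t where nt: "n \<in> N" "t \<in> T" "p = n \<oplus>\<^bsub>M\<^esub> t" using NT[of p] A by auto
    obtain n' t' where nt': "n' \<in> N" "t' \<in> T" "q = n' \<oplus>\<^bsub>M\<^esub> t'" using NT[of q] A by auto
    note [simp] = Nc[OF nt(1)] Tc[OF nt(2)] Nc[OF nt'(1)] Tc[OF nt'(2)]
    have sA: "n \<in> A" "t \<in> A" "n' \<in> A" "t' \<in> A" using split nt nt' A by auto
    have "B p q = B n t' \<oplus> B n' t"
      by (simp add: nt(3) nt'(3) form_simps N(2)[OF nt(1) nt'(1)] T(2)[OF nt(2) nt'(2)] form_sym[of t n'] R.a_comm)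
    then have "B n t' \<notin> \<nn> \<or> B n' t \<notin> \<nn>"
      using A(3) additive_subgroup.a_closed[OF nn.additive_subgroup_axioms] by auto
    then obtain m s where ms: "m \<in> N" "s \<in> T" "m \<in> A" "s \<in> A" "B m s \<notin> \<nn>" using nt nt' sA by blast
    note [simp] = Nc[OF ms(1)] Tc[OF ms(2)]
    have U: "B m s \<in> Units R" by (rule units) (use ms in auto)
    let ?i = "inv B m s"
    have [simp]: "?i \<in> carrier R" using U by simp
    have "B m (?i \<odot>\<^bsub>M\<^esub> s) = \<one>" using U by (simp add: form_simps)
    moreover have "?i \<odot>\<^bsub>M\<^esub> s \<in> T" by (intro submoduleE(4)[OF T(1)] ms) simp
    moreover have "?i \<odot>\<^bsub>M\<^esub> s \<in> A" by (intro scale ms) simp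
    ultimately show ?thesis using ms by blast
  qed
  have "\<exists>n\<in>N. \<exists>t\<in>T. n \<in> carrier M \<and> t \<in> carrier M \<and> B n t = \<one>"
    by (rule unit_pair[of "b 0" _ "c 0"]) (use b c bc nn Nc Tc in auto)
  then obtain z z' where z: "z \<in> N" "z' \<in> T" "B z z' = \<one>" by auto
  note [simp] = Nc[OF z(1)] Tc[OF z(2)] z(3)
  have z'z [simp]: "B z' z = \<one>" using form_sym[of z z'] by simp
  have zz [simp]: "B z z = \<zero>" "B z' z' = \<zero>" using N(2) T(2) z by auto
  obtain p0 q0 where pq: "p0 \<in> plane_complement z z'" "q0 \<in> plane_complement z z'" "B p0 q0 \<notin> \<nn>"
    using complement_unit_pairing[of \<nn> z z' b c] nn b c bc by auto
  have "\<exists>n\<in>N. \<exists>t\<in>T. n \<in> plane_complement z z' \<and> t \<in> plane_complement z z' \<and> B n t = \<one>"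
  proof (rule unit_pair[OF pq])
    show "plane_complement z z' \<subseteq> carrier M" by (auto simp: plane_complement_def)
    show "a \<odot>\<^bsub>M\<^esub> x \<in> plane_complement z z'" if "a \<in> carrier R" "x \<in> plane_complement z z'" for a x
      using that by (auto simp: plane_complement_def form_simps)
    show "n \<in> plane_complement z z' \<and> t \<in> plane_complement z z'"
      if nt: "n \<in> N" "t \<in> T" "n \<oplus>\<^bsub>M\<^esub> t \<in> plane_complement z z'" for n t
    proof -
      note [simp] = Nc[OF nt(1)] Tc[OF nt(2)]
      have "B n z = \<zero>" "B t z' = \<zero>" using N(2)[OF nt(1) z(1)] T(2)[OF nt(2) z(2)] by auto
      then show ?thesis using nt(3) by (simp add: plane_complement_def form_simps)
    qed
  qed
  then obtain y y' where y: "y \<in> N" "y' \<in> T" "y \<in> plane_complement z z'" "y' \<in> plane_complement z z'" "B y y' = \<one>"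
    by auto
  note [simp] = plane_complementD[OF y(3)] plane_complementD[OF y(4)] y(5)
  have yy [simp]: "B y y = \<zero>" "B y' y' = \<zero>" using N(2) T(2) y by auto
  have main: "\<exists>x1 x2. unit_witness x1 \<and> unit_witness x2 \<and> m = x1 \<oplus>\<^bsub>M\<^esub> x2"
    if g: "g \<in> carrier M" "g' \<in> carrier M" "B g g = \<zero>" "B g' g' = \<zero>" "B g' g = \<one>"
      "B g y = \<zero>" "B g y' = \<zero>" "B g' y = \<zero>" "B g' y' = \<zero>"
      and m: "m \<in> carrier M" "B m m = \<zero>" "B m g = \<zero>" for m g g'
  proof -
    note [simp] = g m
    have gg' [simp]: "B g g' = \<one>" using form_sym[of g g'] by simp
    have gm [simp]: "B g m = \<zero>" using form_sym[of g m] by simp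
    let ?a = "B m g'"
    let ?x = "?a \<odot>\<^bsub>M\<^esub> g" and ?x' = "m \<oplus>\<^bsub>M\<^esub> (\<ominus> ?a) \<odot>\<^bsub>M\<^esub> g"
    have "unit_witness ?x" unfolding unit_witness_def
      by (intro conjI bexI[of _ y] bexI[of _ y']) (simp_all add: form_simps)
    moreover have "unit_witness ?x'" unfolding unit_witness_def
      by (intro conjI bexI[of _ g] bexI[of _ g']) (simp_all add: form_simps R.r_neg)
    moreover have "m = ?x \<oplus>\<^bsub>M\<^esub> ?x'" by (simp add: smult_l_minus M.a_lcomm M.r_neg)
    ultimately show ?thesis by blast
  qed
  obtain n t where nt: "n \<in> N" "t \<in> T" "p = n \<oplus>\<^bsub>M\<^esub> t" using NT[OF p] by auto
  note [simp] = Nc[OF nt(1)] Tc[OF nt(2)]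
  have [simp]: "B z y = \<zero>" "B z' y = \<zero>" "B z y' = \<zero>" "B z' y' = \<zero>"
    using y(3,4) form_sym by (auto simp: plane_complement_def)
  obtain x1 x2 where x12: "unit_witness x1" "unit_witness x2" "n = x1 \<oplus>\<^bsub>M\<^esub> x2"
    using main[of z z' n] N(2)[OF nt(1) nt(1)] N(2)[OF nt(1) z(1)] by auto
  obtain x3 x4 where x34: "unit_witness x3" "unit_witness x4" "t = x3 \<oplus>\<^bsub>M\<^esub> x4"
    using main[of z' z t] T(2)[OF nt(2) nt(2)] T(2)[OF nt(2) z(2)] by auto
  show ?thesis using x12 x34 nt(3) by blast
qed

end

section \<open>Arithmetic of fractions\<close>

lemma regular_module_simps [simp]:
  "carrier (regular_module R) = carrier R" "x \<oplus>\<^bsub>regular_module R\<^esub> y = x \<oplus>\<^bsub>R\<^esub> y"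
  "a \<odot>\<^bsub>regular_module R\<^esub> x = a \<otimes>\<^bsub>R\<^esub> x" "\<zero>\<^bsub>regular_module R\<^esub> = \<zero>\<^bsub>R\<^esub>"
  by (simp_all add: regular_module_def)

lemma (in cring) module_regular_module: "module R (regular_module R)"
proof (rule moduleI)
  show "abelian_group (regular_module R)"
    by (rule abelian_groupI) (auto simp: a_ac intro: l_neg)
qed (auto simp: l_distr r_distr m_assoc is_cring)

text \<open>
  Fractions are handled through representatives: once equality of fractions is known to be the usual
  relation, the unions over representatives that define the operations collapse.
\<close>

locale localization = module R M for R (structure) and M (structure) +
  fixes S
  assumes S_carrier: "S \<subseteq> carrier R" and S_one [simp]: "\<one> \<in> S"
    and S_mult [simp]: "s \<in> S \<Longrightarrow> t \<in> S \<Longrightarrow> s \<otimes> t \<in> S"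
begin

lemma S_closed [simp]: "s \<in> S \<Longrightarrow> s \<in> carrier R" using S_carrier by auto

abbreviation fr where "fr \<equiv> fraction R S M"
abbreviation fr\<^sub>R where "fr\<^sub>R \<equiv> fraction R S (regular_module R)"

lemma regular: "localization R (regular_module R) S"
  by (intro localization.intro localization_axioms.intro R.module_regular_module S_carrier S_one S_mult)

lemma fraction_mem: "(y, t) \<in> fr x s \<longleftrightarrow>
    y \<in> carrier M \<and> t \<in> S \<and> (\<exists>u\<in>S. (u \<otimes> t) \<odot>\<^bsub>M\<^esub> x = (u \<otimes> s) \<odot>\<^bsub>M\<^esub> y)"
  if "x \<in> carrier M" "s \<in> S"
  using that by (auto simp: fraction_def smult_assoc1)

lemma fraction_self: "x \<in> carrier M \<Longrightarrow> s \<in> S \<Longrightarrow> (x, s) \<in> fr x s"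
  by (auto simp: fraction_mem intro: bexI[of _ \<one>])

lemma fraction_subset:
  assumes [simp]: "x \<in> carrier M" "s \<in> S" and yt: "(y, t) \<in> fr x s"
  shows "fr y t \<subseteq> fr x s"
proof
  fix p assume "p \<in> fr y t"
  then obtain z r where p: "p = (z, r)" "(z, r) \<in> fr y t" by (cases p) auto
  obtain u where u: "y \<in> carrier M" "t \<in> S" "u \<in> S" "(u \<otimes> t) \<odot>\<^bsub>M\<^esub> x = (u \<otimes> s) \<odot>\<^bsub>M\<^esub> y"
    using yt by (auto simp: fraction_mem)
  obtain v where v: "z \<in> carrier M" "r \<in> S" "v \<in> S" "(v \<otimes> r) \<odot>\<^bsub>M\<^esub> y = (v \<otimes> t) \<odot>\<^bsub>M\<^esub> z"
    using p(2) u by (auto simp: fraction_mem)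
  note [simp] = u(1-3) v(1-3)
  have "((u \<otimes> v \<otimes> t) \<otimes> r) \<odot>\<^bsub>M\<^esub> x = (v \<otimes> r) \<odot>\<^bsub>M\<^esub> ((u \<otimes> t) \<odot>\<^bsub>M\<^esub> x)"
    by (simp add: R.m_ac flip: smult_assoc1)
  also have "\<dots> = (u \<otimes> s) \<odot>\<^bsub>M\<^esub> ((v \<otimes> r) \<odot>\<^bsub>M\<^esub> y)"
    unfolding u(4) by (simp add: R.m_ac flip: smult_assoc1)
  also have "\<dots> = ((u \<otimes> v \<otimes> t) \<otimes> s) \<odot>\<^bsub>M\<^esub> z"
    unfolding v(4) by (simp add: R.m_ac flip: smult_assoc1)
  finally show "p \<in> fr x s" unfolding p(1) by (auto simp: fraction_mem intro!: bexI[of _ "u \<otimes> v \<otimes> t"])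
qed

lemma fraction_mem_sym:
  assumes "x \<in> carrier M" "s \<in> S" "(y, t) \<in> fr x s" shows "(x, s) \<in> fr y t"
proof -
  obtain u where u: "y \<in> carrier M" "t \<in> S" "u \<in> S" "(u \<otimes> t) \<odot>\<^bsub>M\<^esub> x = (u \<otimes> s) \<odot>\<^bsub>M\<^esub> y"
    using assms by (auto simp: fraction_mem)
  then show ?thesis using assms(1,2) by (auto simp: fraction_mem intro!: bexI[of _ u])
qed

lemma fraction_eqI:
  assumes "x \<in> carrier M" "s \<in> S" "y \<in> carrier M" "t \<in> S" "u \<in> S" "(u \<otimes> t) \<odot>\<^bsub>M\<^esub> x = (u \<otimes> s) \<odot>\<^bsub>M\<^esub> y"
  shows "fr x s = fr y t"
proof -
  have yt: "(y, t) \<in> fr x s" using assms by (auto simp: fraction_mem)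
  show ?thesis
    using fraction_subset[OF assms(1,2) yt] fraction_subset[OF assms(3,4) fraction_mem_sym[OF assms(1,2) yt]] by auto
qed

lemma fraction_eqD:
  assumes "x \<in> carrier M" "s \<in> S" "y \<in> carrier M" "t \<in> S" "fr x s = fr y t"
  obtains u where "u \<in> S" "(u \<otimes> t) \<odot>\<^bsub>M\<^esub> x = (u \<otimes> s) \<odot>\<^bsub>M\<^esub> y"
proof -
  have "(y, t) \<in> fr x s" using fraction_self[OF assms(3,4)] assms(5) by simp
  then show ?thesis using assms(1,2) that by (simp add: fraction_mem) blast
qed

lemma union_over_representatives:
  assumes "x \<in> carrier M" "s \<in> S" "y \<in> carrier N" "t \<in> S" "localization R N S"
    and eq: "\<And>x' s' y' t' u v. x' \<in> carrier M \<Longrightarrow> s' \<in> S \<Longrightarrow> y' \<in> carrier N \<Longrightarrow> t' \<in> S \<Longrightarrow> u \<in> S \<Longrightarrow> v \<in> S \<Longrightarrow>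
       (u \<otimes> s') \<odot>\<^bsub>M\<^esub> x = (u \<otimes> s) \<odot>\<^bsub>M\<^esub> x' \<Longrightarrow> (v \<otimes> t') \<odot>\<^bsub>N\<^esub> y = (v \<otimes> t) \<odot>\<^bsub>N\<^esub> y' \<Longrightarrow>
       F x' s' y' t' = F x s y t"
  shows "(\<Union>(x, s)\<in>fr x s. \<Union>(y, t)\<in>fraction R S N y t. F x s y t) = F x s y t"
proof -
  interpret N: localization R N S by fact
  have const: "F x' s' y' t' = F x s y t"
    if reps: "(x', s') \<in> fr x s" "(y', t') \<in> fraction R S N y t" for x' s' y' t'
  proof -
    obtain u where u: "x' \<in> carrier M" "s' \<in> S" "u \<in> S" "(u \<otimes> s') \<odot>\<^bsub>M\<^esub> x = (u \<otimes> s) \<odot>\<^bsub>M\<^esub> x'"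
      using reps(1) assms(1,2) by (auto simp: fraction_mem)
    obtain v where v: "y' \<in> carrier N" "t' \<in> S" "v \<in> S" "(v \<otimes> t') \<odot>\<^bsub>N\<^esub> y = (v \<otimes> t) \<odot>\<^bsub>N\<^esub> y'"
      using reps(2) assms(3,4) by (auto simp: N.fraction_mem)
    show ?thesis by (rule eq[OF u(1,2) v(1,2) u(3) v(3) u(4) v(4)])
  qed
  have "(x, s) \<in> fr x s" "(y, t) \<in> fraction R S N y t"
    using assms fraction_self N.fraction_self by auto
  then have "F x s y t \<subseteq> (\<Union>(x, s)\<in>fr x s. \<Union>(y, t)\<in>fraction R S N y t. F x s y t)" by blast
  moreover have "(\<Union>(x, s)\<in>fr x s. \<Union>(y, t)\<in>fraction R S N y t. F x s y t) \<subseteq> F x s y t"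
    using const by blast
  ultimately show ?thesis by (rule subset_antisym[rotated])
qed

abbreviation loc where "loc \<equiv> localized_module R S M"

lemma localized_carrier: "carrier loc = {fr x s | x s. x \<in> carrier M \<and> s \<in> S}"
  by (simp add: localized_module_def)

lemma fraction_closed: "x \<in> carrier M \<Longrightarrow> s \<in> S \<Longrightarrow> fr x s \<in> carrier loc"
  by (auto simp: localized_carrier)

lemma localized_zero: "\<zero>\<^bsub>loc\<^esub> = fr \<zero>\<^bsub>M\<^esub> \<one>"
  by (simp add: localized_module_def)

lemma localized_add:
  assumes "x \<in> carrier M" "s \<in> S" "y \<in> carrier M" "t \<in> S"
  shows "fr x s \<oplus>\<^bsub>loc\<^esub> fr y t = fr (t \<odot>\<^bsub>M\<^esub> x \<oplus>\<^bsub>M\<^esub> s \<odot>\<^bsub>M\<^esub> y) (s \<otimes> t)"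
proof -
  let ?F = "\<lambda>x s y t. fr (t \<odot>\<^bsub>M\<^esub> x \<oplus>\<^bsub>M\<^esub> s \<odot>\<^bsub>M\<^esub> y) (s \<otimes> t)"
  have "(\<Union>(x, s)\<in>fr x s. \<Union>(y, t)\<in>fr y t. ?F x s y t) = ?F x s y t"
  proof (rule union_over_representatives[OF assms localization_axioms])
    fix x' s' y' t' u v
    assume a: "x' \<in> carrier M" "s' \<in> S" "y' \<in> carrier M" "t' \<in> S" "u \<in> S" "v \<in> S"
      and e: "(u \<otimes> s') \<odot>\<^bsub>M\<^esub> x = (u \<otimes> s) \<odot>\<^bsub>M\<^esub> x'" "(v \<otimes> t') \<odot>\<^bsub>M\<^esub> y = (v \<otimes> t) \<odot>\<^bsub>M\<^esub> y'"
    note [simp] = a assms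
    have "(u \<otimes> v \<otimes> (s \<otimes> t)) \<odot>\<^bsub>M\<^esub> (t' \<odot>\<^bsub>M\<^esub> x' \<oplus>\<^bsub>M\<^esub> s' \<odot>\<^bsub>M\<^esub> y')
        = (v \<otimes> t \<otimes> t') \<odot>\<^bsub>M\<^esub> ((u \<otimes> s) \<odot>\<^bsub>M\<^esub> x') \<oplus>\<^bsub>M\<^esub> (u \<otimes> s \<otimes> s') \<odot>\<^bsub>M\<^esub> ((v \<otimes> t) \<odot>\<^bsub>M\<^esub> y')"
      by (simp add: smult_r_distr R.m_ac flip: smult_assoc1)
    also have "\<dots> = (u \<otimes> v \<otimes> (s' \<otimes> t')) \<odot>\<^bsub>M\<^esub> (t \<odot>\<^bsub>M\<^esub> x \<oplus>\<^bsub>M\<^esub> s \<odot>\<^bsub>M\<^esub> y)"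
      unfolding e[symmetric] by (simp add: smult_r_distr R.m_ac flip: smult_assoc1)
    finally show "?F x' s' y' t' = ?F x s y t" by (intro fraction_eqI[of _ _ _ _ "u \<otimes> v"]) simp_all
  qed
  then show ?thesis by (simp add: localized_module_def)
qed

lemma localized_smult:
  assumes "a \<in> carrier R" "s \<in> S" "y \<in> carrier M" "t \<in> S"
  shows "fr\<^sub>R a s \<odot>\<^bsub>loc\<^esub> fr y t = fr (a \<odot>\<^bsub>M\<^esub> y) (s \<otimes> t)"
proof -
  interpret reg: localization R "regular_module R" S by (rule regular)
  let ?F = "\<lambda>a s y t. fr (a \<odot>\<^bsub>M\<^esub> y) (s \<otimes> t)"
  have "(\<Union>(a, s)\<in>fr\<^sub>R a s. \<Union>(y, t)\<in>fr y t. ?F a s y t) = ?F a s y t"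
  proof (rule reg.union_over_representatives[OF _ assms(2-4) localization_axioms])
    fix b s' y' t' u v
    assume a: "b \<in> carrier (regular_module R)" "s' \<in> S" "y' \<in> carrier M" "t' \<in> S" "u \<in> S" "v \<in> S"
      and e: "(u \<otimes> s') \<odot>\<^bsub>regular_module R\<^esub> a = (u \<otimes> s) \<odot>\<^bsub>regular_module R\<^esub> b" "(v \<otimes> t') \<odot>\<^bsub>M\<^esub> y = (v \<otimes> t) \<odot>\<^bsub>M\<^esub> y'"
    note [simp] = a(1)[simplified] a(2-) assms
    have "(u \<otimes> v \<otimes> (s \<otimes> t)) \<odot>\<^bsub>M\<^esub> (b \<odot>\<^bsub>M\<^esub> y') = ((u \<otimes> s) \<otimes> b) \<odot>\<^bsub>M\<^esub> ((v \<otimes> t) \<odot>\<^bsub>M\<^esub> y')"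
      by (simp add: R.m_ac flip: smult_assoc1)
    also have "\<dots> = ((u \<otimes> s') \<otimes> a) \<odot>\<^bsub>M\<^esub> ((v \<otimes> t') \<odot>\<^bsub>M\<^esub> y)"
      using e by simp
    also have "\<dots> = (u \<otimes> v \<otimes> (s' \<otimes> t')) \<odot>\<^bsub>M\<^esub> (a \<odot>\<^bsub>M\<^esub> y)"
      by (simp add: R.m_ac flip: smult_assoc1)
    finally show "?F b s' y' t' = ?F a s y t" by (intro fraction_eqI[of _ _ _ _ "u \<otimes> v"]) simp_all
  qed (use assms in simp)
  then show ?thesis by (simp add: localized_module_def)
qed

lemma localized_form_fraction:
  assumes form: "symmetric_form_module R M B h"
    and "x \<in> carrier M" "s \<in> S" "y \<in> carrier M" "t \<in> S"
  shows "localized_form R S B (fr x s) (fr y t) = fr\<^sub>R (B x y) (s \<otimes> t)"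
proof -
  interpret symmetric_form_module R M B h by (rule form)
  interpret reg: localization R "regular_module R" S by (rule regular)
  let ?F = "\<lambda>x s y t. fr\<^sub>R (B x y) (s \<otimes> t)"
  have "(\<Union>(x, s)\<in>fr x s. \<Union>(y, t)\<in>fr y t. ?F x s y t) = ?F x s y t"
  proof (rule union_over_representatives[OF assms(2-5) localization_axioms])
    fix x' s' y' t' u v
    assume a: "x' \<in> carrier M" "s' \<in> S" "y' \<in> carrier M" "t' \<in> S" "u \<in> S" "v \<in> S"
      and e: "(u \<otimes> s') \<odot>\<^bsub>M\<^esub> x = (u \<otimes> s) \<odot>\<^bsub>M\<^esub> x'" "(v \<otimes> t') \<odot>\<^bsub>M\<^esub> y = (v \<otimes> t) \<odot>\<^bsub>M\<^esub> y'"
    note [simp] = a assms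
    have "(u \<otimes> v \<otimes> (s \<otimes> t)) \<otimes> B x' y' = B ((u \<otimes> s) \<odot>\<^bsub>M\<^esub> x') ((v \<otimes> t) \<odot>\<^bsub>M\<^esub> y')"
      by (simp add: form_simps R.m_ac)
    also have "\<dots> = (u \<otimes> v \<otimes> (s' \<otimes> t')) \<otimes> B x y"
      unfolding e[symmetric] by (simp add: form_simps R.m_ac)
    finally show "?F x' s' y' t' = ?F x s y t" by (intro reg.fraction_eqI[of _ _ _ _ "u \<otimes> v"]) simp_all
  qed
  then show ?thesis by (simp add: localized_form_def)
qed

lemma localized_ring_simps:
  "carrier (localized_ring R S) = {fr\<^sub>R a s | a s. a \<in> carrier R \<and> s \<in> S}"
  "a \<in> carrier R \<Longrightarrow> s \<in> S \<Longrightarrow> fr\<^sub>R a s \<in> carrier (localized_ring R S)"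
  "\<one>\<^bsub>localized_ring R S\<^esub> = fr\<^sub>R \<one> \<one>" "\<zero>\<^bsub>localized_ring R S\<^esub> = fr\<^sub>R \<zero> \<one>"
  "a \<in> carrier R \<Longrightarrow> s \<in> S \<Longrightarrow> b \<in> carrier R \<Longrightarrow> t \<in> S \<Longrightarrow>
     fr\<^sub>R a s \<oplus>\<^bsub>localized_ring R S\<^esub> fr\<^sub>R b t = fr\<^sub>R (t \<otimes> a \<oplus> s \<otimes> b) (s \<otimes> t)"
  "a \<in> carrier R \<Longrightarrow> s \<in> S \<Longrightarrow> b \<in> carrier R \<Longrightarrow> t \<in> S \<Longrightarrow>
     fr\<^sub>R a s \<otimes>\<^bsub>localized_ring R S\<^esub> fr\<^sub>R b t = fr\<^sub>R (a \<otimes> b) (s \<otimes> t)"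
proof -
  interpret reg: localization R "regular_module R" S by (rule regular)
  show "carrier (localized_ring R S) = {fr\<^sub>R a s | a s. a \<in> carrier R \<and> s \<in> S}"
    "a \<in> carrier R \<Longrightarrow> s \<in> S \<Longrightarrow> fr\<^sub>R a s \<in> carrier (localized_ring R S)"
    "\<one>\<^bsub>localized_ring R S\<^esub> = fr\<^sub>R \<one> \<one>" "\<zero>\<^bsub>localized_ring R S\<^esub> = fr\<^sub>R \<zero> \<one>"
    by (auto simp: localized_ring_def reg.localized_carrier reg.localized_zero)
  show "fr\<^sub>R a s \<oplus>\<^bsub>localized_ring R S\<^esub> fr\<^sub>R b t = fr\<^sub>R (t \<otimes> a \<oplus> s \<otimes> b) (s \<otimes> t)"
    "fr\<^sub>R a s \<otimes>\<^bsub>localized_ring R S\<^esub> fr\<^sub>R b t = fr\<^sub>R (a \<otimes> b) (s \<otimes> t)"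
    if "a \<in> carrier R" "s \<in> S" "b \<in> carrier R" "t \<in> S"
    using reg.localized_add[of a s b t] reg.localized_smult[of a s b t] that by (simp_all add: localized_ring_def)
qed

end

section \<open>Locally split orthogonal modules\<close>

lemma orthogonal_module_symmetric_form:
  fixes R (structure)
  assumes "orthogonal_module R P B" "h \<in> carrier R" "h \<oplus> h = \<one>"
  shows "symmetric_form_module R P B h"
proof -
  interpret orthogonal_module R P B by fact
  have hom: "B z \<in> module_hom R P (regular_module R)" if "z \<in> carrier P" for z using that by (rule linear)
  have right: "B z (x \<oplus>\<^bsub>P\<^esub> y) = B z x \<oplus> B z y" "B z x \<in> carrier R"
    if "x \<in> carrier P" "y \<in> carrier P" "z \<in> carrier P" for x y z
    using hom[OF that(3)] that by (auto simp: module_hom_def)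
  have right_smult: "B z (a \<odot>\<^bsub>P\<^esub> x) = a \<otimes> B z x" if "a \<in> carrier R" "x \<in> carrier P" "z \<in> carrier P" for a x z
    using hom[OF that(3)] that by (auto simp: module_hom_def)
  show ?thesis
  proof (intro symmetric_form_module.intro symmetric_form_module_axioms.intro module_axioms assms(2,3))
    show "B x y \<in> carrier R" if "x \<in> carrier P" "y \<in> carrier P" for x y using right(2)[of y y x] that by simp
    show "B (x \<oplus>\<^bsub>P\<^esub> y) z = B x z \<oplus> B y z" if "x \<in> carrier P" "y \<in> carrier P" "z \<in> carrier P" for x y z
      using right(1)[OF that] that symmetric[of "x \<oplus>\<^bsub>P\<^esub> y" z] symmetric[of x z] symmetric[of y z] by simp
    show "B (a \<odot>\<^bsub>P\<^esub> x) y = a \<otimes> B x y" if "a \<in> carrier R" "x \<in> carrier P" "y \<in> carrier P" for a x y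
      using right_smult[OF that] that symmetric[of "a \<odot>\<^bsub>P\<^esub> x" y] symmetric[of x y] by simp
  qed (rule symmetric)
qed

lemma orthogonal_module_represents:
  assumes "orthogonal_module R P B" "\<phi> \<in> module_hom R P (regular_module R)"
  shows "\<exists>x\<in>carrier P. \<forall>y\<in>carrier P. B x y = \<phi> y"
proof -
  interpret orthogonal_module R P B by fact
  have "restrict \<phi> (carrier P) \<in> dual R P"
    using assms(2) by (auto simp: dual_def module_hom_def)
  then have "restrict \<phi> (carrier P) \<in> (\<lambda>x. restrict (B x) (carrier P)) ` carrier P"
    using nondegenerate by (simp add: bij_betw_def)
  then obtain x where "x \<in> carrier P" "restrict \<phi> (carrier P) = restrict (B x) (carrier P)"
    by (rule imageE)
  then show ?thesis by (metis restrict_apply')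
qed

text \<open>
  Since the localization is given as an orthogonal module, the ring and module axioms of the localized
  structures need no verification; only the arithmetic of fractions does.
\<close>

locale localization_at_maximal = symmetric_form_module R M B h
  for R (structure) and M (structure) and B h +
  fixes \<mm> n
  assumes maximal: "maximalideal \<mm> R"
    and split: "split_orthogonal_module (localized_ring R (carrier R - \<mm>))
      (localized_module R (carrier R - \<mm>) M) (localized_form R (carrier R - \<mm>) B)"
    and free: "free_of_rank (localized_ring R (carrier R - \<mm>)) (localized_module R (carrier R - \<mm>) M) n"
    and rank: "n \<ge> 3"
begin

abbreviation "S \<equiv> carrier R - \<mm>"

lemma ideal_m: "ideal \<mm> R" by (rule maximalideal.axioms(1)[OF maximal])
lemma prime_m: "primeideal \<mm> R" by (rule R.maximalideal_prime[OF maximal])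
lemma one_not_in_m: "\<one> \<notin> \<mm>"
  using ideal.one_imp_carrier[OF ideal_m] maximalideal.I_notcarr[OF maximal] by auto

sublocale L: localization R M S
proof (intro localization.intro localization_axioms.intro module_axioms)
  show "s \<otimes> t \<in> S" if "s \<in> S" "t \<in> S" for s t
    using that primeideal.I_prime[OF prime_m, of s t] by auto
qed (use one_not_in_m in auto)

sublocale LR: localization R "regular_module R" S by (rule L.regular)

abbreviation "A \<equiv> localized_ring R S"
abbreviation "V \<equiv> localized_module R S M"
abbreviation "BV \<equiv> localized_form R S B"

lemma orthogonal_V: "orthogonal_module A V BV" using split by (simp add: split_orthogonal_module_def)

lemma cring_A: "cring A"
  by (rule module.axioms(1)[OF orthogonal_module.axioms(1)[OF orthogonal_V]])

lemma fraction_eq_one: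
  assumes "x \<in> carrier R" "s \<in> S" "L.fr\<^sub>R x s = L.fr\<^sub>R \<one> \<one>" shows "x \<notin> \<mm>"
proof
  assume x: "x \<in> \<mm>"
  obtain u where u: "u \<in> S" "(u \<otimes> \<one>) \<otimes> x = (u \<otimes> s) \<otimes> \<one>"
    using LR.fraction_eqD[of x s \<one> \<one>] assms L.S_one by auto
  then have "u \<otimes> s = u \<otimes> x" using assms by auto
  also have "\<dots> \<in> \<mm>" using x u by (intro ideal.I_l_closed[OF ideal_m]) auto
  finally show False using L.S_mult[OF u(1) assms(2)] by simp
qed

lemma half_in_A: "L.fr\<^sub>R h \<one> \<in> carrier A" "L.fr\<^sub>R h \<one> \<oplus>\<^bsub>A\<^esub> L.fr\<^sub>R h \<one> = \<one>\<^bsub>A\<^esub>"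
proof -
  show "L.fr\<^sub>R h \<one> \<in> carrier A" by (rule L.localized_ring_simps(2)[OF half_closed L.S_one])
  show "L.fr\<^sub>R h \<one> \<oplus>\<^bsub>A\<^esub> L.fr\<^sub>R h \<one> = \<one>\<^bsub>A\<^esub>"
    unfolding L.localized_ring_simps(3) L.localized_ring_simps(5)[OF half_closed L.S_one half_closed L.S_one]
    by (simp add: half_add_half)
qed

sublocale V: symmetric_form_module A V BV "L.fr\<^sub>R h \<one>"
  by (rule orthogonal_module_symmetric_form[OF orthogonal_V half_in_A])

text \<open>The maximal ideal of the local ring \<open>A\<close>.\<close>

definition "\<nn> = {L.fr\<^sub>R x s | x s. x \<in> \<mm> \<and> s \<in> S}"

lemma m_closed: "x \<in> \<mm> \<Longrightarrow> x \<in> carrier R" using ideal.Icarr[OF ideal_m] by auto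

lemma ideal_n: "ideal \<nn> A"
proof (rule idealI[OF cring.axioms(1)[OF cring_A]])
  interpret mm: ideal \<mm> R by (rule ideal_m)
  have mult: "a \<otimes>\<^bsub>A\<^esub> y \<in> \<nn>" if y: "y \<in> \<nn>" and a: "a \<in> carrier A" for a y
  proof -
    obtain x s where xs: "y = L.fr\<^sub>R x s" "x \<in> \<mm>" "s \<in> S" using y by (auto simp: \<nn>_def)
    obtain b t where bt: "a = L.fr\<^sub>R b t" "b \<in> carrier R" "t \<in> S" using a by (auto simp: L.localized_ring_simps(1))
    have "a \<otimes>\<^bsub>A\<^esub> y = L.fr\<^sub>R (b \<otimes> x) (t \<otimes> s)" using xs bt m_closed by (simp add: L.localized_ring_simps)
    moreover have "b \<otimes> x \<in> \<mm>" using xs bt by (intro mm.I_l_closed)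
    ultimately show ?thesis using L.S_mult[OF bt(3) xs(3)] unfolding \<nn>_def by blast
  qed
  have sub: "\<nn> \<subseteq> carrier A" using m_closed L.localized_ring_simps(2) by (auto simp: \<nn>_def)
  show "a \<otimes>\<^bsub>A\<^esub> y \<in> \<nn>" "y \<otimes>\<^bsub>A\<^esub> a \<in> \<nn>" if "y \<in> \<nn>" "a \<in> carrier A" for a y
    using mult[OF that] that sub V.R.m_comm[of y a] by auto
  show "subgroup \<nn> (add_monoid A)"
  proof (rule V.R.add.subgroupI)
    show "\<nn> \<subseteq> carrier A" by (rule sub)
    show "\<nn> \<noteq> {}" unfolding \<nn>_def using additive_subgroup.zero_closed[OF mm.additive_subgroup_axioms] L.S_one by blast
    fix y assume y: "y \<in> \<nn>"
    then have "\<ominus>\<^bsub>A\<^esub> y = (\<ominus>\<^bsub>A\<^esub> \<one>\<^bsub>A\<^esub>) \<otimes>\<^bsub>A\<^esub> y" using sub by (auto simp: V.R.l_minus)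
    then show "\<ominus>\<^bsub>A\<^esub> y \<in> \<nn>" using mult[OF y, of "\<ominus>\<^bsub>A\<^esub> \<one>\<^bsub>A\<^esub>"] by simp
    fix y' assume y': "y' \<in> \<nn>"
    obtain x s where xs: "y = L.fr\<^sub>R x s" "x \<in> \<mm>" "s \<in> S" using y by (auto simp: \<nn>_def)
    obtain x' s' where xs': "y' = L.fr\<^sub>R x' s'" "x' \<in> \<mm>" "s' \<in> S" using y' by (auto simp: \<nn>_def)
    have "y \<oplus>\<^bsub>A\<^esub> y' = L.fr\<^sub>R (s' \<otimes> x \<oplus> s \<otimes> x') (s \<otimes> s')" using xs xs' m_closed by (simp add: L.localized_ring_simps)
    moreover have "s' \<otimes> x \<oplus> s \<otimes> x' \<in> \<mm>"
      using xs xs' by (intro additive_subgroup.a_closed[OF mm.additive_subgroup_axioms] mm.I_l_closed) auto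
    ultimately show "y \<oplus>\<^bsub>A\<^esub> y' \<in> \<nn>" using L.S_mult[OF xs(3) xs'(3)] unfolding \<nn>_def by blast
  qed
qed

lemma one_not_in_n: "\<one>\<^bsub>A\<^esub> \<notin> \<nn>"
proof
  assume "\<one>\<^bsub>A\<^esub> \<in> \<nn>"
  then obtain x s where "L.fr\<^sub>R \<one> \<one> = L.fr\<^sub>R x s" "x \<in> \<mm>" "s \<in> S"
    unfolding \<nn>_def L.localized_ring_simps(3) by blast
  from fraction_eq_one[OF m_closed[OF this(2)] this(3) this(1)[symmetric]] this(2) show False by contradiction
qed

lemma units_A:
  assumes "a \<in> carrier A" "a \<notin> \<nn>" shows "a \<in> Units A"
proof -
  obtain x s where xs: "a = L.fr\<^sub>R x s" "x \<in> carrier R" "s \<in> S" using assms(1) by (auto simp: L.localized_ring_simps(1))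
  then have "x \<in> S" using assms(2) unfolding \<nn>_def by blast
  then have sx: "x \<in> carrier R" "s \<in> carrier R" "s \<otimes> x \<in> S" using xs L.S_mult by auto
  have "a \<otimes>\<^bsub>A\<^esub> L.fr\<^sub>R s x = L.fr\<^sub>R (x \<otimes> s) (s \<otimes> x)" using xs \<open>x \<in> S\<close> by (simp add: L.localized_ring_simps)
  also have "\<dots> = L.fr\<^sub>R \<one> \<one>"
    by (rule LR.fraction_eqI[of _ _ _ _ \<one>]) (use sx L.S_one in \<open>simp_all add: R.m_comm[of x s]\<close>)
  finally have "a \<otimes>\<^bsub>A\<^esub> L.fr\<^sub>R s x = \<one>\<^bsub>A\<^esub>" by (simp add: L.localized_ring_simps)
  moreover have "L.fr\<^sub>R s x \<in> carrier A" by (rule L.localized_ring_simps(2)[OF sx(2) \<open>x \<in> S\<close>])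
  ultimately show ?thesis using assms(1) V.R.m_comm[of a "L.fr\<^sub>R s x"] by (auto simp: Units_def)
qed

lemma dual_system_V:
  obtains b c :: "nat \<Rightarrow> ('c \<times> 'a) set" where
    "\<And>i. i < 3 \<Longrightarrow> b i \<in> carrier V" "\<And>i. i < 3 \<Longrightarrow> c i \<in> carrier V"
    "\<And>i j. i < 3 \<Longrightarrow> j < 3 \<Longrightarrow> BV (b i) (c j) = (if i = j then \<one>\<^bsub>A\<^esub> else \<zero>\<^bsub>A\<^esub>)"
proof (rule V.dual_system_from_basis[OF orthogonal_module_represents[OF orthogonal_V] free])
  fix b c assume bc: "\<And>i. i < n \<Longrightarrow> b i \<in> carrier V" "\<And>i. i < n \<Longrightarrow> c i \<in> carrier V"
    "\<And>i j. i < n \<Longrightarrow> j < n \<Longrightarrow> BV (b i) (c j) = (if i = j then \<one>\<^bsub>A\<^esub> else \<zero>\<^bsub>A\<^esub>)"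
  show thesis by (rule that[of b c]) (use bc rank in auto)
qed

lemma sum_of_witnesses_V:
  assumes "p \<in> carrier V"
  shows "\<exists>x1 x2 x3 x4. V.unit_witness x1 \<and> V.unit_witness x2 \<and> V.unit_witness x3 \<and> V.unit_witness x4 \<and>
    p = (x1 \<oplus>\<^bsub>V\<^esub> x2) \<oplus>\<^bsub>V\<^esub> (x3 \<oplus>\<^bsub>V\<^esub> x4)"
proof -
  obtain N where N: "direct_summand N A V" "N = orthogonal_complement A V BV N"
    using split by (auto simp: split_orthogonal_module_def)
  have NN: "BV x y = \<zero>\<^bsub>A\<^esub>" if "x \<in> N" "y \<in> N" for x y
  proof -
    have "x \<in> orthogonal_complement A V BV N" by (rule subst[OF N(2)]) (rule that(1))
    then show ?thesis using that(2) unfolding orthogonal_complement_def by blast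
  qed
  have sN: "submodule N A V" using N(1) by (simp add: direct_summand_def)
  show ?thesis
  proof (rule V.totally_isotropic_complement[OF orthogonal_module_represents[OF orthogonal_V] N])
    fix T assume T: "submodule T A V" "\<And>x y. x \<in> T \<Longrightarrow> y \<in> T \<Longrightarrow> BV x y = \<zero>\<^bsub>A\<^esub>"
      "\<And>p. p \<in> carrier V \<Longrightarrow> \<exists>n\<in>N. \<exists>t\<in>T. p = n \<oplus>\<^bsub>V\<^esub> t"
    show ?thesis
      by (rule dual_system_V) (rule V.sum_of_unit_witnesses[OF ideal_n one_not_in_n units_A sN NN T _ _ _ assms])
  qed
qed

text \<open>The vectors of \<open>M\<close> that have a hyperbolic witness outside \<open>\<mm>\<close> once a hyperbolic plane is added.\<close>

definition "witness x \<longleftrightarrow> x \<in> carrier M \<and> B x x = \<zero> \<and>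
  (\<exists>z\<in>carrier M. \<exists>z'\<in>carrier M. B z z = \<zero> \<and> B z' z' = \<zero> \<and> B x z = \<zero> \<and> B x z' = \<zero> \<and> B z z' \<notin> \<mm>)"

lemma form_fraction:
  "x \<in> carrier M \<Longrightarrow> s \<in> S \<Longrightarrow> y \<in> carrier M \<Longrightarrow> t \<in> S \<Longrightarrow>
    BV (L.fr x s) (L.fr y t) = L.fr\<^sub>R (B x y) (s \<otimes> t)"
  by (rule L.localized_form_fraction[OF symmetric_form_module_axioms])

lemma annihilated:
  assumes "x \<in> carrier M" "s \<in> S" "y \<in> carrier M" "t \<in> S" "BV (L.fr x s) (L.fr y t) = \<zero>\<^bsub>A\<^esub>"
  shows "\<exists>u\<in>S. u \<otimes> B x y = \<zero>"
proof -
  have "L.fr\<^sub>R (B x y) (s \<otimes> t) = L.fr\<^sub>R \<zero> \<one>" using assms by (simp add: form_fraction L.localized_ring_simps)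
  then obtain u where "u \<in> S" "(u \<otimes> \<one>) \<otimes> B x y = (u \<otimes> (s \<otimes> t)) \<otimes> \<zero>"
    using LR.fraction_eqD[of "B x y" "s \<otimes> t" \<zero> \<one>] assms L.S_mult L.S_one by auto
  then show ?thesis using assms by (intro bexI[of _ u]) auto
qed

text \<open>
  Every vanishing relation over the localization holds in \<open>M\<close> after multiplication with a scalar outside
  \<open>\<mm>\<close>; finitely many such scalars are collected in \<open>t\<close>, \<open>b\<close> and \<open>b'\<close>.
\<close>

lemma unit_witness_clear_denominators:
  assumes V: "V.unit_witness (L.fr x s)" and x: "x \<in> carrier M" and s: "s \<in> S"
  shows "\<exists>t\<in>S. witness (t \<odot>\<^bsub>M\<^esub> x)"
proof -
  obtain Z Z' where Z: "Z \<in> carrier V" "Z' \<in> carrier V" "BV Z Z = \<zero>\<^bsub>A\<^esub>" "BV Z' Z' = \<zero>\<^bsub>A\<^esub>"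
    "BV (L.fr x s) Z = \<zero>\<^bsub>A\<^esub>" "BV (L.fr x s) Z' = \<zero>\<^bsub>A\<^esub>" "BV Z Z' = \<one>\<^bsub>A\<^esub>"
    and xx: "BV (L.fr x s) (L.fr x s) = \<zero>\<^bsub>A\<^esub>"
    using V by (auto simp: V.unit_witness_def)
  obtain z r where z: "Z = L.fr z r" "z \<in> carrier M" "r \<in> S" using Z(1) by (auto simp: L.localized_carrier)
  obtain z' r' where z': "Z' = L.fr z' r'" "z' \<in> carrier M" "r' \<in> S" using Z(2) by (auto simp: L.localized_carrier)
  obtain a where a: "a \<in> S" "a \<otimes> B x x = \<zero>" using annihilated[OF x s x s xx] by blast
  obtain b where b: "b \<in> S" "b \<otimes> B z z = \<zero>" using annihilated[OF z(2,3) z(2,3)] Z(3) z(1) by auto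
  obtain b' where b': "b' \<in> S" "b' \<otimes> B z' z' = \<zero>" using annihilated[OF z'(2,3) z'(2,3)] Z(4) z'(1) by auto
  obtain c where c: "c \<in> S" "c \<otimes> B x z = \<zero>" using annihilated[OF x s z(2,3)] Z(5) z(1) by auto
  obtain c' where c': "c' \<in> S" "c' \<otimes> B x z' = \<zero>" using annihilated[OF x s z'(2,3)] Z(6) z'(1) by auto
  note SS = a(1) b(1) b'(1) c(1) c'(1)
  have [simp]: "a \<in> carrier R" "b \<in> carrier R" "b' \<in> carrier R" "c \<in> carrier R" "c' \<in> carrier R" using SS by auto
  note [simp] = x z(2) z'(2)
  define t where "t = a \<otimes> (c \<otimes> c')"
  have t: "t \<in> S" unfolding t_def by (intro L.S_mult SS)
  have [simp]: "t \<in> carrier R" using t by auto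
  have kill: "a \<otimes> y = \<zero> \<Longrightarrow> t \<otimes> y = \<zero>" "c \<otimes> y = \<zero> \<Longrightarrow> t \<otimes> y = \<zero>" "c' \<otimes> y = \<zero> \<Longrightarrow> t \<otimes> y = \<zero>"
    if y: "y \<in> carrier R" for y
  proof -
    have e: "t \<otimes> y = (c \<otimes> c') \<otimes> (a \<otimes> y)" "t \<otimes> y = (a \<otimes> c') \<otimes> (c \<otimes> y)" "t \<otimes> y = (a \<otimes> c) \<otimes> (c' \<otimes> y)"
      using y by (simp_all add: t_def R.m_ac)
    show "a \<otimes> y = \<zero> \<Longrightarrow> t \<otimes> y = \<zero>" by (subst e(1)) simp
    show "c \<otimes> y = \<zero> \<Longrightarrow> t \<otimes> y = \<zero>" by (subst e(2)) simp
    show "c' \<otimes> y = \<zero> \<Longrightarrow> t \<otimes> y = \<zero>" by (subst e(3)) simp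
  qed
  have 1: "B (t \<odot>\<^bsub>M\<^esub> x) (t \<odot>\<^bsub>M\<^esub> x) = \<zero>" using kill[of "B x x"] a(2) by (simp add: form_simps)
  have 2: "B (b \<odot>\<^bsub>M\<^esub> z) (b \<odot>\<^bsub>M\<^esub> z) = \<zero>" by (simp add: form_simps b(2))
  have 3: "B (b' \<odot>\<^bsub>M\<^esub> z') (b' \<odot>\<^bsub>M\<^esub> z') = \<zero>" by (simp add: form_simps b'(2))
  have 4: "B (t \<odot>\<^bsub>M\<^esub> x) (b \<odot>\<^bsub>M\<^esub> z) = \<zero>"
    using kill[of "B x z"] c(2) by (simp add: form_simps R.m_lcomm[of t])
  have 5: "B (t \<odot>\<^bsub>M\<^esub> x) (b' \<odot>\<^bsub>M\<^esub> z') = \<zero>"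
    using kill[of "B x z'"] c'(2) by (simp add: form_simps R.m_lcomm[of t])
  have "L.fr\<^sub>R (B z z') (r \<otimes> r') = L.fr\<^sub>R \<one> \<one>"
    using Z(7) z z' by (simp add: form_fraction L.localized_ring_simps)
  then have "B z z' \<notin> \<mm>" by (intro fraction_eq_one[of _ "r \<otimes> r'"]) (use z z' L.S_mult in auto)
  then have "(b' \<otimes> b) \<otimes> B z z' \<in> S" by (intro L.S_mult) (use SS L.S_mult in auto)
  then have 6: "B (b \<odot>\<^bsub>M\<^esub> z) (b' \<odot>\<^bsub>M\<^esub> z') \<notin> \<mm>" by (simp add: form_simps R.m_assoc)
  have "witness (t \<odot>\<^bsub>M\<^esub> x)"
    unfolding witness_def using 1 2 3 4 5 6
    by (intro conjI bexI[of _ "b \<odot>\<^bsub>M\<^esub> z"] bexI[of _ "b' \<odot>\<^bsub>M\<^esub> z'"]) simp_all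
  with t show ?thesis by blast
qed

text \<open>
  The fractions with a numerator in \<open>Y\<close> are closed under addition and contain every unit witness, hence
  they exhaust the localization.
\<close>

lemma witnesses_span:
  assumes Y: "submodule Y R M" and wit: "\<And>x. witness x \<Longrightarrow> \<exists>s\<in>S. s \<odot>\<^bsub>M\<^esub> x \<in> Y"
    and p: "p \<in> carrier M"
  shows "\<exists>s\<in>S. s \<odot>\<^bsub>M\<^esub> p \<in> Y"
proof -
  note Yc = subsetD[OF submoduleE(1)[OF Y]]
  let ?L = "\<lambda>v. \<exists>y\<in>Y. \<exists>s\<in>S. v = L.fr y s"
  have add: "?L (v \<oplus>\<^bsub>V\<^esub> w)" if vw: "?L v" "?L w" for v w
  proof -
    obtain y s y' s' where ys: "v = L.fr y s" "w = L.fr y' s'" "y \<in> Y" "y' \<in> Y" "s \<in> S" "s' \<in> S" using vw by auto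
    have "v \<oplus>\<^bsub>V\<^esub> w = L.fr (s' \<odot>\<^bsub>M\<^esub> y \<oplus>\<^bsub>M\<^esub> s \<odot>\<^bsub>M\<^esub> y') (s \<otimes> s')" using ys Yc by (simp add: L.localized_add)
    moreover have "s' \<odot>\<^bsub>M\<^esub> y \<oplus>\<^bsub>M\<^esub> s \<odot>\<^bsub>M\<^esub> y' \<in> Y"
      using ys by (intro submoduleE(5)[OF Y] submoduleE(4)[OF Y]) auto
    ultimately show ?thesis using L.S_mult[OF ys(5,6)] by blast
  qed
  have base: "?L v" if v: "V.unit_witness v" for v
  proof -
    have "v \<in> carrier V" using v by (simp add: V.unit_witness_def)
    then obtain x s where xs: "v = L.fr x s" "x \<in> carrier M" "s \<in> S" by (auto simp: L.localized_carrier)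
    obtain t where t: "t \<in> S" "witness (t \<odot>\<^bsub>M\<^esub> x)" using unit_witness_clear_denominators v xs by blast
    obtain r where r: "r \<in> S" "r \<odot>\<^bsub>M\<^esub> (t \<odot>\<^bsub>M\<^esub> x) \<in> Y" using wit[OF t(2)] by blast
    have "v = L.fr (r \<odot>\<^bsub>M\<^esub> (t \<odot>\<^bsub>M\<^esub> x)) (r \<otimes> t \<otimes> s)"
      unfolding xs(1)
    proof (rule L.fraction_eqI[OF xs(2,3) _ L.S_mult[OF L.S_mult[OF r(1) t(1)] xs(3)] L.S_one])
      have [simp]: "r \<in> carrier R" "t \<in> carrier R" "s \<in> carrier R" using r t xs by auto
      show "r \<odot>\<^bsub>M\<^esub> (t \<odot>\<^bsub>M\<^esub> x) \<in> carrier M" using xs by simp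
      show "(\<one> \<otimes> (r \<otimes> t \<otimes> s)) \<odot>\<^bsub>M\<^esub> x = (\<one> \<otimes> s) \<odot>\<^bsub>M\<^esub> (r \<odot>\<^bsub>M\<^esub> (t \<odot>\<^bsub>M\<^esub> x))"
        using xs by (simp add: R.m_ac flip: smult_assoc1)
    qed
    then show ?thesis using r(2) L.S_mult[OF L.S_mult[OF r(1) t(1)] xs(3)] by blast
  qed
  have "L.fr p \<one> \<in> carrier V" by (rule L.fraction_closed[OF p L.S_one])
  from sum_of_witnesses_V[OF this] have "?L (L.fr p \<one>)" using add base by metis
  then obtain y s where ys: "y \<in> Y" "s \<in> S" "L.fr p \<one> = L.fr y s" by blast
  obtain u where u: "u \<in> S" "(u \<otimes> s) \<odot>\<^bsub>M\<^esub> p = (u \<otimes> \<one>) \<odot>\<^bsub>M\<^esub> y"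
    using L.fraction_eqD[OF p L.S_one Yc[OF ys(1)] ys(2,3)] .
  have "(u \<otimes> s) \<odot>\<^bsub>M\<^esub> p \<in> Y" unfolding u(2) using u ys by (intro submoduleE(4)[OF Y]) auto
  then show ?thesis using L.S_mult[OF u(1) ys(2)] by blast
qed

lemma pairing_not_in_m: "\<exists>p\<in>carrier M. \<exists>q\<in>carrier M. B p q \<notin> \<mm>"
proof (rule dual_system_V)
  fix b c :: "nat \<Rightarrow> ('c \<times> 'a) set"
  assume bc: "\<And>i. i < 3 \<Longrightarrow> b i \<in> carrier V" "\<And>i. i < 3 \<Longrightarrow> c i \<in> carrier V"
    "\<And>i j. i < 3 \<Longrightarrow> j < 3 \<Longrightarrow> BV (b i) (c j) = (if i = j then \<one>\<^bsub>A\<^esub> else \<zero>\<^bsub>A\<^esub>)"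
  obtain p s where p: "b 0 = L.fr p s" "p \<in> carrier M" "s \<in> S" using bc(1)[of 0] by (auto simp: L.localized_carrier)
  obtain q t where q: "c 0 = L.fr q t" "q \<in> carrier M" "t \<in> S" using bc(2)[of 0] by (auto simp: L.localized_carrier)
  have "L.fr\<^sub>R (B p q) (s \<otimes> t) = L.fr\<^sub>R \<one> \<one>"
    using bc(3)[of 0 0] p q by (simp add: form_fraction L.localized_ring_simps)
  then have "B p q \<notin> \<mm>" by (intro fraction_eq_one[of _ "s \<otimes> t"]) (use p q L.S_mult in auto)
  then show ?thesis using p q by blast
qed

end

section \<open>The hyperbolic extension and its elementary group\<close>

text \<open>
  The last part reduces normality in the whole group to generators of \<open>H\<close>: the elements of \<open>L\<close> all of
  whose conjugates stay in \<open>L\<close> form a normal subgroup, which contains \<open>H\<close> and hence \<open>L\<close>.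
\<close>

lemma (in group)
  assumes K: "subgroup K G" and HK: "H \<subseteq> K"
  defines "L \<equiv> normal_closure (G\<lparr>carrier := K\<rparr>) H"
  shows normal_closure_subgroup: "subgroup L G"
    and normal_closure_superset: "H \<subseteq> L"
    and normal_closure_conj: "\<And>k l. k \<in> K \<Longrightarrow> l \<in> L \<Longrightarrow> k \<otimes> l \<otimes> inv k \<in> L"
    and normal_closure_normal_in_group:
      "\<And>S. H = generate G S \<Longrightarrow> (\<And>g x. g \<in> carrier G \<Longrightarrow> x \<in> S \<Longrightarrow> g \<otimes> x \<otimes> inv g \<in> L) \<Longrightarrow> L \<lhd> G"
proof -
  let ?K = "G\<lparr>carrier := K\<rparr>"
  interpret K: group ?K by (rule subgroup_imp_group[OF K])
  have invK: "inv\<^bsub>?K\<^esub> x = inv x" if "x \<in> K" for x by (rule m_inv_consistent[OF K that])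
  let ?F = "{N. N \<lhd> ?K \<and> H \<subseteq> N}"
  have L: "L = \<Inter>?F" by (simp add: L_def normal_closure_def)
  have "K \<in> ?F"
    using K.subgroup_self HK subgroup.m_closed[OF K] subgroup.m_inv_closed[OF K] by (auto simp: K.normal_inv_iff invK)
  then have sL: "subgroup L ?K" unfolding L
    by (intro K.subgroups_Inter) (auto simp: normal_imp_subgroup)
  have conj: "k \<otimes> l \<otimes> inv k \<in> L" if "k \<in> K" "l \<in> L" for k l
    using that unfolding L by (auto simp: K.normal_inv_iff invK)
  show HL: "H \<subseteq> L" unfolding L by auto
  show sLG: "subgroup L G" using incl_subgroup[OF K sL] .
  show "\<And>k l. k \<in> K \<Longrightarrow> l \<in> L \<Longrightarrow> k \<otimes> l \<otimes> inv k \<in> L" by (rule conj)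
  note Lc = subsetD[OF subgroup.subset[OF sLG]] and Kc = subsetD[OF subgroup.subset[OF K]]
  fix S assume H: "H = generate G S" and S: "\<And>g x. g \<in> carrier G \<Longrightarrow> x \<in> S \<Longrightarrow> g \<otimes> x \<otimes> inv g \<in> L"
  define N where "N = {l \<in> L. \<forall>g\<in>carrier G. g \<otimes> l \<otimes> inv g \<in> L}"
  have conj_mult: "g \<otimes> (l \<otimes> l') \<otimes> inv g = (g \<otimes> l \<otimes> inv g) \<otimes> (g \<otimes> l' \<otimes> inv g)"
    if [simp]: "g \<in> carrier G" "l \<in> carrier G" "l' \<in> carrier G" for g l l'
    by (simp add: m_assoc) (simp add: m_assoc[symmetric])
  have conj_inv: "g \<otimes> inv l \<otimes> inv g = inv (g \<otimes> l \<otimes> inv g)" if [simp]: "g \<in> carrier G" "l \<in> carrier G" for g l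
    by (simp add: inv_mult_group m_assoc)
  have sN: "subgroup N G"
  proof (rule subgroupI)
    show "N \<subseteq> carrier G" using Lc by (auto simp: N_def)
    have "\<one> \<in> N" using subgroup.one_closed[OF sLG] by (simp add: N_def)
    then show "N \<noteq> {}" by auto
    show "inv a \<in> N" if "a \<in> N" for a
      using that Lc subgroup.m_inv_closed[OF sLG] by (auto simp: N_def conj_inv)
    show "a \<otimes> b \<in> N" if "a \<in> N" "b \<in> N" for a b
      using that Lc subgroup.m_closed[OF sLG] by (auto simp: N_def conj_mult)
  qed
  have Nconj: "k \<otimes> l \<otimes> inv k \<in> N" if l: "l \<in> N" and k: "k \<in> carrier G" for k l
  proof -
    have lc: "l \<in> carrier G" using l Lc by (auto simp: N_def)
    have "g \<otimes> (k \<otimes> l \<otimes> inv k) \<otimes> inv g = (g \<otimes> k) \<otimes> l \<otimes> inv (g \<otimes> k)" if "g \<in> carrier G" for g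
      using that k lc by (simp add: m_assoc inv_mult_group)
    then show ?thesis using l k by (simp add: N_def)
  qed
  have "S \<subseteq> N"
    using HL S generate.incl[of _ S G] unfolding N_def H by blast
  then have "H \<subseteq> N" unfolding H by (rule generate_subgroup_incl[OF _ sN])
  moreover have "N \<subseteq> K" using subgroup.subset[OF sL] by (auto simp: N_def)
  then have "N \<lhd> ?K"
    using Nconj Kc subgroup_incl[OF sN K] by (auto simp: K.normal_inv_iff invK)
  ultimately have "L \<subseteq> N" unfolding L by auto
  then show "L \<lhd> G" using sLG by (auto simp: normal_inv_iff N_def)
qed

lemma hyperbolic_sum_simps [simp]:
  "carrier (hyperbolic_sum R P) = carrier R \<times> carrier R \<times> carrier P"
  "(a, b, p) \<oplus>\<^bsub>hyperbolic_sum R P\<^esub> (c, d, r) = (a \<oplus>\<^bsub>R\<^esub> c, b \<oplus>\<^bsub>R\<^esub> d, p \<oplus>\<^bsub>P\<^esub> r)"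
  "u \<odot>\<^bsub>hyperbolic_sum R P\<^esub> (a, b, p) = (u \<otimes>\<^bsub>R\<^esub> a, u \<otimes>\<^bsub>R\<^esub> b, u \<odot>\<^bsub>P\<^esub> p)"
  "\<zero>\<^bsub>hyperbolic_sum R P\<^esub> = (\<zero>\<^bsub>R\<^esub>, \<zero>\<^bsub>R\<^esub>, \<zero>\<^bsub>P\<^esub>)"
  by (simp_all add: hyperbolic_sum_def)

lemma hyperbolic_form_simp [simp]:
  "hyperbolic_form R B (a, b, p) (c, d, r) = a \<otimes>\<^bsub>R\<^esub> d \<oplus>\<^bsub>R\<^esub> b \<otimes>\<^bsub>R\<^esub> c \<oplus>\<^bsub>R\<^esub> B p r"
  by (simp add: hyperbolic_form_def)

lemma (in module) module_hyperbolic_sum: "module R (hyperbolic_sum R M)"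
proof (rule moduleI)
  show "abelian_group (hyperbolic_sum R M)"
  proof (rule abelian_groupI)
    fix x assume "x \<in> carrier (hyperbolic_sum R M)"
    then show "\<exists>y\<in>carrier (hyperbolic_sum R M). y \<oplus>\<^bsub>hyperbolic_sum R M\<^esub> x = \<zero>\<^bsub>hyperbolic_sum R M\<^esub>"
      by (cases x) (auto intro!: bexI[of _ "(\<ominus> fst x, \<ominus> fst (snd x), \<ominus>\<^bsub>M\<^esub> snd (snd x))"] simp: R.l_neg M.l_neg)
  qed (auto simp: R.a_ac M.a_ac)
qed (auto simp: R.l_distr R.r_distr smult_l_distr smult_r_distr R.m_assoc smult_assoc1 R.is_cring)

lemma (in symmetric_form_module) symmetric_form_hyperbolic:
  "symmetric_form_module R (hyperbolic_sum R M) (hyperbolic_form R B) h"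
  by (intro symmetric_form_module.intro symmetric_form_module_axioms.intro module_hyperbolic_sum half_closed half_add_half)
    (auto simp: form_simps R.l_distr R.r_distr R.m_ac R.a_ac form_sym)

locale hyperbolic_extension = symmetric_form_module R P B h
  for R (structure) and P (structure) and B h
begin

abbreviation "Q \<equiv> hyperbolic_sum R P"
abbreviation "BQ \<equiv> hyperbolic_form R B"

sublocale Q: symmetric_form_module R Q BQ h by (rule symmetric_form_hyperbolic)

definition "e = (\<one>, \<zero>, \<zero>\<^bsub>P\<^esub>)"
definition "f = (\<zero>, \<one>, \<zero>\<^bsub>P\<^esub>)"
definition "emb p = (\<zero>, \<zero>, p)" for p :: 'c

lemma ef_facts: "e \<in> carrier Q" "f \<in> carrier Q" "BQ e e = \<zero>" "BQ f f = \<zero>" "BQ e f = \<one>"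
  by (simp_all add: e_def f_def form_simps)

lemma emb_closed: "p \<in> carrier P \<Longrightarrow> emb p \<in> carrier Q" by (simp add: emb_def)
lemma emb_add: "p \<in> carrier P \<Longrightarrow> q \<in> carrier P \<Longrightarrow> emb (p \<oplus>\<^bsub>P\<^esub> q) = emb p \<oplus>\<^bsub>Q\<^esub> emb q" by (simp add: emb_def)
lemma emb_smult: "a \<in> carrier R \<Longrightarrow> emb (a \<odot>\<^bsub>P\<^esub> q) = a \<odot>\<^bsub>Q\<^esub> emb q" by (simp add: emb_def)
lemma emb_form: "p \<in> carrier P \<Longrightarrow> q \<in> carrier P \<Longrightarrow> BQ (emb p) (emb q) = B p q" by (simp add: emb_def)

lemma complement_eq: "Q.plane_complement e f = emb ` carrier P"
  by (auto simp: Q.plane_complement_def emb_def e_def f_def form_simps)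

lemma rho_eichler:
  assumes "q \<in> carrier P" "isotropic R B q"
  shows "rho R P B q = Q.eichler f (emb (\<ominus>\<^bsub>P\<^esub> q))"
  unfolding rho_def Q.eichler_def
  by (rule restrict_ext) (use assms in \<open>auto simp: f_def emb_def form_simps isotropic_def smult_r_minus
    a_minus_def M.a_ac R.a_ac\<close>)

lemma mu_eichler:
  assumes "q \<in> carrier P" "isotropic R B q"
  shows "mu R P B q = Q.eichler e (emb (\<ominus>\<^bsub>P\<^esub> q))"
  unfolding mu_def Q.eichler_def
  by (rule restrict_ext) (use assms in \<open>auto simp: e_def emb_def form_simps isotropic_def smult_r_minus
    a_minus_def M.a_ac R.a_ac\<close>)

lemma submodule_preimage_emb:
  assumes Y: "submodule Y R Q"
  shows "submodule {p \<in> carrier P. emb p \<in> Y} R P"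
proof (rule submoduleI)
  let ?Y = "{p \<in> carrier P. emb p \<in> Y}"
  show "\<zero>\<^bsub>P\<^esub> \<in> ?Y" using subgroup.one_closed[OF submodule.axioms(1)[OF Y]] by (simp add: emb_def)
  show sm: "a \<odot>\<^bsub>P\<^esub> x \<in> ?Y" if "a \<in> carrier R" "x \<in> ?Y" for a x
    using that Q.submoduleE(4)[OF Y] by (simp add: emb_smult)
  show "\<ominus>\<^bsub>P\<^esub> x \<in> ?Y" if "x \<in> ?Y" for x
    using sm[of "\<ominus> \<one>" x] that by (simp add: smult_l_minus)
  show "x \<oplus>\<^bsub>P\<^esub> y \<in> ?Y" if "x \<in> ?Y" "y \<in> ?Y" for x y
    using that Q.submoduleE(5)[OF Y] by (simp add: emb_add)
qed auto

text \<open>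
  For a fixed \<open>p\<close> the scalars that move \<open>p\<close> into the submodule form an ideal, which no maximal ideal
  contains.
\<close>

lemma locally_spanned_hyperbolic:
  assumes loc: "\<And>\<mm>. maximalideal \<mm> R \<Longrightarrow> localization_at_maximal R P B h \<mm> n"
  shows "Q.locally_spanned e f"
  unfolding Q.locally_spanned_def
proof (intro allI impI)
  fix Y
  assume Y: "submodule Y R Q"
    and wit: "\<forall>\<mm> x t. maximalideal \<mm> R \<longrightarrow> Q.hyperbolic_witness e f x t \<longrightarrow> t \<notin> \<mm> \<longrightarrow>
      (\<exists>s\<in>carrier R - \<mm>. s \<odot>\<^bsub>Q\<^esub> x \<in> Y)"
  let ?Y = "{p \<in> carrier P. emb p \<in> Y}"
  have sY: "submodule ?Y R P" by (rule submodule_preimage_emb[OF Y])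
  have local: "\<exists>s\<in>carrier R - \<mm>. s \<odot>\<^bsub>P\<^esub> p \<in> ?Y" if m: "maximalideal \<mm> R" and p: "p \<in> carrier P" for \<mm> p
  proof -
    interpret loc: localization_at_maximal R P B h \<mm> n by (rule loc[OF m])
    show ?thesis
    proof (rule loc.witnesses_span[OF sY _ p])
      fix x assume "loc.witness x"
      then obtain z z' where z: "x \<in> carrier P" "B x x = \<zero>" "z \<in> carrier P" "z' \<in> carrier P" "B z z = \<zero>" "B z' z' = \<zero>"
        "B x z = \<zero>" "B x z' = \<zero>" "B z z' \<notin> \<mm>"
        unfolding loc.witness_def by blast
      then have "Q.hyperbolic_witness e f (emb x) (B z z')"
        unfolding Q.hyperbolic_witness_def complement_eq
        by (intro conjI bexI[of _ "emb z"] bexI[of _ "emb z'"]) (simp_all add: emb_form)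
      then obtain s where s: "s \<in> carrier R - \<mm>" "s \<odot>\<^bsub>Q\<^esub> emb x \<in> Y" using wit m z(9) by blast
      then have "s \<odot>\<^bsub>P\<^esub> x \<in> ?Y" using z(1) by (simp add: emb_smult)
      with s(1) show "\<exists>s\<in>carrier R - \<mm>. s \<odot>\<^bsub>P\<^esub> x \<in> ?Y" by blast
    qed
  qed
  have "p \<in> ?Y" if p: "p \<in> carrier P" for p
  proof -
    define J where "J = {t \<in> carrier R. t \<odot>\<^bsub>P\<^esub> p \<in> ?Y}"
    have J: "ideal J R"
    proof (rule idealI[OF R.ring_axioms])
      have scale: "a \<otimes> t \<in> J" if "t \<in> J" "a \<in> carrier R" for a t
        using that p submoduleE(4)[OF sY, of a "t \<odot>\<^bsub>P\<^esub> p"] by (simp add: J_def smult_assoc1)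
      show "a \<otimes> t \<in> J" "t \<otimes> a \<in> J" if "t \<in> J" "a \<in> carrier R" for a t
        using scale[OF that] that R.m_comm[of t a] by (auto simp: J_def)
      show "subgroup J (add_monoid R)"
      proof (rule R.add.subgroupI)
        show "J \<subseteq> carrier R" by (auto simp: J_def)
        have "\<zero> \<in> J" using p sY subgroup.one_closed[OF submodule.axioms(1)[OF sY]] by (simp add: J_def)
        then show "J \<noteq> {}" by auto
        fix t assume t: "t \<in> J"
        then have "\<ominus> t = \<ominus> \<one> \<otimes> t" by (simp add: J_def R.l_minus)
        with scale[OF t, of "\<ominus> \<one>"] show "\<ominus> t \<in> J" by simp
        fix t' assume t': "t' \<in> J"
        show "t \<oplus> t' \<in> J"
          using t t' p submoduleE(5)[OF sY, of "t \<odot>\<^bsub>P\<^esub> p" "t' \<odot>\<^bsub>P\<^esub> p"] by (simp add: J_def smult_l_distr)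
      qed
    qed
    have "J = carrier R"
    proof (rule ccontr)
      assume "J \<noteq> carrier R"
      then obtain \<mm> where m: "maximalideal \<mm> R" "J \<subseteq> \<mm>" using R.exists_maximalideal[OF J] by auto
      then show False using local[OF m(1) p] unfolding J_def by blast
    qed
    then have "\<one> \<in> J" by auto
    then show ?thesis using p by (simp add: J_def)
  qed
  then show "Q.plane_complement e f \<subseteq> Y" unfolding complement_eq by auto
qed

lemma locally_unimodular_hyperbolic:
  assumes loc: "\<And>\<mm>. maximalideal \<mm> R \<Longrightarrow> localization_at_maximal R P B h \<mm> n"
  shows "Q.locally_unimodular e f"
  unfolding Q.locally_unimodular_def
proof (intro allI impI)
  fix \<mm> assume m: "maximalideal \<mm> R"
  interpret loc: localization_at_maximal R P B h \<mm> n by (rule loc[OF m])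
  obtain p q where "p \<in> carrier P" "q \<in> carrier P" "B p q \<notin> \<mm>" using loc.pairing_not_in_m by blast
  then show "\<exists>p\<in>Q.plane_complement e f. \<exists>q\<in>Q.plane_complement e f. BQ p q \<notin> \<mm>"
    unfolding complement_eq using emb_form by auto
qed

lemma emb_ideal_times_module:
  assumes "q \<in> ideal_times_module I P" "ideal I R"
  shows "q \<in> carrier P \<and> emb q \<in> ideal_times_module I Q"
  using assms
proof (induction rule: ideal_times_module_induct)
  case zero
  then show ?case using generate.one[of "add_monoid Q"] by (simp add: ideal_times_module_def emb_def)
next
  case (smult c x)
  then have c: "c \<in> carrier R" using ideal.Icarr[OF assms(2)] by auto
  have "c \<odot>\<^bsub>Q\<^esub> emb x \<in> ideal_times_module I Q"
    unfolding ideal_times_module_def using smult emb_closed by (intro generate.incl) blast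
  then show ?case using smult c by (simp add: emb_smult)
next
  case (add x y)
  then have "emb x \<oplus>\<^bsub>Q\<^esub> emb y \<in> ideal_times_module I Q"
    using generate.eng[of "emb x" "add_monoid Q" _ "emb y"] by (simp add: ideal_times_module_def)
  then show ?case using add by (simp add: emb_add)
qed

lemma smult_in_ideal_times_module:
  "c \<in> I \<Longrightarrow> x \<in> carrier P \<Longrightarrow> c \<odot>\<^bsub>P\<^esub> x \<in> ideal_times_module I P"
  unfolding ideal_times_module_def by (intro generate.incl) blast

end

lemma (in symmetric_form_module) isometry_ideal_times_module:
  assumes g: "g \<in> carrier \<O>" and "u \<in> ideal_times_module I M" "ideal I R"
  shows "g u \<in> ideal_times_module I M"
  using assms(2,3)
proof (induction rule: ideal_times_module_induct)
  case zero
  have "g \<zero>\<^bsub>M\<^esub> = \<zero>\<^bsub>M\<^esub>"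
    using isometry_smult[OF g, of \<zero> "\<zero>\<^bsub>M\<^esub>"] isometry_closed[OF g, of "\<zero>\<^bsub>M\<^esub>"] by simp
  then show ?case using generate.one[of "add_monoid M"] by (simp add: ideal_times_module_def)
next
  case (smult c x)
  have "c \<odot>\<^bsub>M\<^esub> g x \<in> ideal_times_module I M"
    unfolding ideal_times_module_def using smult isometry_closed[OF g] by (intro generate.incl) blast
  then show ?case using smult ideal.Icarr[OF assms(3)] isometry_smult[OF g] by simp
next
  case (add x y)
  then have "g x \<oplus>\<^bsub>M\<^esub> g y \<in> ideal_times_module I M"
    using generate.eng[of "g x" "add_monoid M" _ "g y"] by (simp add: ideal_times_module_def)
  then show ?case using add isometry_add[OF g] by simp
qed

lemma half_exists:
  fixes R (structure)
  assumes "cring R" "carrier R = {r \<oplus> r | r. r \<in> carrier R}"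
  obtains h where "h \<in> carrier R" "h \<oplus> h = \<one>"
proof -
  interpret cring R by fact
  have "\<one> \<in> {r \<oplus> r | r. r \<in> carrier R}" using one_closed by (subst (asm) assms(2))
  then show ?thesis using that by auto
qed

lemma localization_at_maximal_locally_split:
  fixes R (structure)
  assumes "locally_split_orthogonal_module R P B" "has_rank R P (2 * n)" "n \<ge> 2"
    and h: "h \<in> carrier R" "h \<oplus> h = \<one>" and m: "maximalideal \<mm> R"
  shows "localization_at_maximal R P B h \<mm> (2 * n)"
proof -
  have orth: "orthogonal_module R P B" using assms(1) by (simp add: locally_split_orthogonal_module_def)
  interpret symmetric_form_module R P B h by (rule orthogonal_module_symmetric_form[OF orth h])
  show ?thesis
    using assms(1,2,3) m R.maximalideal_prime[OF m]
    by (intro localization_at_maximal.intro localization_at_maximal_axioms.intro symmetric_form_module_axioms)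
      (auto simp: locally_split_orthogonal_module_def has_rank_def)
qed

theorem theorem5p20:
  fixes R :: "('a, 'r) ring_scheme" (structure)
    and P :: "('a, 'b, 'm) module_scheme"
    and B :: "'b \<Rightarrow> 'b \<Rightarrow> 'a"
    and I :: "'a set"
    and n :: nat
  assumes "cring R"
    and "carrier R = {r \<oplus> r | r. r \<in> carrier R}"
    and "ideal I R"
    and "locally_split_orthogonal_module R P B"
    and "has_rank R P (2 * n)"
    and "n \<ge> 2"
  shows "ETrans_relative R P B I \<lhd>
    orthogonal_group R (hyperbolic_sum R P) (hyperbolic_form R B)"
proof -
  obtain h where h: "h \<in> carrier R" "h \<oplus> h = \<one>" using half_exists[OF assms(1,2)] .
  have orth: "orthogonal_module R P B" using assms(4) by (simp add: locally_split_orthogonal_module_def)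
  have loc: "localization_at_maximal R P B h \<mm> (2 * n)" if "maximalideal \<mm> R" for \<mm>
    by (rule localization_at_maximal_locally_split[OF assms(4-6) h that])
  interpret hyperbolic_extension R P B h
    by (intro hyperbolic_extension.intro orthogonal_module_symmetric_form[OF orth h])
  have I: "ideal I R" by fact
  have spanned: "Q.locally_spanned e f" by (rule locally_spanned_hyperbolic[OF loc])
  have unimodular: "Q.locally_unimodular e f" by (rule locally_unimodular_hyperbolic[OF loc])
  let ?O = "orthogonal_group R Q BQ"
  let ?K = "ETrans R P B" and ?L = "ETrans_relative R P B I"
  let ?gens = "\<lambda>W. {rho R P B q | q. q \<in> W \<and> isotropic R B q} \<union> {mu R P B q | q. q \<in> W \<and> isotropic R B q}"
  have gens_iso: "rho R P B q \<in> carrier ?O" "mu R P B q \<in> carrier ?O"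
    if "q \<in> carrier P" "isotropic R B q" for q
    using that ef_facts(1-4) complement_eq Q.plane_complementD[of "emb (\<ominus>\<^bsub>P\<^esub> q)" e f] emb_closed[of "\<ominus>\<^bsub>P\<^esub> q"]
    by (simp_all add: rho_eichler mu_eichler Q.eichler_in_isometries)
  have IP: "q \<in> carrier P" if "q \<in> ideal_times_module I P" for q
    using emb_ideal_times_module[OF that I] by simp
  have K: "subgroup ?K ?O"
    unfolding ETrans_def ETrans_on_def by (rule Q.O.generate_is_subgroup) (use gens_iso in auto)
  have rho_K: "rho R P B q \<in> ?K" "mu R P B q \<in> ?K" if "q \<in> carrier P" "isotropic R B q" for q
    unfolding ETrans_def ETrans_on_def using that by (auto intro!: generate.incl)
  have rho_L0: "rho R P B q \<in> ETrans_ideal R P B I" "mu R P B q \<in> ETrans_ideal R P B I"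
    if "q \<in> ideal_times_module I P" "isotropic R B q" for q
    unfolding ETrans_ideal_def ETrans_on_def using that by (auto intro!: generate.incl)
  have HK: "ETrans_ideal R P B I \<subseteq> ?K"
    unfolding ETrans_ideal_def ETrans_on_def
    by (rule Q.O.generate_subgroup_incl[OF _ K]) (use rho_K IP in auto)
  note closure = Q.O.normal_closure_subgroup[OF K HK] Q.O.normal_closure_superset[OF K HK]
    Q.O.normal_closure_conj[OF K HK]
  have L: "subgroup ?L ?O" and HL: "ETrans_ideal R P B I \<subseteq> ?L"
    and conjL: "\<And>k l. k \<in> ?K \<Longrightarrow> l \<in> ?L \<Longrightarrow> k \<otimes>\<^bsub>?O\<^esub> l \<otimes>\<^bsub>?O\<^esub> inv\<^bsub>?O\<^esub> k \<in> ?L"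
    using closure unfolding ETrans_relative_def by auto
  \<comment> \<open>The next two facts are used with \<open>D\<close> the elementary group and \<open>C = R\<close>, and with \<open>D\<close> the relative
    group and \<open>C = I\<close>.\<close>
  have iso_dir: "c \<odot>\<^bsub>Q\<^esub> x \<in> Q.directions D g"
    if D: "\<And>q. q \<in> W \<Longrightarrow> isotropic R B q \<Longrightarrow> rho R P B q \<in> D \<and> mu R P B q \<in> D"
      and W: "\<And>c p. c \<in> C \<Longrightarrow> p \<in> carrier P \<Longrightarrow> c \<odot>\<^bsub>P\<^esub> p \<in> W" and C: "ideal C R"
      and g: "g = e \<or> g = f" and c: "c \<in> C" and x: "x \<in> Q.plane_complement e f" "BQ x x = \<zero>"
    for D W C g c x
  proof -
    obtain p where p: "x = emb p" "p \<in> carrier P" using x complement_eq by auto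
    have c': "c \<in> carrier R" "\<ominus> c \<in> C"
      using ideal.Icarr[OF C c] additive_subgroup.a_inv_closed[OF ideal.axioms(1)[OF C] c] by auto
    let ?q = "(\<ominus> c) \<odot>\<^bsub>P\<^esub> p"
    have iso: "isotropic R B ?q" using x p c' by (simp add: isotropic_def form_simps emb_form)
    have q: "?q \<in> carrier P" "\<ominus>\<^bsub>P\<^esub> ?q = c \<odot>\<^bsub>P\<^esub> p" using p c' by (simp_all add: smult_l_minus)
    note xf = Q.plane_complementD[OF x(1) ef_facts(1,2)]
    have gc: "g \<in> carrier Q" and gx: "BQ g x = \<zero>" using g ef_facts(1,2) xf(4,5) by blast+
    have "c \<odot>\<^bsub>Q\<^esub> x \<in> carrier Q" by (rule Q.smult_closed[OF c'(1) xf(1)])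
    moreover have "BQ g (c \<odot>\<^bsub>Q\<^esub> x) = \<zero>"
      unfolding Q.form_smult_right[OF c'(1) xf(1) gc] gx using c'(1) by simp
    moreover have "Q.eichler g (c \<odot>\<^bsub>Q\<^esub> x) \<in> D"
      using D[OF W[OF c'(2) p(2)] iso] g rho_eichler[OF q(1) iso] mu_eichler[OF q(1) iso] c' p(1)
      by (auto simp: q(2) emb_smult)
    ultimately show ?thesis unfolding Q.directions_def by simp
  qed
  have gen: "Q.eichler g (c \<odot>\<^bsub>Q\<^esub> p) \<in> D"
    if D: "subgroup D ?O" "\<And>q. q \<in> W \<Longrightarrow> isotropic R B q \<Longrightarrow> rho R P B q \<in> D \<and> mu R P B q \<in> D"
      and W: "\<And>c p. c \<in> C \<Longrightarrow> p \<in> carrier P \<Longrightarrow> c \<odot>\<^bsub>P\<^esub> p \<in> W" and C: "ideal C R"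
      and g: "g = e \<or> g = f" and c: "c \<in> C" "p \<in> Q.plane_complement e f"
    for D W C g c p
  proof (rule Q.generators_from_isotropic[OF spanned D(1) _ _ C _ c])
    show "g \<in> carrier Q" "BQ g g = \<zero>" using g ef_facts by auto
    show "c \<odot>\<^bsub>Q\<^esub> x \<in> Q.directions D g" if "c \<in> C" "x \<in> Q.plane_complement e f" "BQ x x = \<zero>" for c x
      by (rule iso_dir[of W D C g c x]) (use D(2) W C g that in auto)
  qed
  have gen_K: "Q.eichler g p \<in> ?K" if "g = e \<or> g = f" "p \<in> Q.plane_complement e f" for g p
    using gen[of ?K "carrier P" "carrier R" g \<one> p] that rho_K K R.oneideal
      Q.plane_complementD(1)[OF that(2) ef_facts(1,2)] by auto
  have gen_L: "Q.eichler g (c \<odot>\<^bsub>Q\<^esub> p) \<in> ?L"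
    if "g = e \<or> g = f" "c \<in> I" "p \<in> Q.plane_complement e f" for g c p
    by (rule gen[of ?L "ideal_times_module I P" I g c p])
      (use that rho_L0 HL L I smult_in_ideal_times_module in auto)
  interpret E: locally_spanned_pair R Q BQ h e f ?K ?L I
    by (intro locally_spanned_pair.intro elementary_pair.intro elementary_pair_axioms.intro
      locally_spanned_pair_axioms.intro Q.symmetric_form_module_axioms ef_facts I K L conjL gen_K gen_L spanned unimodular)
      simp_all
  \<comment> \<open>A conjugate of \<open>E(d,u)\<close> is \<open>E(gd,gu)\<close>, and \<open>gd\<close> is unimodular because \<open>\<langle>gd,gd'\<rangle> = \<one>\<close>.\<close>
  have conj_eichler: "g \<otimes>\<^bsub>?O\<^esub> Q.eichler d u \<otimes>\<^bsub>?O\<^esub> inv\<^bsub>?O\<^esub> g \<in> ?L"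
    if g: "g \<in> carrier ?O" and d: "d \<in> carrier Q" "d' \<in> carrier Q" "BQ d d = \<zero>" "BQ d d' = \<one>"
      and u: "u \<in> carrier Q" "BQ d u = \<zero>" "u \<in> ideal_times_module I Q" for g d d' u
  proof -
    have "g u \<in> Q.directions ?L (g d)"
    proof (rule E.unimodular_directions)
      show "g d \<in> carrier Q" "g d' \<in> carrier Q" "g u \<in> carrier Q" using Q.isometry_closed[OF g] d u by auto
      show "BQ (g d) (g d) = \<zero>" "BQ (g d) (g d') = \<one>" "BQ (g d) (g u) = \<zero>"
        using Q.isometry_form[OF g] d u by auto
      show "g u \<in> ideal_times_module I Q" by (rule Q.isometry_ideal_times_module[OF g u(3) I])
      show "k x \<in> ideal_times_module I Q" if "k \<in> ?K" "x \<in> ideal_times_module I Q" for k x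
        using Q.isometry_ideal_times_module[OF _ that(2) I] that(1) subgroup.subset[OF K] by auto
    qed
    then show ?thesis
      unfolding Q.eichler_conj[OF g d(1) u(1) d(3) u(2)] by (simp add: Q.directions_def)
  qed
  show ?thesis
    unfolding ETrans_relative_def
  proof (rule Q.O.normal_closure_normal_in_group[OF K HK, of "?gens (ideal_times_module I P)"])
    show "ETrans_ideal R P B I = generate ?O (?gens (ideal_times_module I P))"
      by (simp add: ETrans_ideal_def ETrans_on_def)
    fix g x assume g: "g \<in> carrier ?O" and x: "x \<in> ?gens (ideal_times_module I P)"
    obtain q where q: "q \<in> ideal_times_module I P" "isotropic R B q" "x = rho R P B q \<or> x = mu R P B q"
      using x by auto
    let ?u = "emb (\<ominus>\<^bsub>P\<^esub> q)"
    have qc: "q \<in> carrier P" by (rule IP[OF q(1)])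
    have "(\<ominus> \<one>) \<odot>\<^bsub>P\<^esub> q \<in> ideal_times_module I P" by (rule ideal_times_module_smult[OF q(1) I]) simp
    then have u: "?u \<in> ideal_times_module I Q" using emb_ideal_times_module[OF _ I] qc by (simp add: smult_l_minus)
    have up: "?u \<in> Q.plane_complement e f" unfolding complement_eq using qc by simp
    note upf = Q.plane_complementD[OF up ef_facts(1,2)]
    have fe: "BQ f e = \<one>" using ef_facts Q.form_sym by metis
    have "g \<otimes>\<^bsub>?O\<^esub> Q.eichler e ?u \<otimes>\<^bsub>?O\<^esub> inv\<^bsub>?O\<^esub> g \<in> ?L"
      by (rule conj_eichler[OF g ef_facts(1,2,3,5) upf(1,4) u])
    moreover have "g \<otimes>\<^bsub>?O\<^esub> Q.eichler f ?u \<otimes>\<^bsub>?O\<^esub> inv\<^bsub>?O\<^esub> g \<in> ?L"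
      by (rule conj_eichler[OF g ef_facts(2,1,4) fe upf(1,5) u])
    ultimately have "g \<otimes>\<^bsub>?O\<^esub> x \<otimes>\<^bsub>?O\<^esub> inv\<^bsub>?O\<^esub> g \<in> ?L"
      using q(3) rho_eichler[OF qc q(2)] mu_eichler[OF qc q(2)] by auto
    then show "g \<otimes>\<^bsub>?O\<^esub> x \<otimes>\<^bsub>?O\<^esub> inv\<^bsub>?O\<^esub> g
        \<in> normal_closure (?O\<lparr>carrier := ?K\<rparr>) (ETrans_ideal R P B I)"
      by (simp add: ETrans_relative_def)
  qed
qed

end
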